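(* Let $0<p\le\infty$, $d\in\mathbb{N}$ and $r\in\mathbb{N}^d$. Then there are positive constants $C,C'$ depending only on $r,d,p$ such that for every $d$-parallelepiped $Q=[a_1,b_1]\times\cdots\times[a_d,b_d]\subset\mathbb{R}^d$ and every $f\in L_p(Q)$, $$ C'\,\Omega_r(f,\delta)_{p,Q}\ \le\ E_r(f)_{p,Q}\ \le\ C\,\Omega_r(f,\delta)_{p,Q}, $$ where $\delta=\delta(Q)=(b_1-a_1,\dots,b_d-a_d)$ is the size of $Q$.
   Context: Notation: $\mathbb{N}=\{1,2,\dots\}$, $\mathbb{Z}_+$ and $\mathbb{R}_+$ are the non-negative integers and reals, $[d]=\{1,\dots,d\}$. $Q=[a_1,b_1]\times\cdots\times[a_d,b_d]$ with $a_i<b_i$. $L_p(Q)$ is the space of (real-valued, measurable) functions on $Q$ with finite $p$-th integral quasi-norm $\|\cdot\|_{p,Q}$ (ess sup norm if $p=\infty$). $\mathcal{P}_r$ is the set of algebraic polynomials in $x=(x_1,\dots,x_d)$ of degree at most $r_i-1$ in the variable $x_i$ for each $i\in[d]$, and $E_r(f)_{p,Q}:=\inf_{\varphi\in\mathcal{P}_r}\|f-\varphi\|_{p,Q}$. For $m\in\mathbb{Z}_+$, $h\in\mathbb{R}$ and a univariate function $g$, $\Delta_h^m(g,x):=\sum_{j=0}^m(-1)^{m-j}\binom{m}{j}g(x+jh)$ (so $\Delta_h^0(g,x)=g(x)$). For $s\in\mathbb{Z}_+^d$, $h\in\mathbb{R}^d$, the mixed difference operator is $\Delta_h^s:=\prod_{i=1}^d\Delta_{h_i}^{s_i}$,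 where $\Delta_{h_i}^{s_i}$ acts on the variable $x_i$ with the other variables held fixed. For $y\in\mathbb{R}^d$ let $Q_y:=\{x\in Q: x_i,\ x_i+y_i\in[a_i,b_i],\ i\in[d]\}$, and $sh:=(s_1h_1,\dots,s_dh_d)$. For $s\in\mathbb{Z}_+^d$ and $t\in\mathbb{R}_+^d$ the mixed modulus of smoothness is $$\omega_s(f,t)_{p,Q}:=\sup_{|h_i|\le t_i,\ i\in[d]}\|\Delta_h^s(f)\|_{p,Q_{sh}}.$$ For $e\subset[d]$, $r(e)\in\mathbb{Z}_+^d$ is the vector with $r(e)_i=r_i$ for $i\in e$ and $r(e)_i=0$ for $i\notin e$. The total mixed modulus of smoothness of order $r$ is $$\Omega_r(f,t)_{p,Q}:=\sum_{e\subset[d],\ e\ne\varnothing}\omega_{r(e)}(f,t)_{p,Q},\qquad t\in\mathbb{R}_+^d.$$ *)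

theory Defs
  imports "HOL-Analysis.Analysis" "HOL-Probability.Essential_Supremum"
begin

text \<open>
  The dimension $d$ is \<^term>\<open>CARD('d)\<close> for a finite index type \<^typ>\<open>'d\<close>.
  The $L_p$ quasi-norms, and all suprema and infima of them, are taken in \<^typ>\<open>ennreal\<close>,
  so that no boundedness side condition is hidden in \<^const>\<open>Sup\<close> and \<^const>\<open>Inf\<close>.
  Functions on $Q$ are represented by total functions of which only the values on $Q$ matter.
\<close>

definition Lp_norm :: "ennreal \<Rightarrow> (real^'d) set \<Rightarrow> (real^'d \<Rightarrow> real) \<Rightarrow> ennreal" where
  "Lp_norm p S f =
    (if p = \<infinity> then esssup (lebesgue_on S) (\<lambda>x. ennreal \<bar>f x\<bar>)
     else let I = (\<integral>\<^sup>+ x. ennreal (\<bar>f x\<bar> powr enn2real p) \<partial>lebesgue_on S)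
          in if I = \<infinity> then \<infinity> else ennreal (enn2real I powr (1 / enn2real p)))"

definition Lp_space :: "ennreal \<Rightarrow> (real^'d) set \<Rightarrow> (real^'d \<Rightarrow> real) set" where
  "Lp_space p S = {f \<in> borel_measurable (lebesgue_on S). Lp_norm p S f < \<infinity>}"

text \<open>
  Degree at most $r_i - 1$ in $x_i$ is written as \<^term>\<open>k $ i < (r :: nat^'d) $ i\<close>,
  to avoid truncated subtraction.
\<close>

definition polys :: "nat^'d \<Rightarrow> (real^'d \<Rightarrow> real) set" where
  "polys r = {\<phi>. \<exists>c :: nat^'d \<Rightarrow> real.
     \<phi> = (\<lambda>x. \<Sum>k | \<forall>i. k $ i < r $ i. c k * (\<Prod>i\<in>UNIV. (x $ i) ^ (k $ i)))}"

lemma finite_multi_indices: "finite {k :: nat^'d. \<forall>i. k $ i < r $ i}"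
proof (rule finite_subset)
  show "{k :: nat^'d. \<forall>i. k $ i < r $ i} \<subseteq> vec_lambda ` (\<Pi>\<^sub>E i\<in>UNIV. {..<r $ i})"
  proof
    fix k :: "nat^'d"
    assume "k \<in> {k. \<forall>i. k $ i < r $ i}"
    then have "vec_nth k \<in> (\<Pi>\<^sub>E i\<in>UNIV. {..<r $ i})" by (auto simp: PiE_iff)
    then show "k \<in> vec_lambda ` (\<Pi>\<^sub>E i\<in>UNIV. {..<r $ i})"
      by (rule rev_image_eqI) simp
  qed
  show "finite (vec_lambda ` (\<Pi>\<^sub>E i\<in>UNIV. {..<r $ i}) :: (nat^'d) set)"
    by (intro finite_imageI finite_PiE) auto
qed

definition best_approx :: "nat^'d \<Rightarrow> (real^'d \<Rightarrow> real) \<Rightarrow> ennreal \<Rightarrow> (real^'d) set \<Rightarrow> ennreal" where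
  "best_approx r f p Q = (INF \<phi>\<in>polys r. Lp_norm p Q (\<lambda>x. f x - \<phi> x))"

definition fdiff :: "nat \<Rightarrow> real \<Rightarrow> (real \<Rightarrow> real) \<Rightarrow> real \<Rightarrow> real" where
  "fdiff m h g x = (\<Sum>j=0..m. (-1) ^ (m - j) * real (m choose j) * g (x + real j * h))"

definition pdiff :: "'d \<Rightarrow> nat \<Rightarrow> real \<Rightarrow> (real^'d \<Rightarrow> real) \<Rightarrow> real^'d \<Rightarrow> real" where
  "pdiff i m h f = (\<lambda>x. fdiff m h (\<lambda>t. f (\<chi> k. if k = i then t else x $ k)) (x $ i))"

lemma pdiff_commute:
  fixes f :: "real^'d \<Rightarrow> real"
  assumes "i \<noteq> l"
  shows "pdiff i m h (pdiff l n u f) = pdiff l n u (pdiff i m h f)"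
proof
  fix x :: "real^'d"
  have upd: "(\<chi> k. if k = l then (\<chi> k. if k = i then v else x $ k) $ l + w
         else (\<chi> k. if k = i then v else x $ k) $ k) =
      (\<chi> k. if k = i then v else if k = l then x $ l + w else x $ k)"
    "(\<chi> k. if k = i then (\<chi> k. if k = l then w else x $ k) $ i + v
         else (\<chi> k. if k = l then w else x $ k) $ k) =
      (\<chi> k. if k = i then x $ i + v else if k = l then w else x $ k)" for v w
    using assms by (auto simp: vec_eq_iff)
  show "pdiff i m h (pdiff l n u f) x = pdiff l n u (pdiff i m h f) x"
    unfolding pdiff_def fdiff_def sum_distrib_left upd
    by (subst sum.swap) (simp only: upd mult_ac)
qed

lemma comp_fun_commute_pdiff: "comp_fun_commute (\<lambda>i. pdiff i (s $ i) (h $ i))"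
proof
  show "pdiff j (s $ j) (h $ j) \<circ> pdiff i (s $ i) (h $ i) =
      pdiff i (s $ i) (h $ i) \<circ> pdiff j (s $ j) (h $ j)" for i j
    by (cases "i = j") (auto simp: fun_eq_iff pdiff_commute)
qed

text \<open>
  The product (composition) of the pairwise commuting partial difference operators over all
  coordinates; by \<open>comp_fun_commute_pdiff\<close>, the order of composition does not matter.
\<close>

definition mixed_diff :: "nat^'d \<Rightarrow> real^'d \<Rightarrow> (real^'d \<Rightarrow> real) \<Rightarrow> real^'d \<Rightarrow> real" where
  "mixed_diff s h f = Finite_Set.fold (\<lambda>i. pdiff i (s $ i) (h $ i)) f UNIV"

definition shift_dom :: "(real^'d) set \<Rightarrow> real^'d \<Rightarrow> (real^'d) set" where
  "shift_dom Q y = {x \<in> Q. x + y \<in> Q}"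

definition mixed_modulus ::
  "nat^'d \<Rightarrow> (real^'d \<Rightarrow> real) \<Rightarrow> real^'d \<Rightarrow> ennreal \<Rightarrow> (real^'d) set \<Rightarrow> ennreal" where
  "mixed_modulus s f t p Q =
    (SUP h \<in> {h. \<forall>i. \<bar>h $ i\<bar> \<le> t $ i}.
       Lp_norm p (shift_dom Q (\<chi> i. real (s $ i) * h $ i)) (mixed_diff s h f))"

definition restrict_idx :: "nat^'d \<Rightarrow> 'd set \<Rightarrow> nat^'d" where
  "restrict_idx r e = (\<chi> i. if i \<in> e then r $ i else 0)"

definition total_modulus ::
  "nat^'d \<Rightarrow> (real^'d \<Rightarrow> real) \<Rightarrow> real^'d \<Rightarrow> ennreal \<Rightarrow> (real^'d) set \<Rightarrow> ennreal" where
  "total_modulus r f t p Q = (\<Sum>e | e \<noteq> {}. mixed_modulus (restrict_idx r e) f t p Q)"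

end

theory Submission
  imports Defs
begin

text \<open>
  For the lower bound, \<open>\<Delta>\<^sub>h f = \<Delta>\<^sub>h (f - \<phi>)\<close> for every \<open>\<phi> \<in> \<P>\<^sub>r\<close>.

  For the upper bound only the moduli in single coordinate directions are needed. After an affine
  change of variables \<open>Q\<close> is the unit cube. Kemperman's identity passes from differences with equal
  steps to differences with arbitrary small steps near the centre. With these, a local estimate is
  proved by lowering one \<open>r\<^sub>i \<ge> 2\<close> to \<open>r\<^sub>i - 1\<close>: approximate \<open>\<Delta>\<^sub>L f\<close> in direction \<open>i\<close> by a polynomial,
  write that polynomial as \<open>\<Delta>\<^sub>L P\<close>, and put \<open>u = f - P\<close>. As \<open>\<Delta>\<^sub>L u\<close> and the differences of order
  \<open>r\<^sub>i\<close> of \<open>u\<close> are small, so are those of order \<open>r\<^sub>i - 1\<close>, by a contraction argument that needs no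
  averaging and hence also works for \<open>p < 1\<close>. If all \<open>r\<^sub>i = 1\<close>, the value of \<open>f\<close> at a suitable point,
  found with Fubini's theorem, approximates \<open>f\<close>. The approximation extends from a small cube to the
  unit cube because \<open>\<Delta>\<^sub>h\<close> of order \<open>r\<^sub>i\<close> expresses one value of a function by \<open>r\<^sub>i\<close> other ones.
\<close>

section \<open>The p-modular\<close>

text \<open>Two facts about p < 1 shape the argument. The remedy is the lopsided inequality
  \<open>modular_add_sharp\<close>, whose factor on one summand is as close to 1 as desired: halving
  a difference gains 2^(-p), and this outweighs two such factors. Unequal steps are needed because
  lowering the order keeps one step fixed at \<open>L\<close> while the others vary, whereas the
  moduli control equal steps only. Estimates have the form: if certain differences are at most
  \<open>e\<close>, then the error is at most \<open>C * e\<close>, where sizes are p-th powers of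
  quasi-norms (norms for p = \<infinity>). This form is linear in \<open>e\<close>, treats all p
  alike, and lets the Jacobian of the change of variables cancel. Functions are total and Borel, so
  differences need no domain; the finiteness contained in membership in L_p is what permits
  absorption.\<close>

definition ppow :: "ennreal \<Rightarrow> ennreal \<Rightarrow> ennreal" where
  "ppow p t = (if p = \<infinity> then t else if t = \<infinity> then \<infinity> else ennreal (enn2real t powr enn2real p))"

text \<open>Integrating over \<open>lborel\<close> instead of a restricted completion gives direct
  access to translation invariance and Fubini, at the price of working with Borel functions;
  \<open>Lp_norm_le_iff\<close> leads back to the given norm. \<open>ppow\<close> is the matching
  power for constants and bounds.\<close>

definition modular :: "ennreal \<Rightarrow> (real^'d) set \<Rightarrow> (real^'d \<Rightarrow> real) \<Rightarrow> ennreal" where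
  "modular p S f =
    (if p = \<infinity> then esssup lborel (\<lambda>x. ennreal \<bar>f x\<bar> * indicator S x)
     else \<integral>\<^sup>+x\<in>S. ennreal (\<bar>f x\<bar> powr enn2real p) \<partial>lborel)"

lemma ennreal_abs_add_le: "ennreal \<bar>x + y\<bar> \<le> ennreal \<bar>x\<bar> + ennreal \<bar>y\<bar>"
  by (simp flip: ennreal_plus add: ennreal_leI)

lemma enn2real_pos_if: "0 < p \<Longrightarrow> p \<noteq> \<infinity> \<Longrightarrow> 0 < enn2real p"
  by (simp add: enn2real_positive_iff less_top)

lemma ppow_mono: "0 < p \<Longrightarrow> s \<le> t \<Longrightarrow> ppow p s \<le> ppow p t"
  by (auto simp: ppow_def top_unique intro!: ennreal_leI powr_mono2 enn2real_mono simp: less_top)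

lemma ppow_ennreal: "p \<noteq> \<infinity> \<Longrightarrow> 0 \<le> c \<Longrightarrow> ppow p (ennreal c) = ennreal (c powr enn2real p)"
  by (simp add: ppow_def)

lemma ppow_finite: "t < top \<Longrightarrow> ppow p t < top"
  by (auto simp: ppow_def)

lemma ppow_mult:
  assumes "0 < p" shows "ppow p (s * t) = ppow p s * ppow p t"
proof (cases "p = \<infinity>")
  case False
  then have p: "0 < enn2real p" using assms by (rule enn2real_pos_if[rotated])
  show ?thesis
  proof (cases "s = \<infinity> \<or> t = \<infinity>")
    case True
    \<comment> \<open>As \<open>0 * \<infinity> = 0\<close>, the infinite case needs that
      \<open>ppow\<close> vanishes only at 0.\<close>
    have pos: "ennreal (enn2real u powr enn2real p) = 0 \<longleftrightarrow> u = 0" if "u \<noteq> \<infinity>" for u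
      using that p by (auto simp: enn2real_eq_0_iff)
    show ?thesis using True False pos p
      by (auto simp: ppow_def ennreal_mult_top ennreal_top_mult ennreal_mult_eq_top_iff)
  next
    case F: False
    then show ?thesis using False
      by (auto simp: ppow_def ennreal_mult_eq_top_iff enn2real_mult powr_mult ennreal_mult)
  qed
qed (simp add: ppow_def)

lemma modular_top_le_iff:
  assumes [measurable]: "f \<in> borel_measurable borel" "S \<in> sets borel"
  shows "modular top S f \<le> c \<longleftrightarrow> (AE x in lborel. x \<in> S \<longrightarrow> ennreal \<bar>f x\<bar> \<le> c)"
proof
  assume "modular top S f \<le> c"
  then have "AE x in lborel. ennreal \<bar>f x\<bar> * indicator S x \<le> c"
    using esssup_AE[of "\<lambda>x. ennreal \<bar>f x\<bar> * indicator S x" lborel]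
    by (auto simp: modular_def elim!: eventually_mono)
  then show "AE x in lborel. x \<in> S \<longrightarrow> ennreal \<bar>f x\<bar> \<le> c"
    by (rule eventually_mono) (auto simp: indicator_def)
next
  assume "AE x in lborel. x \<in> S \<longrightarrow> ennreal \<bar>f x\<bar> \<le> c"
  then have "AE x in lborel. ennreal \<bar>f x\<bar> * indicator S x \<le> c"
    by (rule eventually_mono) (auto simp: indicator_def)
  then show "modular top S f \<le> c"
    unfolding modular_def by (auto intro!: esssup_I)
qed

lemma modular_top_AE:
  assumes [measurable]: "f \<in> borel_measurable borel" "S \<in> sets borel"
  shows "AE x in lborel. x \<in> S \<longrightarrow> ennreal \<bar>f x\<bar> \<le> modular top S f"
  using modular_top_le_iff[OF assms, of "modular top S f"] by simp

lemma modular_mono: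
  assumes [measurable]: "f \<in> borel_measurable borel" "S \<in> sets borel"
      "g \<in> borel_measurable borel" "T \<in> sets borel"
    and le: "\<And>x. x \<in> S \<Longrightarrow> x \<in> T \<and> \<bar>f x\<bar> \<le> \<bar>g x\<bar>"
  shows "modular p S f \<le> modular p T g"
proof (cases "p = \<infinity>")
  case True
  have "AE x in lborel. x \<in> S \<longrightarrow> ennreal \<bar>f x\<bar> \<le> modular top T g"
    using modular_top_AE[of g T]
    by (auto elim!: eventually_mono dest!: le intro: order_trans[OF ennreal_leI])
  then show ?thesis unfolding True infinity_ennreal_def by (simp add: modular_top_le_iff)
next
  case False
  then show ?thesis unfolding modular_def
    by (auto intro!: nn_integral_mono ennreal_leI powr_mono2 simp: indicator_def le)
qed

lemma modular_0:
  assumes "0 < p" shows "modular p S (\<lambda>x. 0) = 0"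
  using assms esssup_I[of "\<lambda>x. 0::ennreal" lborel 0] by (auto simp: modular_def)

lemma modular_mult_left:
  assumes p: "0 < p" and [measurable]: "f \<in> borel_measurable borel" "S \<in> sets borel"
  shows "modular p S (\<lambda>x. c * f x) \<le> ppow p (ennreal \<bar>c\<bar>) * modular p S f"
proof (cases "p = \<infinity>")
  case True
  have "AE x in lborel. x \<in> S \<longrightarrow> ennreal \<bar>c * f x\<bar> \<le> ennreal \<bar>c\<bar> * modular top S f"
    using modular_top_AE[of f S]
    by (auto elim!: eventually_mono simp: abs_mult ennreal_mult intro!: mult_left_mono)
  then show ?thesis unfolding True infinity_ennreal_def by (simp add: modular_top_le_iff ppow_def)
next
  case False
  then show ?thesis unfolding modular_def
    by (simp add: abs_mult powr_mult ennreal_mult ppow_def mult.assoc nn_integral_cmult)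
qed

lemma modular_uminus: "modular p S (\<lambda>x. - f x) = modular p S f"
  by (simp add: modular_def)

lemma modular_translate:
  assumes [measurable]: "f \<in> borel_measurable borel" "S \<in> sets borel" "T \<in> sets borel"
    and sub: "\<And>x. x \<in> S \<Longrightarrow> x + v \<in> T"
  shows "modular p S (\<lambda>x. f (x + v)) \<le> modular p T f"
proof (cases "p = \<infinity>")
  case True
  have "AE x in distr lborel borel ((+) v). x \<in> T \<longrightarrow> ennreal \<bar>f x\<bar> \<le> modular top T f"
    unfolding lborel_distr_plus using modular_top_AE[of f T] by simp
  then have "AE x in lborel. v + x \<in> T \<longrightarrow> ennreal \<bar>f (v + x)\<bar> \<le> modular top T f"
    by (rule AE_distrD[rotated]) simp
  then have "AE x in lborel. x \<in> S \<longrightarrow> ennreal \<bar>f (x + v)\<bar> \<le> modular top T f"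
    by (rule eventually_mono) (use sub in \<open>auto simp: add.commute\<close>)
  then show ?thesis unfolding True infinity_ennreal_def by (simp add: modular_top_le_iff)
next
  case False
  have "(\<integral>\<^sup>+x\<in>S. ennreal (\<bar>f (x + v)\<bar> powr enn2real p) \<partial>lborel)
      \<le> (\<integral>\<^sup>+x. ennreal (\<bar>f (v + x)\<bar> powr enn2real p) * indicator T (v + x) \<partial>lborel)"
    by (auto intro!: nn_integral_mono simp: indicator_def sub add.commute)
  also have "\<dots> = (\<integral>\<^sup>+x\<in>T. ennreal (\<bar>f x\<bar> powr enn2real p) \<partial>distr lborel borel ((+) v))"
    by (subst nn_integral_distr) auto
  finally show ?thesis using False by (simp add: lborel_distr_plus modular_def)
qed

text \<open>The split is at |y| = d |x|. Below it, y enlarges |x| at most by the factor 1 + d, whose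
  p-th power is \<open>l\<close>; above it, |x| is at most |y| / d.\<close>

lemma powr_add_le_sharp:
  assumes "0 < (p::real)" "1 < l"
  obtains C where "0 \<le> C" "\<And>x y::real. \<bar>x + y\<bar> powr p \<le> l * \<bar>x\<bar> powr p + C * \<bar>y\<bar> powr p"
proof
  define d where "d = l powr (1/p) - 1"
  have d: "0 < d" "(1 + d) powr p = l"
    using assms by (auto simp: d_def powr_powr)
  show "0 \<le> (1 + 1/d) powr p" by simp
  show "\<bar>x + y\<bar> powr p \<le> l * \<bar>x\<bar> powr p + (1 + 1/d) powr p * \<bar>y\<bar> powr p" for x y :: real
  proof (cases "\<bar>y\<bar> \<le> d * \<bar>x\<bar>")
    case True
    then have "\<bar>x + y\<bar> powr p \<le> ((1 + d) * \<bar>x\<bar>) powr p"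
      using assms by (intro powr_mono2) (auto simp: algebra_simps)
    also have "\<dots> = l * \<bar>x\<bar> powr p" using d by (simp add: powr_mult)
    finally show ?thesis by (simp add: add_increasing2)
  next
    case False
    then have "\<bar>x\<bar> \<le> \<bar>y\<bar> / d" using d by (simp add: field_simps)
    then have "\<bar>x + y\<bar> powr p \<le> ((1 + 1/d) * \<bar>y\<bar>) powr p"
      using assms by (intro powr_mono2) (auto simp: algebra_simps)
    also have "\<dots> = (1 + 1/d) powr p * \<bar>y\<bar> powr p" using d by (simp add: powr_mult)
    finally show ?thesis using assms by (simp add: add_increasing)
  qed
qed

text \<open>\<open>C\<close> is fixed before the set and the functions and may be large; only the
  factor of the first summand has to be close to 1. For p = \<infinity> the triangle inequality
  already has the factor 1 on both summands.\<close>

lemma modular_add_sharp: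
  assumes p: "0 < p" and l: "1 < l"
  shows "\<exists>C\<ge>0. \<forall>(S :: (real^'d) set) f g. f \<in> borel_measurable borel \<longrightarrow> g \<in> borel_measurable borel \<longrightarrow> S \<in> sets borel \<longrightarrow>
      modular p S (\<lambda>x. f x + g x) \<le> ennreal l * modular p S f + ennreal C * modular p S g"
proof (cases "p = \<infinity>")
  case True
  show ?thesis
  proof (intro exI[of _ 1] conjI allI impI)
    fix S :: "(real^'d) set" and f g :: "real^'d \<Rightarrow> real"
    assume [measurable]: "f \<in> borel_measurable borel" "g \<in> borel_measurable borel" "S \<in> sets borel"
    have "AE x in lborel. x \<in> S \<longrightarrow> ennreal \<bar>f x + g x\<bar> \<le> modular top S f + modular top S g"
      using modular_top_AE[OF \<open>f \<in> _\<close> \<open>S \<in> _\<close>] modular_top_AE[OF \<open>g \<in> _\<close> \<open>S \<in> _\<close>]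
      by eventually_elim (auto intro: order_trans[OF ennreal_abs_add_le add_mono])
    then have "modular p S (\<lambda>x. f x + g x) \<le> 1 * modular p S f + 1 * modular p S g"
      unfolding True infinity_ennreal_def by (simp add: modular_top_le_iff)
    also have "\<dots> \<le> ennreal l * modular p S f + ennreal 1 * modular p S g"
      using l by (intro add_mono mult_right_mono) (auto simp: ennreal_ge_1)
    finally show "modular p S (\<lambda>x. f x + g x) \<le> ennreal l * modular p S f + ennreal 1 * modular p S g" .
  qed simp
next
  case False
  define q where "q = enn2real p"
  have q: "0 < q" using enn2real_pos_if[OF p False] by (simp add: q_def)
  obtain C where C: "0 \<le> C" "\<And>x y::real. \<bar>x + y\<bar> powr q \<le> l * \<bar>x\<bar> powr q + C * \<bar>y\<bar> powr q"
    using powr_add_le_sharp[OF q l] by blast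
  show ?thesis
  proof (intro exI[of _ C] conjI allI impI C(1))
    fix S :: "(real^'d) set" and f g :: "real^'d \<Rightarrow> real"
    assume [measurable]: "f \<in> borel_measurable borel" "g \<in> borel_measurable borel" "S \<in> sets borel"
    have "modular p S (\<lambda>x. f x + g x) \<le> (\<integral>\<^sup>+x. ennreal l * (ennreal (\<bar>f x\<bar> powr q) * indicator S x)
       + ennreal C * (ennreal (\<bar>g x\<bar> powr q) * indicator S x) \<partial>lborel)"
      unfolding modular_def using False
    proof (simp flip: q_def, intro nn_integral_mono)
      fix x
      have "ennreal (\<bar>f x + g x\<bar> powr q) \<le> ennreal l * ennreal (\<bar>f x\<bar> powr q) + ennreal C * ennreal (\<bar>g x\<bar> powr q)"
        using C l by (simp flip: ennreal_mult ennreal_plus add: ennreal_leI)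
      then show "ennreal (\<bar>f x + g x\<bar> powr q) * indicator S x \<le> ennreal l * (ennreal (\<bar>f x\<bar> powr q) * indicator S x)
       + ennreal C * (ennreal (\<bar>g x\<bar> powr q) * indicator S x)"
        by (auto simp: indicator_def)
    qed
    also have "\<dots> = ennreal l * modular p S f + ennreal C * modular p S g"
      unfolding modular_def using False
      by (simp flip: q_def add: nn_integral_add nn_integral_cmult)
    finally show "modular p S (\<lambda>x. f x + g x) \<le> ennreal l * modular p S f + ennreal C * modular p S g" .
  qed
qed

lemma powr_add_le:
  assumes "0 < (p::real)"
  shows "\<bar>x + y\<bar> powr p \<le> 2 powr p * (\<bar>x\<bar> powr p + \<bar>y\<bar> powr p)"
proof -
  have "\<bar>x + y\<bar> powr p \<le> (2 * max \<bar>x\<bar> \<bar>y\<bar>) powr p"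
    using assms by (intro powr_mono2) auto
  also have "\<dots> \<le> 2 powr p * (\<bar>x\<bar> powr p + \<bar>y\<bar> powr p)"
    by (auto simp: powr_mult max_def)
  finally show ?thesis .
qed

lemma modular_add:
  assumes p: "0 < p" and [measurable]: "f \<in> borel_measurable borel" "g \<in> borel_measurable borel" "S \<in> sets borel"
  shows "modular p S (\<lambda>x. f x + g x) \<le> ppow p 2 * (modular p S f + modular p S g)"
proof (cases "p = \<infinity>")
  case True
  have "AE x in lborel. x \<in> S \<longrightarrow> ennreal \<bar>f x + g x\<bar> \<le> modular top S f + modular top S g"
    using modular_top_AE[OF \<open>f \<in> _\<close> \<open>S \<in> _\<close>] modular_top_AE[OF \<open>g \<in> _\<close> \<open>S \<in> _\<close>]
    by eventually_elim (auto intro: order_trans[OF ennreal_abs_add_le add_mono])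
  then have "modular p S (\<lambda>x. f x + g x) \<le> 1 * (modular p S f + modular p S g)"
    unfolding True infinity_ennreal_def by (simp add: modular_top_le_iff)
  also have "\<dots> \<le> 2 * (modular p S f + modular p S g)"
    by (intro mult_right_mono) auto
  finally show ?thesis by (simp add: True ppow_def)
next
  case False
  define q where "q = enn2real p"
  have q: "0 < q" using enn2real_pos_if[OF p False] by (simp add: q_def)
  have "modular p S (\<lambda>x. f x + g x) \<le> (\<integral>\<^sup>+x. ennreal (2 powr q) * (ennreal (\<bar>f x\<bar> powr q) * indicator S x
     + ennreal (\<bar>g x\<bar> powr q) * indicator S x) \<partial>lborel)"
    unfolding modular_def using False
  proof (simp flip: q_def, intro nn_integral_mono)
    fix x
    have "ennreal (\<bar>f x + g x\<bar> powr q) \<le> ennreal (2 powr q) * (ennreal (\<bar>f x\<bar> powr q) + ennreal (\<bar>g x\<bar> powr q))"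
      using powr_add_le[OF q] by (simp flip: ennreal_mult ennreal_plus add: ennreal_leI)
    then show "ennreal (\<bar>f x + g x\<bar> powr q) * indicator S x \<le>
       ennreal (2 powr q) * (ennreal (\<bar>f x\<bar> powr q) * indicator S x + ennreal (\<bar>g x\<bar> powr q) * indicator S x)"
      by (auto simp: indicator_def)
  qed
  also have "\<dots> = ppow p 2 * (modular p S f + modular p S g)"
    unfolding modular_def ppow_def using False
    by (simp flip: q_def add: nn_integral_add nn_integral_cmult)
  finally show ?thesis .
qed

lemma ppow_2_ge_1: "0 < p \<Longrightarrow> 1 \<le> ppow p 2"
  using ppow_mono[of p 1 2] by (auto simp: ppow_def)

lemma modular_add_le:
  assumes "0 < p" "f \<in> borel_measurable borel" "g \<in> borel_measurable borel" "S \<in> sets borel"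
    and "modular p S f \<le> A" "modular p S g \<le> B"
  shows "modular p S (\<lambda>x. f x + g x) \<le> ppow p 2 * (A + B)"
  using assms by (intro order_trans[OF modular_add] mult_left_mono add_mono) auto

lemma modular_sum_le:
  assumes p: "0 < p" and [measurable]: "S \<in> sets borel"
    and "finite I" "\<And>i. i \<in> I \<Longrightarrow> g i \<in> borel_measurable borel" "\<And>i. i \<in> I \<Longrightarrow> modular p S (g i) \<le> e"
  shows "modular p S (\<lambda>x. \<Sum>i\<in>I. g i x) \<le> (2 * ppow p 2) ^ card I * e"
  using assms(3-)
proof (induction I)
  case empty
  then show ?case using p by (simp add: modular_0)
next
  case (insert i I)
  have "1 \<le> (2 * ppow p 2) ^ card I"
    using ppow_2_ge_1[OF p] by (intro one_le_power) (simp add: mult_2 add_increasing)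
  then have "e \<le> (2 * ppow p 2) ^ card I * e"
    using mult_right_mono[of 1 _ e] by auto
  then have "modular p S (\<lambda>x. g i x + (\<Sum>j\<in>I. g j x))
      \<le> ppow p 2 * ((2 * ppow p 2) ^ card I * e + (2 * ppow p 2) ^ card I * e)"
    using insert by (intro modular_add_le p) (auto intro: order_trans)
  also have "\<dots> = (2 * ppow p 2) ^ card (insert i I) * e"
    using insert by (simp add: mult_2 algebra_simps)
  finally show ?case using insert by simp
qed

lemma modular_mult_left_le:
  assumes "0 < p" "f \<in> borel_measurable borel" "S \<in> sets borel" "modular p S f \<le> e"
  shows "modular p S (\<lambda>x. c * f x) \<le> ppow p (ennreal \<bar>c\<bar>) * e"
  using assms by (intro order_trans[OF modular_mult_left] mult_left_mono) auto

lemma modular_Un: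
  assumes p: "0 < p" and [measurable]: "f \<in> borel_measurable borel" "S \<in> sets borel" "T \<in> sets borel"
  shows "modular p (S \<union> T) f \<le> modular p S f + modular p T f"
proof (cases "p = \<infinity>")
  case True
  have "AE x in lborel. x \<in> S \<union> T \<longrightarrow> ennreal \<bar>f x\<bar> \<le> modular top S f + modular top T f"
    using modular_top_AE[OF \<open>f \<in> _\<close> \<open>S \<in> _\<close>] modular_top_AE[OF \<open>f \<in> _\<close> \<open>T \<in> _\<close>]
    by eventually_elim (auto intro: add_increasing add_increasing2)
  then show ?thesis unfolding True infinity_ennreal_def by (simp add: modular_top_le_iff)
next
  case False
  have "modular p (S \<union> T) f \<le> (\<integral>\<^sup>+x. ennreal (\<bar>f x\<bar> powr enn2real p) * indicator S x
     + ennreal (\<bar>f x\<bar> powr enn2real p) * indicator T x \<partial>lborel)"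
    unfolding modular_def using False by (auto intro!: nn_integral_mono simp: indicator_def)
  then show ?thesis using False by (simp add: modular_def nn_integral_add)
qed

section \<open>Passing between \<open>Lp_norm\<close> and the modular of a Borel version\<close>

lemma borel_measurable_lebesgue_on_AE:
  fixes f f0 :: "'a::euclidean_space \<Rightarrow> real"
  assumes [measurable]: "f0 \<in> borel_measurable borel" "S \<in> sets borel"
    and ae: "AE x in lborel. x \<in> S \<longrightarrow> f x = f0 x"
  shows "f \<in> borel_measurable (lebesgue_on S)"
proof -
  have S: "S \<in> sets lebesgue" by simp
  \<comment> \<open>\<open>f\<close> is arbitrary outside \<open>S\<close>, so \<open>f0\<close>
    replaces it there. Then \<open>g\<close> differs from \<open>f0\<close> only on a null set, all
    of whose subsets are measurable in the completion.\<close>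
  define g where "g = (\<lambda>x. if x \<in> S then f x else f0 x)"
  have "AE x in lebesgue. g x = f0 x"
    unfolding AE_completion_iff using ae by (rule eventually_mono) (auto simp: g_def)
  then have n: "{x. g x \<noteq> f0 x} \<in> null_sets lebesgue"
    by (simp add: completion.AE_iff_null_sets)
  have "g \<in> borel_measurable lebesgue"
  proof (rule measurableI)
    fix A :: "real set" assume [measurable]: "A \<in> sets borel"
    have "f0 -` A \<in> sets lebesgue"
      using measurable_sets_borel[OF assms(1) \<open>A \<in> _\<close>] by simp
    moreover have "g -` A \<inter> {x. g x \<noteq> f0 x} \<in> null_sets lebesgue"
      by (rule completion.complete2[OF _ n]) auto
    ultimately have "(f0 -` A - {x. g x \<noteq> f0 x}) \<union> (g -` A \<inter> {x. g x \<noteq> f0 x}) \<in> sets lebesgue"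
      using n by (blast dest: null_setsD2)
    also have "(f0 -` A - {x. g x \<noteq> f0 x}) \<union> (g -` A \<inter> {x. g x \<noteq> f0 x}) = g -` A" by auto
    finally show "g -` A \<inter> space lebesgue \<in> sets lebesgue" by simp
  qed simp
  then have "g \<in> borel_measurable (lebesgue_on S)"
    by (rule measurable_restrict_space1)
  then show ?thesis
    by (rule measurable_cong[THEN iffD1, rotated]) (auto simp: g_def)
qed

lemma powr_inverse_le_iff:
  assumes "0 < q" "0 \<le> x" "0 \<le> (y::real)"
  shows "x powr (1 / q) \<le> y \<longleftrightarrow> x \<le> y powr q"
proof
  assume "x powr (1 / q) \<le> y"
  then have "(x powr (1 / q)) powr q \<le> y powr q"
    using assms by (intro powr_mono2) auto
  then show "x \<le> y powr q" using assms by (simp add: powr_powr)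
next
  assume "x \<le> y powr q"
  then have "x powr (1 / q) \<le> (y powr q) powr (1 / q)"
    using assms by (intro powr_mono2) auto
  then show "x powr (1 / q) \<le> y" using assms by (simp add: powr_powr)
qed

text \<open>Quasi-norms are compared through their upper bounds \<open>t\<close>: no p-th root
  appears, \<open>t = \<infinity>\<close> is covered, and \<open>f\<close> may be exchanged for a
  Borel function that agrees with it almost everywhere on \<open>S\<close>.\<close>

lemma Lp_norm_le_iff:
  assumes p: "0 < p" and [measurable]: "g \<in> borel_measurable borel" "S \<in> sets borel"
    and ae: "AE x in lborel. x \<in> S \<longrightarrow> f x = g x"
  shows "Lp_norm p S f \<le> t \<longleftrightarrow> modular p S g \<le> ppow p t"
proof (cases "p = \<infinity>")
  case True
  have [measurable]: "f \<in> borel_measurable (lebesgue_on S)"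
    by (rule borel_measurable_lebesgue_on_AE[OF _ _ ae]) auto
  have "Lp_norm p S f \<le> t \<longleftrightarrow> (AE x in lebesgue_on S. ennreal \<bar>f x\<bar> \<le> t)"
  proof
    assume "Lp_norm p S f \<le> t"
    then show "AE x in lebesgue_on S. ennreal \<bar>f x\<bar> \<le> t"
      using esssup_AE[of "\<lambda>x. ennreal \<bar>f x\<bar>" "lebesgue_on S"]
      by (auto simp: Lp_norm_def True elim!: eventually_mono)
  qed (auto simp: Lp_norm_def True intro!: esssup_I)
  also have "\<dots> \<longleftrightarrow> (AE x in lborel. x \<in> S \<longrightarrow> ennreal \<bar>f x\<bar> \<le> t)"
    by (simp add: AE_restrict_space_iff AE_completion_iff)
  also have "\<dots> \<longleftrightarrow> (AE x in lborel. x \<in> S \<longrightarrow> ennreal \<bar>g x\<bar> \<le> t)"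
    by (rule eventually_subst) (use ae in \<open>auto elim!: eventually_mono\<close>)
  also have "\<dots> \<longleftrightarrow> modular p S g \<le> ppow p t"
    using modular_top_le_iff[of g S t] by (simp add: True ppow_def)
  finally show ?thesis .
next
  case False
  define q where "q = enn2real p"
  have q: "0 < q" using enn2real_pos_if[OF p False] by (simp add: q_def)
  define I where "I = modular p S g"
  have "(\<integral>\<^sup>+ x. ennreal (\<bar>f x\<bar> powr q) \<partial>lebesgue_on S)
      = (\<integral>\<^sup>+ x. ennreal (\<bar>f x\<bar> powr q) * indicator S x \<partial>lborel)"
    by (subst nn_integral_restrict_space) (auto simp: nn_integral_completion)
  also have "\<dots> = I"
    unfolding I_def modular_def using False ae
    by (auto simp flip: q_def intro!: nn_integral_cong_AE elim!: eventually_mono simp: indicator_def)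
  finally have eq: "Lp_norm p S f = (if I = \<infinity> then \<infinity> else ennreal (enn2real I powr (1 / q)))"
    unfolding Lp_norm_def q_def[symmetric] Let_def using False by simp
  show ?thesis
  proof (cases "I = \<infinity> \<or> t = \<infinity>")
    case True
    then show ?thesis unfolding eq I_def[symmetric] using False by (auto simp: ppow_def top_unique)
  next
    case F: False
    then obtain x y where "I = ennreal x" "0 \<le> x" "t = ennreal y" "0 \<le> y"
      by (metis ennreal_cases infinity_ennreal_def)
    then show ?thesis unfolding eq I_def[symmetric]
      using False q powr_inverse_le_iff[OF q] by (simp add: ppow_def flip: q_def)
  qed
qed

lemma ppow_surj:
  assumes "0 < p" "0 < C"
  obtains C' where "0 < C'" "ppow p (ennreal C') = ennreal C"
proof (cases "p = \<infinity>")
  case True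
  then show ?thesis using that[of C] assms by (simp add: ppow_def)
next
  case False
  then show ?thesis
    using that[of "C powr (1 / enn2real p)"] assms enn2real_pos_if[OF assms(1) False]
    by (simp add: ppow_def powr_powr)
qed

section \<open>Coordinatewise affine maps\<close>

definition stretch :: "real^'d \<Rightarrow> real^'d \<Rightarrow> real^'d \<Rightarrow> real^'d" where
  "stretch a c x = (\<chi> i. a $ i + c $ i * x $ i)"

text \<open>The Jacobian determinant of \<open>stretch a c\<close>. An essential supremum is not
  rescaled, hence the value 1 for p = \<infinity>.\<close>

definition stretch_factor :: "ennreal \<Rightarrow> real^'d \<Rightarrow> ennreal" where
  "stretch_factor p c = (if p = \<infinity> then 1 else ennreal (\<Prod>i\<in>UNIV. c $ i))"

lemma stretch_measurable [measurable]: "stretch a c \<in> borel_measurable borel"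
  by (intro borel_measurable_continuous_onI)
     (auto simp: stretch_def intro!: continuous_intros continuous_on_vec_lambda)

lemma lborel_stretch:
  assumes c: "\<And>i. 0 < c $ i"
  shows "lborel = density (distr lborel borel (stretch a c)) (\<lambda>_. ennreal (\<Prod>i\<in>UNIV. c $ i))"
proof -
  have Basis: "Basis = (\<lambda>i. axis i 1 :: real^'d) ` UNIV" by (auto simp: Basis_vec_def)
  have inj: "inj (\<lambda>i. axis i 1 :: real^'d)" by (auto simp: inj_on_def axis_eq_axis)
  have st: "stretch a c = (\<lambda>x. a + (\<Sum>j\<in>Basis. ((c \<bullet> j) * (x \<bullet> j)) *\<^sub>R j))"
  proof (intro ext iffD2[OF vec_eq_iff] allI)
    fix x i
    have "(\<Sum>j\<in>Basis. ((c \<bullet> j) * (x \<bullet> j)) *\<^sub>R j) $ i = (\<Sum>k\<in>UNIV. if k = i then c $ k * x $ k else 0)"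
      unfolding Basis sum.reindex[OF inj] o_def sum_component
      by (intro sum.cong refl) (simp add: inner_axis, simp add: axis_def)
    then show "stretch a c x $ i = (a + (\<Sum>j\<in>Basis. ((c \<bullet> j) * (x \<bullet> j)) *\<^sub>R j)) $ i"
      by (simp add: stretch_def)
  qed
  have pr: "(\<Prod>j\<in>Basis. \<bar>c \<bullet> j\<bar>) = (\<Prod>i\<in>UNIV. c $ i)"
    unfolding Basis prod.reindex[OF inj] using c by (auto intro!: prod.cong simp: inner_axis less_imp_le)
  have "c \<bullet> j \<noteq> 0" if "j \<in> Basis" for j
  proof -
    from that obtain i where "j = axis i 1" unfolding Basis by blast
    then show ?thesis using c[of i] by (simp add: inner_axis)
  qed
  from lborel_affine_euclidean[of "\<lambda>j. c \<bullet> j" a, OF this]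
  show ?thesis unfolding st pr .
qed

lemma modular_stretch:
  assumes c: "\<And>i. 0 < c $ i" and [measurable]: "F \<in> borel_measurable borel" "T \<in> sets borel"
  shows "modular p T F = stretch_factor p c * modular p (stretch a c -` T) (\<lambda>x. F (stretch a c x))"
proof -
  define J where "J = (\<Prod>i\<in>UNIV. c $ i)"
  have J: "0 < J" unfolding J_def using c by (intro prod_pos) auto
  have [measurable]: "stretch a c -` T \<in> sets borel"
    using measurable_sets_borel[OF stretch_measurable assms(3)] by simp
  show ?thesis
  proof (cases "p = \<infinity>")
    case True
    have "(AE x in lborel. P x) \<longleftrightarrow> (AE x in lborel. P (stretch a c x))" if [measurable]: "Measurable.pred borel P" for P
    proof -
      have "(AE x in lborel. P x) \<longleftrightarrow> (AE x in density (distr lborel borel (stretch a c)) (\<lambda>_. ennreal J). P x)"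
        unfolding J_def by (rule arg_cong[where f="\<lambda>M. AE x in M. P x", OF lborel_stretch[OF c]])
      also have "\<dots> \<longleftrightarrow> (AE x in lborel. P (stretch a c x))"
        using J by (simp add: AE_density AE_distr_iff)
      finally show ?thesis .
    qed
    from this[of "\<lambda>x. x \<in> T \<longrightarrow> ennreal \<bar>F x\<bar> \<le> t" for t]
    have "modular top T F \<le> t \<longleftrightarrow> modular top (stretch a c -` T) (\<lambda>x. F (stretch a c x)) \<le> t" for t
      by (simp add: modular_top_le_iff)
    then have "modular top T F = modular top (stretch a c -` T) (\<lambda>x. F (stretch a c x))"
      by (meson antisym order_refl)
    then show ?thesis using True by (simp add: stretch_factor_def)
  next
    case False
    have "(\<integral>\<^sup>+x. g x \<partial>lborel) = ennreal J * (\<integral>\<^sup>+x. g (stretch a c x) \<partial>lborel)"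
      if [measurable]: "g \<in> borel_measurable borel" for g
    proof -
      have "(\<integral>\<^sup>+x. g x \<partial>lborel) = (\<integral>\<^sup>+x. g x \<partial>density (distr lborel borel (stretch a c)) (\<lambda>_. ennreal J))"
        unfolding J_def by (rule arg_cong[where f="\<lambda>M. nn_integral M g", OF lborel_stretch[OF c]])
      also have "\<dots> = ennreal J * (\<integral>\<^sup>+x. g (stretch a c x) \<partial>lborel)"
        by (simp add: nn_integral_density nn_integral_distr nn_integral_cmult)
      finally show ?thesis .
    qed
    from this[of "\<lambda>x. ennreal (\<bar>F x\<bar> powr enn2real p) * indicator T x"] show ?thesis
      using False by (simp add: modular_def stretch_factor_def J_def indicator_def)
  qed
qed

section \<open>Iterated differences\<close>

text \<open>The steps form a list because they may differ from each other.
  \<open>idiff_commute\<close> exchanges two such operators, also in different directions, and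
  \<open>idiff_Cons_inner\<close> moves the first step inside, next to \<open>f\<close>.\<close>

primrec idiff :: "'d::finite \<Rightarrow> real list \<Rightarrow> (real^'d \<Rightarrow> real) \<Rightarrow> real^'d \<Rightarrow> real" where
  "idiff i [] f = f"
| "idiff i (h # hs) f = (\<lambda>x. idiff i hs f (x + h *\<^sub>R axis i 1) - idiff i hs f x)"

lemma idiff_measurable [measurable]:
  "f \<in> borel_measurable borel \<Longrightarrow> idiff i hs f \<in> borel_measurable borel"
proof (induction hs)
  case (Cons h hs)
  then have [measurable]: "idiff i hs f \<in> borel_measurable borel" by simp
  show ?case by simp
qed simp

lemma idiff_translate: "idiff i hs (\<lambda>x. f (x + v)) x = idiff i hs f (x + v)"
  by (induction hs arbitrary: x) (auto simp: algebra_simps)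

lemma idiff_add: "idiff i hs (\<lambda>x. f x + g x) x = idiff i hs f x + idiff i hs g x"
  by (induction hs arbitrary: x) auto

lemma idiff_diff: "idiff i hs (\<lambda>x. f x - g x) x = idiff i hs f x - idiff i hs g x"
  by (induction hs arbitrary: x) auto

lemma idiff_cmult: "idiff i hs (\<lambda>x. c * f x) x = c * idiff i hs f x"
  by (induction hs arbitrary: x) (auto simp: algebra_simps)

lemma idiff_append: "idiff i (hs @ ks) f = idiff i hs (idiff i ks f)"
  by (induction hs) auto

lemma idiff_commute: "idiff i hs (idiff j ks f) = idiff j ks (idiff i hs f)"
proof (induction hs)
  case (Cons h hs)
  show ?case
    by (rule ext) (simp add: Cons idiff_diff idiff_translate)
qed simp

lemma idiff_Cons_inner: "idiff i (h # hs) f = idiff i hs (idiff i [h] f)"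
  using idiff_commute[of i "[h]" i hs f] idiff_append[of i "[h]" hs f] by simp

lemma idiff_zero_step: "0 \<in> set hs \<Longrightarrow> idiff i hs f x = 0"
  by (induction hs arbitrary: x) auto

lemma idiff_replicate:
  "idiff i (replicate m h) f x =
     (\<Sum>j=0..m. (-1) ^ (m - j) * real (m choose j) * f (x + (real j * h) *\<^sub>R axis i 1))"
proof (induction m arbitrary: x)
  case (Suc m)
  let ?F = "\<lambda>j. f (x + (real j * h) *\<^sub>R axis i 1)"
  have shift: "f (x + h *\<^sub>R axis i 1 + (real j * h) *\<^sub>R axis i 1) = ?F (Suc j)" for j
    by (simp add: algebra_simps)
  have 1: "(\<Sum>j=0..m. (-1) ^ (m - j) * real (m choose j) * ?F (Suc j))
      = (\<Sum>j=0..Suc m. (case j of 0 \<Rightarrow> 0 | Suc j \<Rightarrow> (-1) ^ (m - j) * real (m choose j)) * ?F j)"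
    by (subst sum.atLeast0_atMost_Suc_shift) simp
  have 2: "(\<Sum>j=0..m. (-1) ^ (m - j) * real (m choose j) * ?F j)
      = (\<Sum>j=0..Suc m. (-1) ^ (m - j) * real (m choose j) * ?F j)"
    by simp
  \<comment> \<open>Pascal's rule: the coefficient with its index shifted by one, minus the
    unshifted one.\<close>
  have "(case j of 0 \<Rightarrow> 0 | Suc j \<Rightarrow> (-1) ^ (m - j) * real (m choose j)) - (-1) ^ (m - j) * real (m choose j)
      = (-1) ^ (Suc m - j) * real (Suc m choose j)" if "j \<le> Suc m" for j
  proof (cases "j = Suc m")
    case False
    then show ?thesis using that by (cases j) (auto simp: Suc_diff_le algebra_simps Suc_diff_Suc[symmetric] diff_Suc_less)
  qed simp
  then have 3: "(\<Sum>j=0..Suc m. (case j of 0 \<Rightarrow> 0 | Suc j \<Rightarrow> (-1) ^ (m - j) * real (m choose j)) * ?F j)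
      - (\<Sum>j=0..Suc m. (-1) ^ (m - j) * real (m choose j) * ?F j)
      = (\<Sum>j=0..Suc m. (-1) ^ (Suc m - j) * real (Suc m choose j) * ?F j)"
    unfolding sum_subtractf[symmetric] left_diff_distrib[symmetric] by (intro sum.cong refl) simp
  show ?case
    unfolding replicate_Suc idiff.simps Suc.IH shift using 1 2 3 by argo
qed simp

lemma pdiff_eq_idiff: "pdiff i m h f = idiff i (replicate m h) f"
proof
  fix x
  have "(\<chi> k. if k = i then x $ i + t else x $ k) = x + t *\<^sub>R axis i 1" for t
    by (auto simp: vec_eq_iff axis_def)
  then show "pdiff i m h f x = idiff i (replicate m h) f x"
    by (simp add: pdiff_def fdiff_def idiff_replicate)
qed

text \<open>The product of \<open>m\<close> first differences is multiplied out; \<open>A\<close>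
  collects the factors that contribute their shifted term. The list is reversed so that its head has
  the largest index, which the induction on \<open>m\<close> peels off, and the exponent
  \<open>m + card A\<close> has the parity of \<open>m - card A\<close>.\<close>

lemma idiff_subsets:
  "idiff i (map w (rev [0..<m])) f x =
     (\<Sum>A\<in>Pow {..<m}. (-1) ^ (m + card A) * f (x + sum w A *\<^sub>R axis i 1))"
proof (induction m arbitrary: x)
  case (Suc m)
  have disj: "Pow {..<m} \<inter> insert m ` Pow {..<m} = {}" by auto
  have inj: "inj_on (insert m) (Pow {..<m})"
    by (rule inj_onI) (metis Diff_insert_absorb PowD lessThan_iff less_irrefl subsetD)
  have "(\<Sum>A\<in>Pow {..<Suc m}. (-1) ^ (Suc m + card A) * f (x + sum w A *\<^sub>R axis i 1))
      = (\<Sum>A\<in>Pow {..<m}. (-1) ^ (Suc m + card A) * f (x + sum w A *\<^sub>R axis i 1))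
      + (\<Sum>A\<in>Pow {..<m}. (-1) ^ (Suc m + card (insert m A)) * f (x + sum w (insert m A) *\<^sub>R axis i 1))"
    unfolding lessThan_Suc Pow_insert
    by (subst sum.union_disjoint[OF _ _ disj]) (auto simp: sum.reindex[OF inj])
  also have "(\<Sum>A\<in>Pow {..<m}. (-1) ^ (Suc m + card (insert m A)) * f (x + sum w (insert m A) *\<^sub>R axis i 1))
      = (\<Sum>A\<in>Pow {..<m}. (-1) ^ (m + card A) * f ((x + w m *\<^sub>R axis i 1) + sum w A *\<^sub>R axis i 1))"
  proof (intro sum.cong refl)
    fix A assume "A \<in> Pow {..<m}"
    then have "finite A" "m \<notin> A" by (auto intro: finite_subset)
    then show "(-1) ^ (Suc m + card (insert m A)) * f (x + sum w (insert m A) *\<^sub>R axis i 1)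
      = (-1) ^ (m + card A) * f ((x + w m *\<^sub>R axis i 1) + sum w A *\<^sub>R axis i 1)"
      by (simp add: algebra_simps)
  qed
  finally show ?case by (simp add: Suc sum_negf)
qed simp

text \<open>Kemperman's identity: the expansion in \<open>j\<close> of the right-hand side gives the products of the
  differences with steps \<open>w k * (1 - j / (k + 1))\<close>, which vanish unless \<open>j = 0\<close>.\<close>

lemma idiff_kemperman:
  "idiff i (map w (rev [0..<m])) f x =
     (\<Sum>A\<in>Pow {..<m}. (-1) ^ card A *
        idiff i (replicate m (- (\<Sum>k\<in>A. w k / real (Suc k)))) f (x + sum w A *\<^sub>R axis i 1))"
proof -
  have "(\<Sum>A\<in>Pow {..<m}. (-1) ^ card A *
        idiff i (replicate m (- (\<Sum>k\<in>A. w k / real (Suc k)))) f (x + sum w A *\<^sub>R axis i 1))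
     = (\<Sum>A\<in>Pow {..<m}. \<Sum>j=0..m. ((-1) ^ (m - j) * real (m choose j) * (-1) ^ m) *
          ((-1) ^ (m + card A) * f (x + (\<Sum>k\<in>A. w k * (1 - real j / real (Suc k))) *\<^sub>R axis i 1)))"
  proof (intro sum.cong refl)
    fix A
    have eq: "x + sum w A *\<^sub>R axis i 1 + (real j * - (\<Sum>k\<in>A. w k / real (Suc k))) *\<^sub>R axis i 1
       = x + (\<Sum>k\<in>A. w k * (1 - real j / real (Suc k))) *\<^sub>R axis i 1" for j
    proof -
      have "(\<Sum>k\<in>A. w k * (1 - real j / real (Suc k))) = sum w A + (real j * - (\<Sum>k\<in>A. w k / real (Suc k)))"
        by (simp only: right_diff_distrib mult_1_right sum_subtractf sum_distrib_left mult_minus_right)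
           (simp add: mult.commute)
      then show ?thesis by (simp only: scaleR_add_left add.assoc)
    qed
    show "(-1) ^ card A * idiff i (replicate m (- (\<Sum>k\<in>A. w k / real (Suc k)))) f (x + sum w A *\<^sub>R axis i 1)
      = (\<Sum>j=0..m. ((-1) ^ (m - j) * real (m choose j) * (-1) ^ m) *
          ((-1) ^ (m + card A) * f (x + (\<Sum>k\<in>A. w k * (1 - real j / real (Suc k))) *\<^sub>R axis i 1)))"
      unfolding idiff_replicate sum_distrib_left eq
      by (intro sum.cong refl) (simp add: power_add mult_ac flip: power_mult_distrib)
  qed
  also have "\<dots> = (\<Sum>j=0..m. ((-1) ^ (m - j) * real (m choose j) * (-1) ^ m) *
      idiff i (map (\<lambda>k. w k * (1 - real j / real (Suc k))) (rev [0..<m])) f x)"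
    by (subst sum.swap) (simp only: idiff_subsets sum_distrib_left)
  also have "\<dots> = (\<Sum>j\<in>{0}. ((-1) ^ (m - j) * real (m choose j) * (-1) ^ m) *
      idiff i (map (\<lambda>k. w k * (1 - real j / real (Suc k))) (rev [0..<m])) f x)"
  proof (intro sum.mono_neutral_right ballI)
    fix j assume j: "j \<in> {0..m} - {0}"
    \<comment> \<open>The index \<open>k = j - 1\<close> lies below \<open>m\<close>, and there
      \<open>1 - j / (k + 1)\<close> is 0.\<close>
    then have "0 \<in> set (map (\<lambda>k. w k * (1 - real j / real (Suc k))) (rev [0..<m]))"
      by (auto simp: image_iff intro!: bexI[of _ "j - 1"])
    then show "((-1) ^ (m - j) * real (m choose j) * (-1) ^ m) *
      idiff i (map (\<lambda>k. w k * (1 - real j / real (Suc k))) (rev [0..<m])) f x = 0"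
      by (simp only: idiff_zero_step mult_zero_right)
  qed auto
  also have "\<dots> = idiff i (map w (rev [0..<m])) f x"
    by (simp flip: power_mult_distrib)
  finally show ?thesis ..
qed

section \<open>Polynomials of bounded coordinate degree\<close>

definition monomial :: "nat^'d \<Rightarrow> real^'d \<Rightarrow> real" where
  "monomial k x = (\<Prod>i\<in>UNIV. (x $ i) ^ (k $ i))"

definition upd :: "nat^'d \<Rightarrow> 'd \<Rightarrow> nat \<Rightarrow> nat^'d" where
  "upd k i l = (\<chi> j. if j = i then l else k $ j)"

lemma upd_nth [simp]: "upd k i l $ j = (if j = i then l else k $ j)"
  by (simp add: upd_def)

lemma upd_same [simp]: "upd k i (k $ i) = k"
  by (simp add: vec_eq_iff)

lemma upd_upd [simp]: "upd (upd k i l) i l' = upd k i l'"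
  by (simp add: vec_eq_iff)

lemma polys_eq: "polys r = {\<phi>. \<exists>c. \<phi> = (\<lambda>x. \<Sum>k | \<forall>i. k $ i < r $ i. c k * monomial k x)}"
  by (simp add: polys_def monomial_def)

lemma polys_0: "(\<lambda>x. 0) \<in> polys r"
  unfolding polys_eq by (rule CollectI, rule exI[of _ "\<lambda>_. 0"]) simp

lemma polys_add: "f \<in> polys r \<Longrightarrow> g \<in> polys r \<Longrightarrow> (\<lambda>x. f x + g x) \<in> polys r"
proof -
  assume "f \<in> polys r" "g \<in> polys r"
  then obtain c d where "f = (\<lambda>x. \<Sum>k | \<forall>i. k $ i < r $ i. c k * monomial k x)"
    "g = (\<lambda>x. \<Sum>k | \<forall>i. k $ i < r $ i. d k * monomial k x)"
    unfolding polys_eq by blast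
  then have "(\<lambda>x. f x + g x) = (\<lambda>x. \<Sum>k | \<forall>i. k $ i < r $ i. (c k + d k) * monomial k x)"
    by (simp add: distrib_right sum.distrib)
  then show ?thesis unfolding polys_eq by (intro CollectI exI[where x="\<lambda>k. c k + d k"])
qed

lemma polys_cmult: "f \<in> polys r \<Longrightarrow> (\<lambda>x. c * f x) \<in> polys r"
proof -
  assume "f \<in> polys r"
  then obtain d where "f = (\<lambda>x. \<Sum>k | \<forall>i. k $ i < r $ i. d k * monomial k x)"
    unfolding polys_eq by blast
  then have "(\<lambda>x. c * f x) = (\<lambda>x. \<Sum>k | \<forall>i. k $ i < r $ i. (c * d k) * monomial k x)"
    by (simp add: sum_distrib_left mult.assoc)
  then show ?thesis unfolding polys_eq by (intro CollectI exI[where x="\<lambda>k. c * d k"])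
qed

lemma polys_diff: "f \<in> polys r \<Longrightarrow> g \<in> polys r \<Longrightarrow> (\<lambda>x. f x - g x) \<in> polys r"
  using polys_add[of f r "\<lambda>x. -1 * g x"] polys_cmult[of g r "-1"] by simp

lemma polys_sum:
  "(\<And>i. i \<in> I \<Longrightarrow> f i \<in> polys r) \<Longrightarrow> (\<lambda>x. \<Sum>i\<in>I. f i x) \<in> polys r"
  by (induction I rule: infinite_finite_induct) (auto intro: polys_0 polys_add)

lemma polys_monomial:
  fixes k r :: "nat^'d"
  assumes "\<And>i. k $ i < r $ i" shows "monomial k \<in> polys r"
  unfolding polys_eq
proof (rule CollectI, rule exI[of _ "\<lambda>l. if l = k then 1 else 0"], rule ext)
  fix x :: "real^'d"
  show "monomial k x = (\<Sum>l | \<forall>i. l $ i < r $ i. (if l = k then 1 else 0) * monomial l x)"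
    using assms by (subst sum.mono_neutral_right[of _ "{k}"]) (auto simp: finite_multi_indices)
qed

lemma polys_induct [consumes 1, case_names zero add cmult monomial]:
  assumes f: "f \<in> polys r"
    and z: "P (\<lambda>x. 0)"
    and add: "\<And>f g. P f \<Longrightarrow> P g \<Longrightarrow> P (\<lambda>x. f x + g x)"
    and cm: "\<And>c f. P f \<Longrightarrow> P (\<lambda>x. c * f x)"
    and mon: "\<And>k. (\<And>i. k $ i < r $ i) \<Longrightarrow> P (monomial k)"
  shows "P f"
proof -
  have *: "P (\<lambda>x. \<Sum>k\<in>I. c k * monomial k x)" if "finite I" "I \<subseteq> {k. \<forall>i. k $ i < r $ i}" for I c
    using that by (induction I) (auto intro: z add[OF cm[OF mon]])
  obtain c where "f = (\<lambda>x. \<Sum>k | \<forall>i. k $ i < r $ i. c k * monomial k x)"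
    using f unfolding polys_eq by auto
  then show ?thesis using * finite_multi_indices by auto
qed

lemma polys_continuous: "f \<in> polys r \<Longrightarrow> continuous_on UNIV f"
  unfolding polys_def by (auto intro!: continuous_intros)

lemma polys_measurable: "f \<in> polys r \<Longrightarrow> f \<in> borel_measurable borel"
  by (intro borel_measurable_continuous_onI polys_continuous)

lemma polys_subset:
  assumes "\<And>i. r $ i \<le> r' $ i" shows "polys r \<subseteq> polys r'"
proof
  fix f assume "f \<in> polys r"
  then show "f \<in> polys r'"
    by (induction rule: polys_induct)
       (auto intro: polys_0 polys_add polys_cmult polys_monomial less_le_trans assms)
qed

text \<open>No exponent is below 0, so the sum is empty. The zero space is thus where the degree
  count in \<open>polys_idiff_eq_0\<close> ends.\<close>

lemma polys_no_degree:
  assumes "r $ i = 0" "f \<in> polys r" shows "f = (\<lambda>x. 0)"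
  using assms unfolding polys_def by (auto simp: fun_eq_iff) (metis (mono_tags, lifting) less_nat_zero_code mem_Collect_eq sum.neutral)

lemma monomial_upd: "monomial (upd k i l) x = (x $ i) ^ l * (\<Prod>j\<in>UNIV - {i}. (x $ j) ^ (k $ j))"
proof -
  have "(\<Prod>j\<in>UNIV - {i}. (x $ j) ^ (upd k i l $ j)) = (\<Prod>j\<in>UNIV - {i}. (x $ j) ^ (k $ j))"
    by (rule prod.cong) auto
  then show ?thesis by (simp add: monomial_def prod.remove[of UNIV i])
qed

lemma idiff_monomial:
  "idiff i [h] (monomial k) x = (\<Sum>l<k $ i. real (k $ i choose l) * h ^ (k $ i - l) * monomial (upd k i l) x)"
proof -
  let ?R = "\<Prod>j\<in>UNIV - {i}. (x $ j) ^ (k $ j)"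
  have "monomial k (x + h *\<^sub>R axis i 1) = (x $ i + h) ^ (k $ i) * ?R"
    using monomial_upd[of k i "k $ i" "x + h *\<^sub>R axis i 1"] by (auto simp: axis_def intro!: prod.cong)
  moreover have "(x $ i + h) ^ (k $ i) =
      (\<Sum>l<k $ i. real (k $ i choose l) * (x $ i) ^ l * h ^ (k $ i - l)) + (x $ i) ^ (k $ i)"
    unfolding binomial_ring by (simp add: lessThan_Suc_atMost[symmetric])
  moreover have "monomial k x = (x $ i) ^ (k $ i) * ?R"
    using monomial_upd[of k i "k $ i" x] by simp
  ultimately have "idiff i [h] (monomial k) x =
      (\<Sum>l<k $ i. real (k $ i choose l) * (x $ i) ^ l * h ^ (k $ i - l)) * ?R"
    by (simp add: algebra_simps)
  then show ?thesis by (simp add: monomial_upd sum_distrib_right sum_distrib_left mult_ac)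
qed

lemma polys_idiff_single:
  assumes "f \<in> polys r"
  shows "idiff i [h] f \<in> polys (upd r i (r $ i - 1))"
  using assms
proof (induction rule: polys_induct)
  case zero
  show ?case by (simp add: polys_0)
next
  case (add f g)
  then show ?case using polys_add[OF add] by (simp add: algebra_simps)
next
  case (cmult c f)
  then show ?case using polys_cmult[OF cmult, of c] by (simp add: algebra_simps)
next
  case (monomial k)
  have "upd k i l $ j < upd r i (r $ i - 1) $ j" if "l < k $ i" for l j
    using that monomial[of j] monomial[of i] by auto
  then show ?case
    unfolding idiff_monomial[abs_def] by (intro polys_sum polys_cmult polys_monomial) auto
qed

lemma polys_idiff_eq_0:
  assumes "f \<in> polys r" "length hs = r $ i"
  shows "idiff i hs f = (\<lambda>x. 0)"
  using assms
proof (induction hs arbitrary: f r)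
  case Nil
  then show ?case using polys_no_degree[of r i f] by simp
next
  case (Cons h hs)
  have "idiff i hs (idiff i [h] f) = (\<lambda>x. 0)"
    using Cons by (intro Cons.IH[OF polys_idiff_single[OF Cons.prems(1)]]) auto
  then show ?case by (metis idiff_Cons_inner)
qed

text \<open>The difference of the monomial with exponent \<open>n + 1\<close> in
  \<open>x $ i\<close> is \<open>(n + 1) * h\<close> times the one with exponent \<open>n\<close>,
  plus terms of lower exponent. The latter are differences by induction on the exponent and can be
  subtracted.\<close>

lemma polys_idiff_surj:
  assumes "f \<in> polys (upd r i (r $ i - 1))" "h \<noteq> 0"
  shows "\<exists>g\<in>polys r. idiff i [h] g = f"
  using assms(1)
proof (induction rule: polys_induct)
  case zero
  then show ?case using polys_0 by (intro bexI[of _ "\<lambda>x. 0"]) auto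
next
  case (add f g)
  then obtain u v where "u \<in> polys r" "v \<in> polys r" "idiff i [h] u = f" "idiff i [h] v = g" by auto
  then show ?case
    by (intro bexI[of _ "\<lambda>x. u x + v x"] polys_add) (auto simp: fun_eq_iff idiff_add simp del: idiff.simps)
next
  case (cmult c f)
  then obtain u where "u \<in> polys r" "idiff i [h] u = f" by auto
  then show ?case
    by (intro bexI[of _ "\<lambda>x. c * u x"] polys_cmult) (auto simp: fun_eq_iff idiff_cmult simp del: idiff.simps)
next
  case (monomial k)
  then show ?case
  proof (induction "k $ i" arbitrary: k rule: less_induct)
    case (less k)
    define n where "n = k $ i"
    have "\<exists>g. g \<in> polys r \<and> idiff i [h] g = monomial (upd k i l)" if "l < n" for l
    proof -
      have "upd k i l $ j < upd r i (r $ i - 1) $ j" for j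
        using less.prems[of j] that by (auto simp: n_def split: if_splits)
      then show ?thesis using less.hyps[of "upd k i l"] that by (auto simp: n_def)
    qed
    then obtain g where g: "\<And>l. l < n \<Longrightarrow> g l \<in> polys r" "\<And>l. l < n \<Longrightarrow> idiff i [h] (g l) = monomial (upd k i l)"
      by metis
    have K: "monomial (upd k i (Suc n)) \<in> polys r"
    proof (rule polys_monomial)
      show "upd k i (Suc n) $ j < r $ j" for j
        using less.prems[of j] by (auto simp: n_def split: if_splits)
    qed
    define a where "a = real (Suc n) * h"
    then have a: "a \<noteq> 0" using \<open>h \<noteq> 0\<close> by simp
    let ?G = "\<lambda>x. inverse a * (monomial (upd k i (Suc n)) x - (\<Sum>l<n. real (Suc n choose l) * h ^ (Suc n - l) * g l x))"
    have "?G \<in> polys r"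
      using K g(1) by (intro polys_cmult polys_diff polys_sum) auto
    moreover have "idiff i [h] ?G = monomial k"
    proof
      fix x
      have *: "idiff i [h] (\<lambda>x. \<Sum>l\<in>I. c l * g l x) x = (\<Sum>l\<in>I. c l * idiff i [h] (g l) x)" for c and I :: "nat set"
        by (simp add: sum_subtractf right_diff_distrib)
      have "idiff i [h] (monomial (upd k i (Suc n))) x =
        (\<Sum>l<n. real (Suc n choose l) * h ^ (Suc n - l) * monomial (upd k i l) x) + a * monomial k x"
        unfolding idiff_monomial by (simp add: n_def a_def)
      moreover have "(\<Sum>l<n. real (Suc n choose l) * h ^ (Suc n - l) * idiff i [h] (g l) x) =
        (\<Sum>l<n. real (Suc n choose l) * h ^ (Suc n - l) * monomial (upd k i l) x)"
        by (intro sum.cong refl) (simp add: g(2) del: idiff.simps)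
      ultimately show "idiff i [h] ?G x = monomial k x"
        unfolding idiff_cmult idiff_diff * using a by simp
    qed
    ultimately show ?case by blast
  qed
qed

lemma polys_stretch:
  assumes "f \<in> polys r" shows "(\<lambda>x. f (stretch a c x)) \<in> polys r"
  using assms
proof (induction rule: polys_induct)
  case (monomial k)
  have "monomial k (stretch a c x) = (\<Sum>g\<in>(\<Pi>\<^sub>E i\<in>UNIV. {..k $ i}).
      (\<Prod>i\<in>UNIV. real (k $ i choose g i) * a $ i ^ g i * c $ i ^ (k $ i - g i)) * monomial (\<chi> i. k $ i - g i) x)" for x
    unfolding monomial_def stretch_def
    by (simp add: binomial_ring prod_sum_PiE power_mult_distrib flip: prod.distrib) (simp add: mult_ac)
  then have eq: "(\<lambda>x. monomial k (stretch a c x)) = (\<lambda>x. \<Sum>g\<in>(\<Pi>\<^sub>E i\<in>UNIV. {..k $ i}).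
      (\<Prod>i\<in>UNIV. real (k $ i choose g i) * a $ i ^ g i * c $ i ^ (k $ i - g i)) * monomial (\<chi> i. k $ i - g i) x)"
    by blast
  show ?case
    unfolding eq
  proof (intro polys_sum polys_cmult polys_monomial)
    show "(\<chi> i. k $ i - g i) $ i < r $ i" for g i
      using monomial[of i] by simp
  qed
qed (auto intro: polys_0 polys_add polys_cmult)

section \<open>The local estimate\<close>

lemma modular_diff_le:
  assumes "0 < p" "f \<in> borel_measurable borel" "g \<in> borel_measurable borel" "S \<in> sets borel"
    and "modular p S f \<le> A" "modular p S g \<le> B"
  shows "modular p S (\<lambda>x. f x - g x) \<le> ppow p 2 * (A + B)"
  using modular_add_le[of p f "\<lambda>x. - g x" S A B] assms by (simp add: modular_uminus)

section \<open>Cubes with a fixed lower corner, and functions of finite size on all of them\<close>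

definition cube :: "real^'d \<Rightarrow> real \<Rightarrow> (real^'d) set" where
  "cube a s = {x. \<forall>j. a $ j \<le> x $ j \<and> x $ j \<le> a $ j + s}"

lemma cube_eq_cbox: "cube a s = cbox a (\<chi> j. a $ j + s)"
  by (auto simp: cube_def mem_box_cart)

lemma cube_borel [measurable, simp]: "cube a s \<in> sets borel"
  by (simp add: cube_eq_cbox)

lemma cube_mono: "s \<le> t \<Longrightarrow> cube a s \<subseteq> cube a t"
  by (auto simp: cube_def) (meson add_left_mono order_trans)

lemma cube_shift: "x \<in> cube a s \<Longrightarrow> 0 \<le> h \<Longrightarrow> x + h *\<^sub>R axis i 1 \<in> cube a (s + h)"
proof -
  assume x: "x \<in> cube a s" and h: "0 \<le> h"
  have "a $ j \<le> (x + h *\<^sub>R axis i 1) $ j \<and> (x + h *\<^sub>R axis i 1) $ j \<le> a $ j + (s + h)" for j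
    using x h unfolding cube_def by (cases "j = i") (auto simp: axis_def intro: add_increasing2 dest!: spec[of _ j])
  then show ?thesis by (simp add: cube_def)
qed

lemma modular_subset:
  assumes "f \<in> borel_measurable borel" "S \<in> sets borel" "T \<in> sets borel" "S \<subseteq> T"
  shows "modular p S f \<le> modular p T f"
  using assms by (intro modular_mono) auto

text \<open>Finiteness is asked for every side length because differences with nonnegative steps see
  values beyond a given cube, and iterated differences must stay in the class. It makes the supremum
  in \<open>single_diff_bound\<close> finite.\<close>

definition locally_Lp :: "ennreal \<Rightarrow> real^'d \<Rightarrow> (real^'d \<Rightarrow> real) \<Rightarrow> bool" where
  "locally_Lp p a f \<longleftrightarrow> f \<in> borel_measurable borel \<and> (\<forall>s. modular p (cube a s) f < \<infinity>)"

lemma locally_LpD: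
  assumes "locally_Lp p a f"
  shows "f \<in> borel_measurable borel" "modular p (cube a s) f < \<infinity>"
  using assms by (auto simp: locally_Lp_def)

text \<open>The factor for a sum of two functions that share one bound, see
  \<open>quasi_eq\<close>.\<close>

definition quasi :: "ennreal \<Rightarrow> ennreal" where
  "quasi p = 2 * ppow p 2"

lemma quasi_finite: "quasi p < \<infinity>"
  using ppow_finite[of 2 p] by (simp add: quasi_def ennreal_mult_less_top)

lemma quasi_ge_1: "0 < p \<Longrightarrow> 1 \<le> quasi p"
  using ppow_2_ge_1 by (simp add: quasi_def mult_2 add_increasing)

lemma quasi_eq: "ppow p 2 * (e + e) = quasi p * e"
  by (simp add: quasi_def mult_2 algebra_simps)

text \<open>Nonnegative steps push points away from the lower corner, so each step lengthens the
  side by its own size and costs one factor \<open>quasi p\<close>.\<close>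

lemma modular_idiff_cube_le:
  assumes p: "0 < p" and [measurable]: "f \<in> borel_measurable borel" and "set hs \<subseteq> {0..}"
  shows "modular p (cube a s) (idiff i hs f)
    \<le> quasi p ^ length hs * modular p (cube a (s + sum_list hs)) f"
  using assms(3)
proof (induction hs arbitrary: s)
  case (Cons h hs)
  then have h: "0 \<le> h" and IH: "\<And>s. modular p (cube a s) (idiff i hs f)
    \<le> quasi p ^ length hs * modular p (cube a (s + sum_list hs)) f" by auto
  let ?B = "quasi p ^ length hs * modular p (cube a (s + h + sum_list hs)) f"
  have "modular p (cube a s) (\<lambda>x. idiff i hs f (x + h *\<^sub>R axis i 1)) \<le> modular p (cube a (s + h)) (idiff i hs f)"
    by (intro modular_translate cube_shift h) auto
  moreover have "modular p (cube a s) (idiff i hs f) \<le> modular p (cube a (s + h)) (idiff i hs f)"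
    using h by (intro modular_subset cube_mono) auto
  ultimately have "modular p (cube a s) (idiff i (h # hs) f) \<le> ppow p 2 * (?B + ?B)"
    unfolding idiff.simps by (intro modular_diff_le p) (auto intro: order_trans[OF _ IH])
  then show ?case unfolding quasi_eq by (simp add: add.assoc mult.assoc)
qed simp

lemma locally_Lp_idiff:
  assumes p: "0 < p" and f: "locally_Lp p a f" and hs: "set hs \<subseteq> {0..}"
  shows "locally_Lp p a (idiff i hs f)"
  unfolding locally_Lp_def
proof (intro conjI allI)
  show "idiff i hs f \<in> borel_measurable borel" using locally_LpD[OF f] by simp
  fix s
  have "quasi p ^ length hs * modular p (cube a (s + sum_list hs)) f < \<infinity>"
    using locally_LpD(2)[OF f] quasi_finite[of p]
    by (simp add: ennreal_mult_less_top power_less_top_ennreal)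
  then show "modular p (cube a s) (idiff i hs f) < \<infinity>"
    using modular_idiff_cube_le[OF p locally_LpD(1)[OF f] hs, of a s i] by (rule le_less_trans[rotated])
qed

lemma locally_Lp_diff:
  assumes p: "0 < p" and f: "locally_Lp p a f" and g: "locally_Lp p a g"
  shows "locally_Lp p a (\<lambda>x. f x - g x)"
  unfolding locally_Lp_def
proof (intro conjI allI)
  note [measurable] = locally_LpD(1)[OF f] locally_LpD(1)[OF g]
  show "(\<lambda>x. f x - g x) \<in> borel_measurable borel" by simp
  fix s
  have "modular p (cube a s) (\<lambda>x. f x - g x) \<le> ppow p 2 * (modular p (cube a s) f + modular p (cube a s) g)"
    by (intro modular_diff_le p) auto
  also have "\<dots> < \<infinity>"
    using locally_LpD(2)[OF f] locally_LpD(2)[OF g] ppow_finite[of 2 p]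
    by (simp add: ennreal_mult_less_top)
  finally show "modular p (cube a s) (\<lambda>x. f x - g x) < \<infinity>" .
qed

lemma locally_Lp_continuous:
  assumes f: "continuous_on UNIV f" shows "locally_Lp p a f"
  unfolding locally_Lp_def
proof (intro conjI allI)
  show [measurable]: "f \<in> borel_measurable borel" using f by (rule borel_measurable_continuous_onI)
  fix s
  have "compact (f ` cube a s)"
    unfolding cube_eq_cbox by (intro compact_continuous_image continuous_on_subset[OF f]) auto
  then obtain B where B: "\<And>x. x \<in> cube a s \<Longrightarrow> \<bar>f x\<bar> \<le> B"
    by (force dest!: compact_imp_bounded simp: bounded_iff)
  show "modular p (cube a s) f < \<infinity>"
  proof (cases "p = \<infinity>")
    case True
    have "modular top (cube a s) f \<le> ennreal B"
      by (subst modular_top_le_iff) (auto intro!: ennreal_leI B)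
    then show ?thesis unfolding True infinity_ennreal_def by (rule le_less_trans) simp
  next
    case False
    have "modular p (cube a s) f \<le> (\<integral>\<^sup>+x. ennreal (B powr enn2real p) * indicator (cube a s) x \<partial>lborel)"
      unfolding modular_def using False
      by (auto intro!: nn_integral_mono ennreal_leI powr_mono2 B simp: indicator_def)
    also have "\<dots> = ennreal (B powr enn2real p) * emeasure lborel (cube a s)"
      by (simp add: nn_integral_cmult)
    also have "\<dots> < \<infinity>"
      unfolding cube_eq_cbox by (simp add: ennreal_mult_less_top emeasure_lborel_cbox_eq)
    finally show ?thesis .
  qed
qed

text \<open>The factor of the contraction in \<open>single_diff_bound\<close>: \<open>1/2\<close>
  comes from halving a doubled difference, and each \<open>l\<close> from one use of
  \<open>modular_add_sharp\<close>. For p = \<infinity>, \<open>l = 6/5\<close> gives 18/25; for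
  finite p, \<open>l\<close> is 2^(p/4), which leaves 2^(-p/2).\<close>

lemma sharp_factor:
  assumes "0 < p"
  obtains l \<theta> where "1 < l" "0 \<le> \<theta>" "\<theta> < 1" "ennreal l * (ennreal l * ppow p (ennreal (1/2))) = ennreal \<theta>"
proof (cases "p = \<infinity>")
  case True
  then show ?thesis
  proof -
    have "ennreal (6/5 * (6/5 * (1/2))) = ennreal (6/5) * (ennreal (6/5) * ennreal (1/2))"
      by (subst ennreal_mult, simp, simp, subst ennreal_mult) simp_all
    then show ?thesis using that[of "6/5" "6/5 * (6/5 * (1/2))"] True by (simp add: ppow_def)
  qed
next
  case False
  define q where "q = enn2real p"
  have q: "0 < q" using enn2real_pos_if[OF assms False] by (simp add: q_def)
  have "2 powr (q/4) * (2 powr (q/4) * 2 powr (- q)) = (2::real) powr (q/4 + (q/4 + - q))"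
    by (simp only: powr_add)
  also have "q/4 + (q/4 + - q) = - (q/2)" by simp
  finally have "2 powr (q/4) * (2 powr (q/4) * (1/2) powr q) = (2::real) powr (- (q/2))"
    by (simp add: powr_divide powr_minus_divide[of 2 q])
  moreover have "ppow p (ennreal (1/2)) = ennreal ((1/2) powr q)"
    unfolding q_def by (rule ppow_ennreal[OF False]) simp
  ultimately have eq: "ennreal (2 powr (q/4)) * (ennreal (2 powr (q/4)) * ppow p (ennreal (1/2))) = ennreal (2 powr (- (q/2)))"
    by (simp only:) (simp flip: ennreal_mult)
  show ?thesis
    by (intro that[OF _ _ _ eq]) (use q powr_less_mono[of "- (q/2)" 0 2] in auto)
qed

text \<open>Finiteness of \<open>B\<close> is essential: for positive \<open>\<theta>\<close> the
  value \<open>B = \<infinity>\<close> always satisfies the last hypothesis. The subtraction takes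
  place in the reals.\<close>

lemma ennreal_absorb:
  assumes "B < \<infinity>" "0 \<le> \<theta>" "\<theta> < 1" "B \<le> ennreal \<theta> * B + c"
  shows "B \<le> ennreal (1 / (1 - \<theta>)) * c"
proof (cases "c = \<infinity>")
  case True
  have "ennreal (1 / (1 - \<theta>)) \<noteq> 0" using assms(3) by simp
  then show ?thesis unfolding True by (simp add: ennreal_mult_top)
next
  case False
  then obtain b d where bd: "B = ennreal b" "0 \<le> b" "c = ennreal d" "0 \<le> d"
    using assms(1) by (metis ennreal_cases infinity_ennreal_def less_irrefl)
  have "ennreal b \<le> ennreal (\<theta> * b + d)"
    using assms(2,4) bd by (simp add: ennreal_mult)
  then have "b \<le> \<theta> * b + d" using assms(2) bd by (subst (asm) ennreal_le_iff) auto
  then have "b * (1 - \<theta>) \<le> d" by (simp add: algebra_simps)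
  then have "b \<le> 1 / (1 - \<theta>) * d" using assms(3) by (simp add: pos_le_divide_eq)
  then have "ennreal b \<le> ennreal (1 / (1 - \<theta>) * d)" by (rule ennreal_leI)
  also have "\<dots> = ennreal (1 / (1 - \<theta>)) * ennreal d"
    using assms(3) bd(4) by (intro ennreal_mult) auto
  finally show ?thesis unfolding bd .
qed

text \<open>The bound \<open>M\<close> of the first differences with steps in \<open>[0, L]\<close> satisfies \<open>M \<le> \<theta> M + C e\<close>
  with \<open>\<theta> < 1\<close>: a step \<open>h \<le> L / 2\<close> is doubled, up to a second difference, and a larger step is
  replaced by \<open>L - h\<close>. It can be absorbed since \<open>M\<close> is finite.\<close>

lemma single_diff_bound:
  assumes p: "0 < p"
  shows "\<exists>C<\<infinity>. \<forall>(a :: real^'d) t L i G e. locally_Lp p a G \<longrightarrow> 0 \<le> L \<longrightarrow>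
      (\<forall>h\<in>{0..L}. \<forall>u\<in>{0..L}. modular p (cube a t) (idiff i [h, u] G) \<le> e) \<longrightarrow>
      modular p (cube a t) (idiff i [L] G) \<le> e \<longrightarrow>
      (\<forall>h\<in>{0..L}. modular p (cube a t) (idiff i [h] G) \<le> C * e)"
proof -
  obtain l \<theta> where l: "1 < l" "0 \<le> \<theta>" "\<theta> < 1" "ennreal l * (ennreal l * ppow p (ennreal (1/2))) = ennreal \<theta>"
    using sharp_factor[OF p] .
  obtain D where D: "0 \<le> D" "\<And>(S :: (real^'d) set) f g. f \<in> borel_measurable borel \<Longrightarrow> g \<in> borel_measurable borel \<Longrightarrow> S \<in> sets borel \<Longrightarrow>
      modular p S (\<lambda>x. f x + g x) \<le> ennreal l * modular p S f + ennreal D * modular p S g"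
    using modular_add_sharp[OF p l(1), where 'd='d] by blast
  let ?k = "ppow p (ennreal (1/2))"
  define c where "c = ennreal l * (?k * ennreal D) + ennreal D * quasi p"
  have k: "?k < top" "ppow p 2 < top" by (rule ppow_finite, rule ennreal_less_top, rule ppow_finite, simp)
  show ?thesis
  proof (intro exI[of _ "ennreal (1 / (1 - \<theta>)) * c"] conjI allI impI ballI)
    show "ennreal (1 / (1 - \<theta>)) * c < \<infinity>"
      using k quasi_finite[of p] by (simp add: c_def ennreal_mult_less_top)
    fix a :: "real^'d" and t L :: real and i G e h0
    assume G: "locally_Lp p a G" and L: "0 \<le> L"
      and E: "\<forall>h\<in>{0..L}. \<forall>u\<in>{0..L}. modular p (cube a t) (idiff i [h, u] G) \<le> e"
      and P: "modular p (cube a t) (idiff i [L] G) \<le> e"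
      and h0: "h0 \<in> {0..L}"
    let ?N = "modular p (cube a t)"
    note [measurable] = locally_LpD(1)[OF G]
    define B where "B = (SUP h\<in>{0..L}. ?N (idiff i [h] G))"
    have le_B: "?N (idiff i [h] G) \<le> B" if "h \<in> {0..L}" for h
      unfolding B_def using that by (rule SUP_upper)
    \<comment> \<open>Based on \<Delta>_h = (\<Delta>_{2h} - \<Delta>_h \<Delta>_h) / 2. The doubled
      step stays in [0, L], so the supremum \<open>B\<close> bounds its difference.\<close>
    have half: "?N (idiff i [h] G) \<le> ?k * (ennreal l * B + ennreal D * e)" if h: "0 \<le> h" "h \<le> L / 2" for h
    proof -
      have "?N (idiff i [2 * h] G) \<le> B" "?N (\<lambda>x. - idiff i [h, h] G x) \<le> e"
        using h by (auto intro!: le_B E[rule_format] simp del: idiff.simps simp: modular_uminus)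
      then have "?N (\<lambda>x. idiff i [2 * h] G x + - idiff i [h, h] G x) \<le> ennreal l * B + ennreal D * e"
        by (intro order_trans[OF D(2)] add_mono mult_left_mono) (auto simp del: idiff.simps)
      then have "?N (\<lambda>x. (1/2) * (idiff i [2 * h] G x + - idiff i [h, h] G x)) \<le> ?k * (ennreal l * B + ennreal D * e)"
        using modular_mult_left_le[OF p, of "\<lambda>x. idiff i [2 * h] G x + - idiff i [h, h] G x" "cube a t" _ "1/2"]
        by (simp del: idiff.simps)
      moreover have "(\<lambda>x. (1/2) * (idiff i [2 * h] G x + - idiff i [h, h] G x)) = idiff i [h] G"
      proof
        fix x :: "real^'d"
        have eq: "x + h *\<^sub>R axis i 1 + h *\<^sub>R axis i 1 = x + (2 * h) *\<^sub>R axis i 1"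
          by (simp add: vec_eq_iff algebra_simps)
        show "(1/2) * (idiff i [2 * h] G x + - idiff i [h, h] G x) = idiff i [h] G x"
          unfolding idiff.simps eq by simp
      qed
      ultimately show ?thesis by simp
    qed
    have "?N (idiff i [h] G) \<le> ennreal l * (?k * (ennreal l * B + ennreal D * e)) + ennreal D * (ppow p 2 * (e + e))"
      if h: "h \<in> {0..L}" for h
    proof (cases "h \<le> L / 2")
      case True
      have "?N (idiff i [h] G) \<le> 1 * (?k * (ennreal l * B + ennreal D * e))"
        using half[of h] True h by simp
      also have "\<dots> \<le> ennreal l * (?k * (ennreal l * B + ennreal D * e))"
        using l by (intro mult_right_mono) (auto simp: ennreal_ge_1)
      finally show ?thesis by (rule order_trans) simp
    next
      \<comment> \<open>Based on \<Delta>_h = - \<Delta>_{L-h} + (\<Delta>_L - \<Delta>_h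
        \<Delta>_{L-h}). Since \<open>L - h \<le> L / 2\<close>, the first term falls under
        \<open>half\<close>; the bracket is bounded by hypothesis.\<close>
      case False
      have "?N (\<lambda>x. - idiff i [L - h] G x) \<le> ?k * (ennreal l * B + ennreal D * e)"
        unfolding modular_uminus using False h by (intro half) auto
      moreover have "?N (\<lambda>x. idiff i [L] G x - idiff i [h, L - h] G x) \<le> ppow p 2 * (e + e)"
        using h by (intro modular_diff_le p P E[rule_format]) (auto simp del: idiff.simps)
      ultimately have "?N (\<lambda>x. - idiff i [L - h] G x + (idiff i [L] G x - idiff i [h, L - h] G x))
         \<le> ennreal l * (?k * (ennreal l * B + ennreal D * e)) + ennreal D * (ppow p 2 * (e + e))"
        by (intro order_trans[OF D(2)] add_mono mult_left_mono) (auto simp del: idiff.simps)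
      moreover have "(\<lambda>x. - idiff i [L - h] G x + (idiff i [L] G x - idiff i [h, L - h] G x)) = idiff i [h] G"
      proof
        fix x :: "real^'d"
        have eq: "x + h *\<^sub>R axis i 1 + (L - h) *\<^sub>R axis i 1 = x + L *\<^sub>R axis i 1"
          by (simp add: vec_eq_iff algebra_simps)
        show "- idiff i [L - h] G x + (idiff i [L] G x - idiff i [h, L - h] G x) = idiff i [h] G x"
          unfolding idiff.simps eq by simp
      qed
      ultimately show ?thesis by simp
    qed
    then have "B \<le> ennreal l * (?k * (ennreal l * B + ennreal D * e)) + ennreal D * (ppow p 2 * (e + e))"
      unfolding B_def by (rule SUP_least)
    also have "\<dots> = (ennreal l * (ennreal l * ?k)) * B + c * e"
      unfolding quasi_eq by (simp add: c_def algebra_simps)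
    finally have "B \<le> ennreal \<theta> * B + c * e" unfolding l(4) .
    moreover have "B < \<infinity>"
    proof -
      \<comment> \<open>The supremum runs over infinitely many steps, but one larger cube serves
        them all.\<close>
      have "B \<le> quasi p * modular p (cube a (t + L)) G"
        unfolding B_def
      proof (rule SUP_least)
        fix h assume h: "h \<in> {0..L}"
        have "?N (idiff i [h] G) \<le> quasi p ^ length [h] * modular p (cube a (t + sum_list [h])) G"
          using h by (intro modular_idiff_cube_le p) auto
        also have "\<dots> \<le> quasi p * modular p (cube a (t + L)) G"
          using h by (auto intro!: mult_left_mono modular_subset cube_mono)
        finally show "?N (idiff i [h] G) \<le> quasi p * modular p (cube a (t + L)) G" .
      qed
      also have "\<dots> < \<infinity>"
        using locally_LpD(2)[OF G, of "t + L"] quasi_finite[of p] by (simp add: ennreal_mult_less_top)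
      finally show ?thesis .
    qed
    ultimately have "B \<le> ennreal (1 / (1 - \<theta>)) * (c * e)"
      using l by (intro ennreal_absorb)
    then show "?N (idiff i [h0] G) \<le> ennreal (1 / (1 - \<theta>)) * c * e"
      using le_B[OF h0] by (simp add: mult.assoc)
  qed
qed

text \<open>The steps are nonnegative and may differ, and the single number \<open>s\<close> bounds
  both them and the side. Differences on \<open>cube a s\<close> may involve values of
  \<open>f\<close> outside it, which is harmless as \<open>f\<close> is total.\<close>

definition small_diffs :: "ennreal \<Rightarrow> real^'d \<Rightarrow> nat^'d \<Rightarrow> real \<Rightarrow> (real^'d \<Rightarrow> real) \<Rightarrow> ennreal \<Rightarrow> bool" where
  "small_diffs p a r s f e \<longleftrightarrow>
    (\<forall>i hs. length hs = r $ i \<longrightarrow> set hs \<subseteq> {0..s} \<longrightarrow> modular p (cube a s) (idiff i hs f) \<le> e)"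

lemma small_diffsD:
  "small_diffs p a r s f e \<Longrightarrow> length hs = r $ i \<Longrightarrow> set hs \<subseteq> {0..s} \<Longrightarrow>
    modular p (cube a s) (idiff i hs f) \<le> e"
  by (auto simp: small_diffs_def)

text \<open>The cube may shrink: the loss is made up for by \<open>extend_to_unit_cube\<close>.\<close>

definition local_whitney :: "ennreal \<Rightarrow> real^'d \<Rightarrow> nat^'d \<Rightarrow> bool" where
  "local_whitney p a r \<longleftrightarrow> (\<forall>s>0. \<exists>s'>0. s' \<le> s \<and> (\<exists>C<\<infinity>. \<forall>f e. locally_Lp p a f \<longrightarrow> small_diffs p a r s f e \<longrightarrow>
     (\<exists>\<phi>\<in>polys r. modular p (cube a s') (\<lambda>x. f x - \<phi> x) \<le> C * e)))"

lemma sum_list_le_length: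
  "set hs \<subseteq> {0..t::real} \<Longrightarrow> sum_list hs \<le> real (length hs) * t"
  by (induction hs) (auto simp: algebra_simps)

text \<open>The hypothesis is used at two scales: on side \<open>L\<close> for \<open>g\<close>, the
  difference of \<open>f\<close> with step \<open>L\<close>, which yields \<open>s1\<close>; then on
  the smaller side \<open>t\<close> for \<open>u = f - P\<close>. What the second use has to
  establish are the differences of \<open>u\<close> of order \<open>r $ i - 1\<close> in direction
  \<open>i\<close>: in all other directions the order is unchanged, and there \<open>u\<close> has
  the same differences as \<open>f\<close>.\<close>

lemma local_whitney_step:
  assumes p: "0 < p" and r: "2 \<le> r $ i" and W: "local_whitney p a (upd r i (r $ i - 1))"
  shows "local_whitney p a r"
  unfolding local_whitney_def
proof (intro allI impI)
  fix s :: real assume s: "0 < s"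
  define r' where "r' = upd r i (r $ i - 1)"
  \<comment> \<open>In a direction \<open>j \<noteq> i\<close>, a difference of \<open>g\<close> on
    side \<open>L\<close> is \<Delta>_L of a difference of \<open>f\<close>, which is then read on
    side \<open>L + L = s\<close>.\<close>
  define L where "L = s / 2"
  have L: "0 < L" "L \<le> s" "L + L = s" using s by (auto simp: L_def)
  obtain s1 C1 where s1: "0 < s1" "s1 \<le> L" "C1 < \<infinity>"
    "\<And>f e. locally_Lp p a f \<Longrightarrow> small_diffs p a r' L f e \<Longrightarrow>
     (\<exists>\<phi>\<in>polys r'. modular p (cube a s1) (\<lambda>x. f x - \<phi> x) \<le> C1 * e)"
    using W L(1) unfolding local_whitney_def r'_def[symmetric] by metis
  \<comment> \<open>A point of \<open>cube a t\<close> moved by \<open>r $ i - 2\<close> steps of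
    length at most \<open>t\<close> stays in \<open>cube a s1\<close>, where \<open>g - Q\<close> is
    controlled.\<close>
  define t where "t = s1 / real (r $ i)"
  have t: "0 < t" "t \<le> s1" "t \<le> L" "t \<le> s" "real (r $ i) * t = s1"
    using s1 r L by (auto simp: t_def divide_le_eq intro: order_trans)
  obtain s0 C0 where s0: "0 < s0" "s0 \<le> t" "C0 < \<infinity>"
    "\<And>f e. locally_Lp p a f \<Longrightarrow> small_diffs p a r' t f e \<Longrightarrow>
     (\<exists>\<phi>\<in>polys r'. modular p (cube a s0) (\<lambda>x. f x - \<phi> x) \<le> C0 * e)"
    using W t(1) unfolding local_whitney_def r'_def[symmetric] by metis
  obtain C2 where C2: "C2 < \<infinity>"
    "\<And>t L i G e. locally_Lp p a G \<Longrightarrow> 0 \<le> L \<Longrightarrow>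
      (\<forall>h\<in>{0..L}. \<forall>u\<in>{0..L}. modular p (cube a t) (idiff i [h, u] G) \<le> e) \<Longrightarrow>
      modular p (cube a t) (idiff i [L] G) \<le> e \<Longrightarrow>
      (\<forall>h\<in>{0..L}. modular p (cube a t) (idiff i [h] G) \<le> C2 * e)"
    using single_diff_bound[OF p] by blast
  \<comment> \<open>\<open>C1 * quasi p\<close> is the cost of approximating \<open>g\<close> by
    \<open>Q\<close>; each of the remaining \<open>r $ i - 2\<close> differences costs another
    \<open>quasi p\<close>.\<close>
  define D where "D = quasi p ^ (r $ i - 2) * (C1 * quasi p)"
  define C where "C = C0 * (1 + C2 * (1 + D))"
  have fin: "quasi p < \<infinity>" by (rule quasi_finite)
  have D: "D < \<infinity>" using s1(3) fin by (simp add: D_def ennreal_mult_less_top power_less_top_ennreal)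
  have C: "C < \<infinity>" using D C2(1) s0(3) by (simp add: C_def ennreal_mult_less_top)
  have "\<exists>\<phi>\<in>polys r. modular p (cube a s0) (\<lambda>x. f x - \<phi> x) \<le> C * e"
    if f: "locally_Lp p a f" and sm: "small_diffs p a r s f e" for f e
  proof -
    note [measurable] = locally_LpD(1)[OF f]
    define g where "g = idiff i [L] f"
    have g: "locally_Lp p a g" unfolding g_def using L by (intro locally_Lp_idiff p f) auto
    have e_le: "e \<le> quasi p * e" using mult_right_mono[OF quasi_ge_1[OF p], of e] by simp
    have "small_diffs p a r' L g (quasi p * e)"
      unfolding small_diffs_def
    proof (intro allI impI)
      fix j hs assume hs: "length hs = r' $ j" "set hs \<subseteq> {0..L}"
      show "modular p (cube a L) (idiff j hs g) \<le> quasi p * e"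
      proof (cases "j = i")
        case True
        have "modular p (cube a L) (idiff j hs g) = modular p (cube a L) (idiff i (L # hs) f)"
          unfolding True g_def idiff_Cons_inner[of i L hs f] ..
        also have "\<dots> \<le> modular p (cube a s) (idiff i (L # hs) f)"
          using L by (intro modular_subset cube_mono) (auto simp del: idiff.simps)
        also have "\<dots> \<le> e"
          using hs L r True by (intro small_diffsD[OF sm]) (auto simp: r'_def)
        finally show ?thesis using e_le by (rule order_trans)
      next
        case False
        have "modular p (cube a L) (idiff j hs g) = modular p (cube a L) (idiff i [L] (idiff j hs f))"
          unfolding g_def idiff_commute[of j hs i "[L]" f] ..
        also have "\<dots> \<le> quasi p ^ length [L] * modular p (cube a (L + sum_list [L])) (idiff j hs f)"
          using L by (intro modular_idiff_cube_le p) auto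
        also have "\<dots> = quasi p * modular p (cube a s) (idiff j hs f)" using L by simp
        also have "\<dots> \<le> quasi p * e"
          using hs L False by (intro mult_left_mono small_diffsD[OF sm]) (auto simp: r'_def)
        finally show ?thesis .
      qed
    qed
    then obtain Q where Q: "Q \<in> polys r'" "modular p (cube a s1) (\<lambda>x. g x - Q x) \<le> C1 * (quasi p * e)"
      using s1(4)[OF g] by blast
    obtain P where P: "P \<in> polys r" "idiff i [L] P = Q"
      using polys_idiff_surj[of Q r i L] Q(1) L by (auto simp: r'_def simp del: idiff.simps)
    have P0: "idiff j hs P = (\<lambda>x. 0)" if "length hs = r $ j" for j hs
      using polys_idiff_eq_0[OF P(1) that] .
    define u where "u = (\<lambda>x. f x - P x)"
    have u: "locally_Lp p a u"
      unfolding u_def by (intro locally_Lp_diff p f locally_Lp_continuous polys_continuous[OF P(1)])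
    have sm_u: "modular p (cube a t) (idiff j hs u) \<le> e" if "length hs = r $ j" "set hs \<subseteq> {0..s}" for j hs
    proof -
      have "idiff j hs u = idiff j hs f"
        unfolding u_def by (rule ext) (simp add: idiff_diff P0[OF that(1)])
      moreover have "modular p (cube a t) (idiff j hs f) \<le> modular p (cube a s) (idiff j hs f)"
        using t by (intro modular_subset cube_mono) auto
      ultimately show ?thesis using small_diffsD[OF sm that] by (auto intro: order_trans)
    qed
    have gu: "idiff i [L] u = (\<lambda>x. g x - Q x)"
      unfolding u_def g_def P(2)[symmetric] by (rule ext) (rule idiff_diff)
    \<comment> \<open>\<open>single_diff_bound\<close> takes one common bound, so the
      \<open>e\<close> of the second differences and the \<open>D * e\<close> of \<Delta>_L are
      merged.\<close>
    define e1 where "e1 = (1 + D) * e"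
    have e1: "e \<le> e1" "D * e \<le> e1" unfolding e1_def by (simp_all add: distrib_right)
    have "small_diffs p a r' t u ((1 + C2 * (1 + D)) * e)"
      unfolding small_diffs_def
    proof (intro allI impI)
      fix j hs assume hs: "length hs = r' $ j" "set hs \<subseteq> {0..t}"
      show "modular p (cube a t) (idiff j hs u) \<le> (1 + C2 * (1 + D)) * e"
      proof (cases "j = i")
        case True
        then obtain h ks where hk: "hs = h # ks" "length ks = r $ i - 2"
          using hs(1) r by (cases hs) (auto simp: r'_def)
        have ks: "set ks \<subseteq> {0..t}" "h \<in> {0..L}" using hs(2) hk t by auto
        \<comment> \<open>Freezing all steps but one reduces order \<open>r $ i - 1\<close> to order
          1: the second differences of \<open>G\<close> are differences of \<open>u\<close> of order
          \<open>r $ i\<close>, hence small.\<close>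
        define G where "G = idiff i ks u"
        have G: "locally_Lp p a G" unfolding G_def using ks by (intro locally_Lp_idiff p u) auto
        have comb: "idiff i xs G = idiff i (xs @ ks) u" for xs
          unfolding G_def by (simp add: idiff_append)
        have "modular p (cube a t) (idiff i [h] G) \<le> C2 * e1"
        proof (rule bspec[OF C2(2)[OF G] ks(2)], safe)
          show "0 \<le> L" using L by simp
          show "modular p (cube a t) (idiff i [h, v] G) \<le> e1" if "h \<in> {0..L}" "v \<in> {0..L}" for h v
            unfolding comb using that ks t L r hk
            by (intro order_trans[OF sm_u e1(1)]) auto
          have "modular p (cube a t) (idiff i [L] G) = modular p (cube a t) (idiff i ks (\<lambda>x. g x - Q x))"
            unfolding G_def gu[symmetric] idiff_commute[of i ks i "[L]" u] ..
          also have "\<dots> \<le> quasi p ^ length ks * modular p (cube a (t + sum_list ks)) (\<lambda>x. g x - Q x)"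
            using ks locally_LpD(1)[OF g] polys_measurable[OF Q(1)] by (intro modular_idiff_cube_le p) auto
          also have "\<dots> \<le> quasi p ^ length ks * modular p (cube a s1) (\<lambda>x. g x - Q x)"
          proof (intro mult_left_mono modular_subset cube_mono)
            have "t + sum_list ks \<le> t + real (length ks) * t"
              using sum_list_le_length[OF ks(1)] by simp
            also have "\<dots> \<le> real (r $ i) * t"
              using r hk t(1) by (simp add: of_nat_diff algebra_simps)
            finally show "t + sum_list ks \<le> s1" using t by simp
          qed (use locally_LpD(1)[OF g] polys_measurable[OF Q(1)] in auto)
          also have "\<dots> \<le> quasi p ^ length ks * (C1 * (quasi p * e))"
            by (intro mult_left_mono Q) auto
          also have "\<dots> = D * e" by (simp add: D_def hk mult_ac)
          finally show "modular p (cube a t) (idiff i [L] G) \<le> e1" using e1(2) by (rule order_trans)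
        qed
        then have "modular p (cube a t) (idiff j hs u) \<le> C2 * e1"
          unfolding comb hk True by simp
        also have "\<dots> \<le> (1 + C2 * (1 + D)) * e"
          by (simp add: e1_def mult.assoc distrib_right)
        finally show ?thesis .
      next
        case False
        have "modular p (cube a t) (idiff j hs u) \<le> e"
          using hs False t by (intro sm_u) (auto simp: r'_def)
        also have "\<dots> \<le> (1 + C2 * (1 + D)) * e" by (simp add: distrib_right)
        finally show ?thesis .
      qed
    qed
    then obtain R where R: "R \<in> polys r'" "modular p (cube a s0) (\<lambda>x. u x - R x) \<le> C0 * ((1 + C2 * (1 + D)) * e)"
      using s0(4)[OF u] by blast
    have "polys r' \<subseteq> polys r" by (rule polys_subset) (simp add: r'_def)
    then have "R \<in> polys r" using R(1) by blast
    then have "(\<lambda>x. P x + R x) \<in> polys r" using P(1) by (rule polys_add[rotated])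
    moreover have "modular p (cube a s0) (\<lambda>x. f x - (P x + R x)) \<le> C * e"
      using R(2) by (simp add: u_def C_def mult.assoc diff_diff_eq)
    ultimately show ?thesis by (intro bexI[where x="\<lambda>x. P x + R x"])
  qed
  then show "\<exists>s'>0. s' \<le> s \<and> (\<exists>C<\<infinity>. \<forall>f e. locally_Lp p a f \<longrightarrow> small_diffs p a r s f e \<longrightarrow>
     (\<exists>\<phi>\<in>polys r. modular p (cube a s') (\<lambda>x. f x - \<phi> x) \<le> C * e))"
    using s0 t C by (intro exI[of _ s0]) auto
qed

section \<open>Approximation by a constant when all orders are 1\<close>

lemma translate_nn_integral:
  fixes g :: "'a::euclidean_space \<Rightarrow> ennreal"
  assumes [measurable]: "g \<in> borel_measurable borel"
  shows "(\<integral>\<^sup>+v. g (x + v) \<partial>lborel) = (\<integral>\<^sup>+y. g y \<partial>lborel)"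
  using nn_integral_distr[of "(+) x" lborel borel g] by (simp add: lborel_distr_plus)

lemma emeasure_cube: "0 \<le> s \<Longrightarrow> emeasure lborel (cube (a :: real^'d) s) = ennreal (s ^ CARD('d))"
proof -
  assume s: "0 \<le> s"
  have Basis: "Basis = (\<lambda>i. axis i 1 :: real^'d) ` UNIV" by (auto simp: Basis_vec_def)
  have inj: "inj (\<lambda>i. axis i 1 :: real^'d)" by (auto simp: inj_on_def axis_eq_axis)
  have "(\<Prod>b\<in>Basis. ((\<chi> j. a $ j + s) - a) \<bullet> b) = s ^ CARD('d)"
    unfolding Basis prod.reindex[OF inj] by (simp add: inner_axis)
  moreover have "\<forall>b\<in>Basis. a \<bullet> b \<le> (\<chi> j. a $ j + s) \<bullet> b"
    unfolding Basis using s by (simp add: inner_axis)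
  ultimately show ?thesis unfolding cube_eq_cbox by (simp add: emeasure_lborel_cbox_eq)
qed

text \<open>An averaging argument: if every \<open>y\<close> violated the bound, integrate over the
  half cube \<open>Y\<close> opposite to \<open>X\<close>. For \<open>x\<close> in \<open>X\<close>
  and \<open>y\<close> in \<open>Y\<close> the vector \<open>v = y - x\<close> lies in
  \<open>cube 0 t\<close>, so Fubini and the hypothesis bound the double integral. The factor
  \<open>2 ^ CARD('d)\<close> is the ratio of the volumes of \<open>cube 0 t\<close> and
  \<open>Y\<close>.\<close>

lemma exists_good_point:
  fixes F :: "(real^'d) \<times> (real^'d) \<Rightarrow> ennreal"
  assumes [measurable]: "F \<in> borel_measurable borel" and t: "0 < t" and M: "M < \<infinity>"
    and le: "\<And>v. v \<in> cube 0 t \<Longrightarrow> (\<integral>\<^sup>+x. F (x, x + v) * indicator (cube a (t / 2)) x \<partial>lborel) \<le> M"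
  shows "\<exists>y. (\<integral>\<^sup>+x. F (x, y) * indicator (cube a (t / 2)) x \<partial>lborel) \<le> 2 ^ CARD('d) * M"
proof (rule ccontr)
  assume "\<not> ?thesis"
  then have gt: "2 ^ CARD('d) * M < (\<integral>\<^sup>+x. F (x, y) * indicator (cube a (t / 2)) x \<partial>lborel)" for y
    by (simp add: not_le)
  define X where "X = cube a (t / 2)"
  define Y where "Y = cube (\<chi> j. a $ j + t / 2) (t / 2)"
  define V where "V = cube (0 :: real^'d) t"
  define G where "G = (\<lambda>y. \<integral>\<^sup>+x. F (x, y) * indicator X x \<partial>lborel)"
  have [measurable]: "X \<in> sets borel" "Y \<in> sets borel" "V \<in> sets borel"
    by (auto simp: X_def Y_def V_def)
  have [measurable]: "F \<in> borel_measurable (borel \<Otimes>\<^sub>M borel)" by (simp add: borel_prod)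
  have [measurable]: "G \<in> borel_measurable borel" unfolding G_def by measurable
  have "(\<integral>\<^sup>+y. G y * indicator Y y \<partial>lborel)
      = (\<integral>\<^sup>+y. (\<integral>\<^sup>+x. F (x, y) * indicator X x * indicator Y y \<partial>lborel) \<partial>lborel)"
    unfolding G_def by (simp add: nn_integral_multc)
  also have "\<dots> = (\<integral>\<^sup>+x. (\<integral>\<^sup>+y. F (x, y) * indicator X x * indicator Y y \<partial>lborel) \<partial>lborel)"
    by (rule lborel_pair.Fubini') simp
  also have "\<dots> = (\<integral>\<^sup>+x. (\<integral>\<^sup>+v. F (x, x + v) * indicator X x * indicator Y (x + v) \<partial>lborel) \<partial>lborel)"
    by (subst translate_nn_integral) auto
  also have "\<dots> \<le> (\<integral>\<^sup>+x. (\<integral>\<^sup>+v. F (x, x + v) * indicator X x * indicator V v \<partial>lborel) \<partial>lborel)"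
  proof (intro nn_integral_mono)
    fix x v :: "real^'d"
    have "v \<in> V" if "x \<in> X" "x + v \<in> Y"
      unfolding V_def cube_def
    proof (rule CollectI, rule allI)
      fix j
      have "a $ j \<le> x $ j \<and> x $ j \<le> a $ j + t / 2" using that(1) by (simp add: X_def cube_def)
      moreover have "a $ j + t / 2 \<le> x $ j + v $ j \<and> x $ j + v $ j \<le> a $ j + t / 2 + t / 2"
        using that(2) by (simp add: Y_def cube_def)
      ultimately show "(0 :: real^'d) $ j \<le> v $ j \<and> v $ j \<le> (0 :: real^'d) $ j + t" by auto
    qed
    then show "F (x, x + v) * indicator X x * indicator Y (x + v) \<le> F (x, x + v) * indicator X x * indicator V v"
      by (auto simp: indicator_def)
  qed
  also have "\<dots> = (\<integral>\<^sup>+v. (\<integral>\<^sup>+x. F (x, x + v) * indicator X x * indicator V v \<partial>lborel) \<partial>lborel)"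
    by (rule lborel_pair.Fubini'[symmetric]) simp
  also have "\<dots> \<le> (\<integral>\<^sup>+v. M * indicator V v \<partial>lborel)"
    using le by (intro nn_integral_mono) (auto simp: indicator_def V_def X_def)
  also have "\<dots> = M * ennreal (t ^ CARD('d))"
    using t by (simp add: nn_integral_cmult V_def emeasure_cube)
  also have "\<dots> = 2 ^ CARD('d) * M * ennreal ((t / 2) ^ CARD('d))"
  proof -
    have "ennreal (t ^ CARD('d)) = ennreal (2 ^ CARD('d)) * ennreal ((t / 2) ^ CARD('d))"
      using t by (simp add: power_divide flip: ennreal_mult)
    also have "ennreal (2 ^ CARD('d)) = 2 ^ CARD('d)" by (simp flip: ennreal_power)
    finally show ?thesis by (simp add: mult_ac)
  qed
  also have "\<dots> = (\<integral>\<^sup>+y. 2 ^ CARD('d) * M * indicator Y y \<partial>lborel)"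
    using t by (simp add: nn_integral_cmult Y_def emeasure_cube)
  \<comment> \<open>The strict inequality survives integration since the left-hand integral is
    finite and \<open>Y\<close> has positive measure.\<close>
  also have "\<dots> < (\<integral>\<^sup>+y. G y * indicator Y y \<partial>lborel)"
  proof (rule nn_integral_less)
    have "2 ^ CARD('d) * M * ennreal ((t / 2) ^ CARD('d)) < \<infinity>"
      using M by (simp add: ennreal_mult_less_top power_less_top_ennreal)
    then show "(\<integral>\<^sup>+y. 2 ^ CARD('d) * M * indicator Y y \<partial>lborel) \<noteq> \<infinity>"
      using t by (simp add: nn_integral_cmult Y_def emeasure_cube)
    show "AE y in lborel. 2 ^ CARD('d) * M * indicator Y y \<le> G y * indicator Y y"
      using gt by (auto simp: indicator_def G_def X_def intro!: less_imp_le)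
    show "\<not> (AE y in lborel. G y * indicator Y y \<le> 2 ^ CARD('d) * M * indicator Y y)"
    proof
      assume "AE y in lborel. G y * indicator Y y \<le> 2 ^ CARD('d) * M * indicator Y y"
      then have "AE y in lborel. y \<notin> Y"
        by (rule eventually_mono) (use gt in \<open>auto simp: indicator_def G_def X_def not_le[symmetric] split: if_splits\<close>)
      then have "emeasure lborel Y = 0" by (subst (asm) AE_iff_measurable[of Y]) auto
      then show False using t by (simp add: Y_def emeasure_cube)
    qed
  qed auto
  finally show False by simp
qed

text \<open>Move from \<open>x\<close> to \<open>x + v\<close> one coordinate at a time. Each move
  is a first difference at a point displaced by at most \<open>t\<close> in every coordinate, hence
  still in the cube of side \<open>2 * t\<close>, and costs one factor
  \<open>quasi p\<close>.\<close>

lemma modular_difference_le: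
  fixes a :: "real^'d"
  assumes p: "0 < p" and [measurable]: "f \<in> borel_measurable borel" and r: "\<And>i. r $ i = 1"
    and sm: "small_diffs p a r (2 * t) f e" and v: "v \<in> cube 0 t" and J: "finite J"
  shows "modular p (cube a t) (\<lambda>x. f (x + (\<Sum>j\<in>J. (v $ j) *\<^sub>R axis j 1)) - f x) \<le> quasi p ^ card J * e"
  using J
proof (induction J)
  case empty
  show ?case using p by (simp add: modular_0)
next
  case (insert i J)
  let ?w = "\<Sum>j\<in>J. (v $ j) *\<^sub>R axis j 1 :: real^'d"
  have vj: "0 \<le> v $ j" "v $ j \<le> t" for j using v by (auto simp: cube_def)
  have w: "0 \<le> ?w $ j \<and> ?w $ j \<le> t" for j
  proof -
    have "?w $ j = (\<Sum>k\<in>J. if k = j then v $ k else 0)"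
      unfolding sum_component by (intro sum.cong) (auto simp: axis_def)
    then show ?thesis using vj[of j] insert.hyps(1) by (auto intro: order_trans)
  qed
  have "modular p (cube a t) (\<lambda>x. idiff i [v $ i] f (x + ?w)) \<le> modular p (cube a (2 * t)) (idiff i [v $ i] f)"
  proof (rule modular_translate)
    show "x + ?w \<in> cube a (2 * t)" if "x \<in> cube a t" for x
      unfolding cube_def
    proof (rule CollectI, rule allI)
      fix j
      show "a $ j \<le> (x + ?w) $ j \<and> (x + ?w) $ j \<le> a $ j + 2 * t"
        using that w[of j] unfolding cube_def by (auto dest!: spec[of _ j] simp del: sum_component)
    qed
  qed (auto simp del: idiff.simps)
  also have "\<dots> \<le> e"
    using vj[of i] by (intro small_diffsD[OF sm]) (auto simp: r)
  finally have 1: "modular p (cube a t) (\<lambda>x. idiff i [v $ i] f (x + ?w)) \<le> e" .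
  have "1 \<le> quasi p ^ card J" using quasi_ge_1[OF p] by (rule one_le_power)
  then have e: "e \<le> quasi p ^ card J * e" using mult_right_mono[of 1 _ e] by simp
  have "modular p (cube a t) (\<lambda>x. idiff i [v $ i] f (x + ?w) + (f (x + ?w) - f x))
      \<le> ppow p 2 * (quasi p ^ card J * e + quasi p ^ card J * e)"
    using insert.IH order_trans[OF 1 e] by (intro modular_add_le p) (auto simp del: idiff.simps)
  moreover have "(\<lambda>x. idiff i [v $ i] f (x + ?w) + (f (x + ?w) - f x))
      = (\<lambda>x. f (x + (\<Sum>j\<in>insert i J. (v $ j) *\<^sub>R axis j 1)) - f x)"
    using insert.hyps by (auto simp: fun_eq_iff algebra_simps)
  ultimately show ?case unfolding quasi_eq using insert.hyps by (simp add: mult_ac)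
qed

lemma local_whitney_base:
  fixes a :: "real^'d"
  assumes p: "0 < p" and r: "\<And>i. r $ i = 1"
  shows "local_whitney p a r"
  unfolding local_whitney_def
proof (intro allI impI)
  fix s :: real assume s: "0 < s"
  define t where "t = s / 2"
  have t: "0 < t" "2 * t = s" using s by (auto simp: t_def)
  define D where "D = quasi p ^ CARD('d)"
  have D: "D < top" using quasi_finite[of p] by (simp add: D_def power_less_top_ennreal)
  define C where "C = 2 ^ CARD('d) * D"
  have C: "C < \<infinity>" using D by (simp add: C_def ennreal_mult_less_top power_less_top_ennreal)
  have "\<exists>\<phi>\<in>polys r. modular p (cube a (t / 2)) (\<lambda>x. f x - \<phi> x) \<le> C * e"
    if f: "locally_Lp p a f" and sm: "small_diffs p a r s f e" for f e
  proof -
    note [measurable] = locally_LpD(1)[OF f]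
    have const: "(\<lambda>x. c) \<in> polys r" for c
    proof -
      have "(\<lambda>x. c * monomial 0 x) \<in> polys r"
        by (intro polys_cmult polys_monomial) (simp add: r)
      then show ?thesis by (simp add: monomial_def)
    qed
    have "\<exists>y. modular p (cube a (t / 2)) (\<lambda>x. f x - f y) \<le> C * e"
    proof (cases "e = \<infinity>")
      \<comment> \<open>\<open>exists_good_point\<close> needs a finite bound. For infinite
        \<open>e\<close> any \<open>y\<close> will do, provided that \<open>C\<close> is not
        0.\<close>
      case True
      have "1 \<le> D" unfolding D_def using quasi_ge_1[OF p] by (rule one_le_power)
      then have "C \<noteq> 0" by (auto simp: C_def)
      then show ?thesis using True by (simp add: ennreal_mult_top)
    next
      case False
      then have fin: "D * e < \<infinity>" using D by (simp add: ennreal_mult_less_top less_top)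
      have diff: "modular p (cube a (t / 2)) (\<lambda>x. f (x + v) - f x) \<le> D * e" if v: "v \<in> cube 0 t" for v
      proof -
        have "(\<Sum>j\<in>UNIV. (v $ j) *\<^sub>R axis j 1) = v"
          by (simp add: vec_eq_iff axis_def if_distrib cong: if_cong)
        then have "modular p (cube a t) (\<lambda>x. f (x + v) - f x) \<le> D * e"
          using modular_difference_le[OF p _ r, of f a t e v UNIV] sm v t by (simp add: D_def)
        moreover have "modular p (cube a (t / 2)) (\<lambda>x. f (x + v) - f x) \<le> modular p (cube a t) (\<lambda>x. f (x + v) - f x)"
          using t by (intro modular_subset cube_mono) auto
        ultimately show ?thesis by (rule order_trans[rotated])
      qed
      show ?thesis
      proof (cases "p = \<infinity>")
        case True
        \<comment> \<open>The indicator of the bad pairs. With bound 0, the averaging yields one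
          \<open>y\<close> for which almost every \<open>x\<close> is good.\<close>
        define F where "F = (\<lambda>z::(real^'d) \<times> (real^'d). if D * e < ennreal \<bar>f (fst z) - f (snd z)\<bar> then 1 else 0 :: ennreal)"
        have [measurable]: "F \<in> borel_measurable borel"
          unfolding F_def borel_prod[symmetric] by measurable
        have "\<exists>y. (\<integral>\<^sup>+x. F (x, y) * indicator (cube a (t / 2)) x \<partial>lborel) \<le> 2 ^ CARD('d) * 0"
        proof (rule exists_good_point)
          fix v :: "real^'d" assume "v \<in> cube 0 t"
          then have "AE x in lborel. x \<in> cube a (t / 2) \<longrightarrow> ennreal \<bar>f (x + v) - f x\<bar> \<le> D * e"
            using diff unfolding True infinity_ennreal_def by (subst (asm) modular_top_le_iff) auto
          then have "AE x in lborel. F (x, x + v) * indicator (cube a (t / 2)) x = 0"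
            by (rule eventually_mono) (auto simp: F_def indicator_def abs_minus_commute)
          then show "(\<integral>\<^sup>+x. F (x, x + v) * indicator (cube a (t / 2)) x \<partial>lborel) \<le> 0"
            by (subst nn_integral_cong_AE[where v="\<lambda>_. 0"]) auto
        qed (use t in auto)
        then obtain y where "(\<integral>\<^sup>+x. F (x, y) * indicator (cube a (t / 2)) x \<partial>lborel) = 0" by auto
        moreover have "(\<lambda>x. F (x, y)) \<in> borel_measurable borel" unfolding F_def by measurable
        ultimately have "AE x in lborel. F (x, y) * indicator (cube a (t / 2)) x = 0"
          by (subst (asm) nn_integral_0_iff_AE) auto
        then have "AE x in lborel. x \<in> cube a (t / 2) \<longrightarrow> ennreal \<bar>f x - f y\<bar> \<le> D * e"
          by (rule eventually_mono) (auto simp: F_def indicator_def split: if_splits)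
        then have "modular p (cube a (t / 2)) (\<lambda>x. f x - f y) \<le> 1 * (D * e)"
          unfolding True infinity_ennreal_def by (subst modular_top_le_iff) auto
        also have "\<dots> \<le> C * e" unfolding C_def mult.assoc by (intro mult_right_mono) auto
        finally show ?thesis by blast
      next
        case False
        define F where "F = (\<lambda>z::(real^'d) \<times> (real^'d). ennreal (\<bar>f (fst z) - f (snd z)\<bar> powr enn2real p))"
        have [measurable]: "F \<in> borel_measurable borel"
          unfolding F_def borel_prod[symmetric] by measurable
        have "\<exists>y. (\<integral>\<^sup>+x. F (x, y) * indicator (cube a (t / 2)) x \<partial>lborel) \<le> 2 ^ CARD('d) * (D * e)"
        proof (rule exists_good_point)
          show "(\<integral>\<^sup>+x. F (x, x + v) * indicator (cube a (t / 2)) x \<partial>lborel) \<le> D * e" if "v \<in> cube 0 t" for v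
            using diff[OF that] False by (simp add: modular_def F_def abs_minus_commute)
        qed (use t fin in auto)
        then show ?thesis using False by (simp add: modular_def F_def C_def mult.assoc)
      qed
    qed
    then obtain y where "modular p (cube a (t / 2)) (\<lambda>x. f x - f y) \<le> C * e" ..
    then show ?thesis using const by (intro bexI[where x="\<lambda>x. f y"])
  qed
  then show "\<exists>s'>0. s' \<le> s \<and> (\<exists>C<\<infinity>. \<forall>f e. locally_Lp p a f \<longrightarrow> small_diffs p a r s f e \<longrightarrow>
     (\<exists>\<phi>\<in>polys r. modular p (cube a s') (\<lambda>x. f x - \<phi> x) \<le> C * e))"
    using t C by (intro exI[of _ "t / 2"]) auto
qed

lemma local_whitney:
  assumes p: "0 < p" and r: "\<And>i. 1 \<le> r $ i"
  shows "local_whitney p a r"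
  using r
proof (induction "\<Sum>i\<in>UNIV. r $ i" arbitrary: r rule: less_induct)
  case less
  show ?case
  proof (cases "\<exists>i. 2 \<le> r $ i")
    case True
    then obtain i where i: "2 \<le> r $ i" ..
    have "(\<Sum>j\<in>UNIV. upd r i (r $ i - 1) $ j) < (\<Sum>j\<in>UNIV. r $ j)"
      using i by (intro sum_strict_mono_ex1) auto
    moreover have "1 \<le> upd r i (r $ i - 1) $ j" for j
      using i less.prems[of j] by auto
    ultimately have "local_whitney p a (upd r i (r $ i - 1))" by (rule less.hyps)
    then show ?thesis using local_whitney_step[OF p i] by blast
  next
    case False
    then have "r $ i = 1" for i using less.prems[of i] by (metis le_antisym not_less_eq_eq numeral_2_eq_2 One_nat_def)
    then show ?thesis using local_whitney_base[OF p] by blast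
  qed
qed

section \<open>Extension to the unit cube\<close>

text \<open>The bound 1 on the step is the side of the unit cube. Both signs of \<open>h\<close> are
  included, so that an extension can proceed upwards and downwards from a slab.\<close>

definition axis_diffs :: "ennreal \<Rightarrow> (real^'d) set \<Rightarrow> nat \<Rightarrow> 'd \<Rightarrow> (real^'d \<Rightarrow> real) \<Rightarrow> ennreal \<Rightarrow> bool" where
  "axis_diffs p Q m i f e \<longleftrightarrow> (\<forall>h. \<bar>h\<bar> \<le> 1 \<longrightarrow>
     modular p (shift_dom Q ((real m * h) *\<^sub>R axis i 1)) (idiff i (replicate m h) f) \<le> e)"

lemma shift_dom_borel [measurable]:
  assumes [measurable]: "Q \<in> sets borel" shows "shift_dom Q v \<in> sets borel"
proof -
  have "shift_dom Q v = Q \<inter> (\<lambda>x. x + v) -` Q" by (auto simp: shift_dom_def)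
  moreover have "(\<lambda>x. x + v) -` Q \<in> sets borel"
    using measurable_sets_borel[of "\<lambda>x. x + v" borel Q] by simp
  ultimately show ?thesis by simp
qed

lemma modular_mult_sub_le:
  assumes p: "0 < p" and "f \<in> borel_measurable borel" "S \<in> sets borel" "modular p S f \<le> e" "\<bar>c\<bar> \<le> d"
  shows "modular p S (\<lambda>x. c * f x) \<le> ppow p (ennreal d) * e"
proof -
  have "modular p S (\<lambda>x. c * f x) \<le> ppow p (ennreal \<bar>c\<bar>) * e"
    using assms by (intro modular_mult_left_le)
  also have "\<dots> \<le> ppow p (ennreal d) * e"
    using assms by (intro mult_right_mono ppow_mono ennreal_leI) auto
  finally show ?thesis .
qed

definition extend_const :: "ennreal \<Rightarrow> nat \<Rightarrow> ennreal" where
  "extend_const p m = ppow p 2 * (1 + quasi p ^ m * ppow p (ennreal (2 ^ m)))"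

lemma extend_const_finite: "extend_const p m < top"
  using quasi_finite[of p] ppow_finite[of 2 p] ppow_finite[of "ennreal (2 ^ m)" p]
  by (simp add: extend_const_def ennreal_mult_less_top power_less_top_ennreal)

text \<open>In the expansion of an \<open>m\<close>-th difference the term \<open>j = m\<close> has
  coefficient 1. So \<open>u x\<close> is the difference based at \<open>x - m h\<close> minus a
  combination of \<open>m\<close> values at points of \<open>W\<close>. The \<open>2 ^ m\<close> in
  \<open>extend_const\<close> bounds the binomial coefficients.\<close>

lemma extend_step:
  assumes p: "0 < p" and [measurable]: "u \<in> borel_measurable borel" "Q \<in> sets borel" "T \<in> sets borel" "W \<in> sets borel"
    and d: "modular p (shift_dom Q ((real m * h) *\<^sub>R axis i 1)) (idiff i (replicate m h) u) \<le> e"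
    and T: "\<And>x. x \<in> T \<Longrightarrow> x \<in> Q \<and> x - (real m * h) *\<^sub>R axis i 1 \<in> Q"
    and W: "\<And>x j. x \<in> T \<Longrightarrow> j < m \<Longrightarrow> x + ((real j - real m) * h) *\<^sub>R axis i 1 \<in> W"
  shows "modular p T u \<le> extend_const p m * (e + modular p W u)"
proof -
  let ?v = "\<lambda>j. ((real j - real m) * h) *\<^sub>R axis i 1 :: real^'a"
  let ?c = "\<lambda>j. (-1) ^ (m - j) * real (m choose j)"
  let ?B = "quasi p ^ m * (ppow p (ennreal (2 ^ m)) * modular p W u)"
  have "u = (\<lambda>x. idiff i (replicate m h) u (x + ?v 0) - (\<Sum>j<m. ?c j * u (x + ?v j)))"
  proof
    fix x
    have eq: "x + ?v 0 + (real j * h) *\<^sub>R axis i 1 = x + ?v j" for j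
      by (simp add: algebra_simps)
    have "idiff i (replicate m h) u (x + ?v 0) = (\<Sum>j=0..m. ?c j * u (x + ?v j))"
      unfolding idiff_replicate eq ..
    also have "{0..m} = insert m {..<m}" by auto
    finally show "u x = idiff i (replicate m h) u (x + ?v 0) - (\<Sum>j<m. ?c j * u (x + ?v j))" by simp
  qed
  moreover have "modular p T (\<lambda>x. idiff i (replicate m h) u (x + ?v 0) - (\<Sum>j<m. ?c j * u (x + ?v j)))
     \<le> ppow p 2 * (e + ?B)"
  proof (rule modular_diff_le[OF p])
    have "modular p T (\<lambda>x. idiff i (replicate m h) u (x + ?v 0))
      \<le> modular p (shift_dom Q ((real m * h) *\<^sub>R axis i 1)) (idiff i (replicate m h) u)"
      using T by (intro modular_translate) (auto simp: shift_dom_def)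
    then show "modular p T (\<lambda>x. idiff i (replicate m h) u (x + ?v 0)) \<le> e" using d by (rule order_trans)
    have "modular p T (\<lambda>x. ?c j * u (x + ?v j)) \<le> ppow p (ennreal (2 ^ m)) * modular p W u" if "j < m" for j
    proof (rule modular_mult_sub_le[OF p])
      show "modular p T (\<lambda>x. u (x + ?v j)) \<le> modular p W u"
        using W that by (intro modular_translate) auto
      have "m choose j \<le> 2 ^ m"
        by (metis binomial_le_pow2 binomial_eq_0 leI zero_le)
      then show "\<bar>?c j\<bar> \<le> 2 ^ m"
        by (simp add: abs_mult power_abs)
    qed auto
    then show "modular p T (\<lambda>x. \<Sum>j<m. ?c j * u (x + ?v j)) \<le> ?B"
      using modular_sum_le[OF p, of T "{..<m}" "\<lambda>j x. ?c j * u (x + ?v j)"] by (auto simp: quasi_def)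
  qed auto
  ultimately have "modular p T u \<le> ppow p 2 * (e + ?B)" by simp
  also have "\<dots> \<le> extend_const p m * (e + modular p W u)"
    unfolding extend_const_def mult.assoc
    by (intro mult_left_mono) (auto simp: algebra_simps add_increasing add_increasing2 intro: add_mono)
  finally show ?thesis .
qed

definition slab :: "(real^'d) set \<Rightarrow> 'd \<Rightarrow> real \<Rightarrow> real \<Rightarrow> (real^'d) set" where
  "slab R i l h = {x \<in> R. l \<le> x $ i \<and> x $ i \<le> h}"

lemma slab_borel [measurable]:
  assumes [measurable]: "R \<in> sets borel" shows "slab R i l h \<in> sets borel"
proof -
  have "{x::real^'a. l \<le> x $ i \<and> x $ i \<le> h} \<in> sets borel"
    by (intro borel_closed closed_Collect_conj closed_Collect_le) (intro continuous_intros)+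
  then have "R \<inter> {x::real^'a. l \<le> x $ i \<and> x $ i \<le> h} \<in> sets borel" by auto
  also have "R \<inter> {x. l \<le> x $ i \<and> x $ i \<le> h} = slab R i l h" by (auto simp: slab_def)
  finally show ?thesis .
qed

text \<open>The slab grows in rounds, by one layer of width \<open>h\<close> on either side.
  \<open>R\<close> has to be a cylinder over [0, 1] in direction \<open>i\<close> only, and the
  constant does not depend on it, so the coordinates can be treated one after the other.\<close>

lemma extend_direction:
  assumes p: "0 < p" and m: "1 \<le> m" and s: "0 < s"
  shows "\<exists>C<top. \<forall>(u :: real^'d \<Rightarrow> real) e R i l. u \<in> borel_measurable borel \<longrightarrow> R \<in> sets borel \<longrightarrow> R \<subseteq> cube 0 1 \<longrightarrow>
    (\<forall>x\<in>R. \<forall>\<tau>. 0 \<le> x $ i + \<tau> \<longrightarrow> x $ i + \<tau> \<le> 1 \<longrightarrow> x + \<tau> *\<^sub>R axis i 1 \<in> R) \<longrightarrow>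
    0 \<le> l \<longrightarrow> l + s \<le> 1 \<longrightarrow> axis_diffs p (cube 0 1) m i u e \<longrightarrow>
    modular p R u \<le> C * (e + modular p (slab R i l (l + s)) u)"
proof -
  \<comment> \<open>With this step the farthest of the \<open>m\<close> auxiliary points is at
    distance \<open>s\<close>, the width of the initial slab, and the nearest at distance
    \<open>h\<close>, the width of a layer.\<close>
  define h where "h = s / real m"
  have h: "0 < h" "real m * h = s" using m s by (auto simp: h_def)
  obtain n where n: "1 / h < real n" using reals_Archimedean2 by blast
  then have n: "1 \<le> real n * h" using h by (simp add: field_simps)
  \<comment> \<open>Two layers per round at the cost of \<open>extend_const p m\<close> each, plus
    what is already covered. The iterated quantity is \<open>e + modular p (W k) u\<close>, so that
    the additive \<open>e\<close> is carried along.\<close>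
  define A where "A = 1 + 2 * extend_const p m"
  have A: "A ^ n < top" using extend_const_finite[of p m]
    by (simp add: A_def power_less_top_ennreal ennreal_mult_less_top)
  show ?thesis
  proof (intro exI[of _ "A ^ n"] conjI A allI impI)
    fix u :: "real^'d \<Rightarrow> real" and e R i l
    assume [measurable]: "u \<in> borel_measurable borel" "R \<in> sets borel" and R: "R \<subseteq> cube 0 1"
      and cyl: "\<forall>x\<in>R. \<forall>\<tau>. 0 \<le> x $ i + \<tau> \<longrightarrow> x $ i + \<tau> \<le> 1 \<longrightarrow> x + \<tau> *\<^sub>R axis i 1 \<in> R"
      and l: "0 \<le> l" "l + s \<le> 1" and ax: "axis_diffs p (cube 0 1) m i u e"
    have h1: "\<bar>h\<bar> \<le> 1"
    proof -
      have "1 * h \<le> real m * h" using m h(1) by (intro mult_right_mono) auto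
      then show ?thesis using h l by simp
    qed
    define W where "W k = slab R i (l - real k * h) (l + s + real k * h)" for k
    have [measurable]: "W k \<in> sets borel" for k unfolding W_def by measurable
    have xi: "(x + \<tau> *\<^sub>R axis i 1) $ i = x $ i + \<tau>" for x :: "real^'d" and \<tau> by simp
    have step: "modular p T u \<le> extend_const p m * (e + modular p (W k) u)"
      if T: "T = slab R i (l + s + real k * h) (l + s + real (Suc k) * h) \<and> \<sigma> = h \<or>
        T = slab R i (l - real (Suc k) * h) (l - real k * h) \<and> \<sigma> = - h" for T k \<sigma>
    proof (rule extend_step[OF p, where h=\<sigma> and Q="cube 0 1"])
      show "T \<in> sets borel" using T by auto
      have "\<bar>\<sigma>\<bar> \<le> 1" using T h1 by auto
      then show "modular p (shift_dom (cube 0 1) ((real m * \<sigma>) *\<^sub>R axis i 1)) (idiff i (replicate m \<sigma>) u) \<le> e"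
        using ax by (simp add: axis_diffs_def)
      have *: "x \<in> R \<and> (j < m \<longrightarrow> x + ((real j - real m) * \<sigma>) *\<^sub>R axis i 1 \<in> W k) \<and> x + ((real j - real m) * \<sigma>) *\<^sub>R axis i 1 \<in> R"
        if x: "x \<in> T" and j: "j \<le> m" for x j
      proof -
        have xR: "x \<in> R" using x T by (auto simp: slab_def)
        then have x01: "0 \<le> x $ i" "x $ i \<le> 1" using R by (auto simp: cube_def)
        have jh: "real j * h \<le> s" "0 \<le> real j * h" using j h by (auto simp flip: h(2))
        have kh: "0 \<le> real k * h" using h by simp
        have jm: "j < m \<Longrightarrow> real j * h + h \<le> s"
        proof -
          assume "j < m"
          then have "(real j + 1) * h \<le> real m * h" using h by (intro mult_right_mono) auto
          then show ?thesis by (simp add: h(2) distrib_right)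
        qed
        have sk: "real (Suc k) * h = real k * h + h" by (simp add: algebra_simps)
        consider (up) "l + s + real k * h \<le> x $ i" "x $ i \<le> l + s + real k * h + h" "(real j - real m) * \<sigma> = real j * h - s"
          | (down) "l - real k * h - h \<le> x $ i" "x $ i \<le> l - real k * h" "(real j - real m) * \<sigma> = s - real j * h"
          using T x unfolding sk by (auto simp: slab_def left_diff_distrib h(2))
        then show ?thesis
        proof cases
          case up
          have "x + (real j * h - s) *\<^sub>R axis i 1 \<in> R"
            using up l x01 kh jh by (intro cyl[rule_format, OF xR]) linarith+
          moreover have "l - real k * h \<le> x $ i + (real j * h - s)" using up jh kh by linarith
          moreover have "j < m \<Longrightarrow> x $ i + (real j * h - s) \<le> l + s + real k * h"
            using jm up by linarith
          ultimately show ?thesis using xR unfolding up(3) W_def slab_def mem_Collect_eq xi by blast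
        next
          case down
          have "x + (s - real j * h) *\<^sub>R axis i 1 \<in> R"
            using down l x01 kh jh by (intro cyl[rule_format, OF xR]) linarith+
          moreover have "x $ i + (s - real j * h) \<le> l + s + real k * h" using down jh kh by linarith
          moreover have "j < m \<Longrightarrow> l - real k * h \<le> x $ i + (s - real j * h)"
            using jm down by linarith
          ultimately show ?thesis using xR unfolding down(3) W_def slab_def mem_Collect_eq xi by blast
        qed
      qed
      show "x \<in> cube 0 1 \<and> x - (real m * \<sigma>) *\<^sub>R axis i 1 \<in> cube 0 1" if "x \<in> T" for x
        using *[OF that, of 0] R by auto
      show "x + ((real j - real m) * \<sigma>) *\<^sub>R axis i 1 \<in> W k" if "x \<in> T" "j < m" for x j
        using *[OF that(1), of j] that(2) by auto
    qed auto
    have "e + modular p (W k) u \<le> A ^ k * (e + modular p (W 0) u)" for k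
    proof (induction k)
      case (Suc k)
      let ?U = "slab R i (l + s + real k * h) (l + s + real (Suc k) * h)"
      let ?D = "slab R i (l - real (Suc k) * h) (l - real k * h)"
      have "W (Suc k) \<subseteq> W k \<union> (?U \<union> ?D)" by (auto simp: W_def slab_def)
      then have "modular p (W (Suc k)) u \<le> modular p (W k \<union> (?U \<union> ?D)) u"
        by (intro modular_subset) auto
      also have "\<dots> \<le> modular p (W k) u + (modular p ?U u + modular p ?D u)"
        by (intro order_trans[OF modular_Un[OF p]] add_mono order_refl modular_Un p) auto
      also have "\<dots> \<le> modular p (W k) u + (extend_const p m * (e + modular p (W k) u) + extend_const p m * (e + modular p (W k) u))"
        by (intro add_mono order_refl step) auto
      finally have "e + modular p (W (Suc k)) u \<le> e + (modular p (W k) u + (extend_const p m * (e + modular p (W k) u) + extend_const p m * (e + modular p (W k) u)))"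
        by (rule add_left_mono)
      also have "\<dots> = A * (e + modular p (W k) u)"
        unfolding A_def distrib_right mult_2 by (simp add: add_ac)
      also have "\<dots> \<le> A * (A ^ k * (e + modular p (W 0) u))"
        by (intro mult_left_mono Suc) auto
      finally show ?case by (simp add: mult.assoc)
    qed simp
    from this[of n] have "modular p (W n) u \<le> A ^ n * (e + modular p (W 0) u)"
      by (rule order_trans[rotated]) simp
    moreover have "W n = R"
    proof
      show "R \<subseteq> W n"
      proof
        fix x assume x: "x \<in> R"
        then have "0 \<le> x $ i \<and> x $ i \<le> 1" using R by (auto simp: cube_def)
        then show "x \<in> W n" using x n l s by (auto simp: W_def slab_def)
      qed
    qed (auto simp: W_def slab_def)
    moreover have "W 0 = slab R i l (l + s)" by (simp add: W_def)
    ultimately show "modular p R u \<le> A ^ n * (e + modular p (slab R i l (l + s)) u)"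
      by (simp only:)
  qed
qed

text \<open>\<open>R J\<close> lets the coordinates in \<open>J\<close> range over [0, 1] and
  confines the others to the small cube. Adding an index to \<open>J\<close> is one use of
  \<open>extend_direction\<close>, whose initial slab is the previous set.\<close>

lemma extend_to_unit_cube:
  fixes c :: "real^'d"
  assumes p: "0 < p" and r: "\<And>i. 1 \<le> r $ i" and s: "0 < s" and c: "\<And>i. 0 \<le> c $ i \<and> c $ i + s \<le> 1"
  shows "\<exists>C<top. \<forall>u e. u \<in> borel_measurable borel \<longrightarrow> (\<forall>i. axis_diffs p (cube 0 1) (r $ i) i u e) \<longrightarrow>
    modular p (cube 0 1) u \<le> C * (e + modular p (cube c s) u)"
proof -
  define R where "R J = {x \<in> cube 0 1. \<forall>j. j \<notin> J \<longrightarrow> c $ j \<le> x $ j \<and> x $ j \<le> c $ j + s}" for J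
  have R_closed: "closed (R J)" for J
  proof -
    have "R J = cube 0 1 \<inter> (\<Inter>j\<in>-J. {x. c $ j \<le> x $ j \<and> x $ j \<le> c $ j + s})"
      by (auto simp: R_def)
    moreover have "closed (cube (0::real^'d) 1)" by (simp add: cube_eq_cbox closed_cbox)
    ultimately show ?thesis
      by (auto intro!: closed_Int closed_INT closed_Collect_conj closed_Collect_le continuous_intros)
  qed
  then have [measurable]: "R J \<in> sets borel" for J by (intro borel_closed)
  have "\<exists>C<top. \<forall>u e. u \<in> borel_measurable borel \<longrightarrow> (\<forall>i. axis_diffs p (cube 0 1) (r $ i) i u e) \<longrightarrow>
    e + modular p (R J) u \<le> C * (e + modular p (cube c s) u)" if "finite J" for J
    using that
  proof (induction J)
    case empty
    have "R {} = cube c s"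
      using c by (auto simp: R_def cube_def) (meson order_trans)+
    then show ?case by (intro exI[of _ 1]) auto
  next
    case (insert i J)
    then obtain C where C: "C < top" "\<And>u e. u \<in> borel_measurable borel \<Longrightarrow> (\<forall>i. axis_diffs p (cube 0 1) (r $ i) i u e) \<Longrightarrow>
      e + modular p (R J) u \<le> C * (e + modular p (cube c s) u)" by blast
    obtain D where D: "D < top" "\<And>(u :: real^'d \<Rightarrow> real) e R i' l. u \<in> borel_measurable borel \<Longrightarrow> R \<in> sets borel \<Longrightarrow> R \<subseteq> cube 0 1 \<Longrightarrow>
      (\<forall>x\<in>R. \<forall>\<tau>. 0 \<le> x $ i' + \<tau> \<longrightarrow> x $ i' + \<tau> \<le> 1 \<longrightarrow> x + \<tau> *\<^sub>R axis i' 1 \<in> R) \<Longrightarrow>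
      0 \<le> l \<Longrightarrow> l + s \<le> 1 \<Longrightarrow> axis_diffs p (cube 0 1) (r $ i) i' u e \<Longrightarrow>
      modular p R u \<le> D * (e + modular p (slab R i' l (l + s)) u)"
      using extend_direction[OF p r s, of i, where 'd='d] by blast
    show ?case
    proof (intro exI[of _ "(1 + D) * C"] conjI allI impI)
      show "(1 + D) * C < top" using C D by (simp add: ennreal_mult_less_top)
      fix u e assume u: "u \<in> borel_measurable borel" and ax: "\<forall>i. axis_diffs p (cube 0 1) (r $ i) i u e"
      have cyl: "\<forall>x\<in>R (insert i J). \<forall>\<tau>. 0 \<le> x $ i + \<tau> \<longrightarrow> x $ i + \<tau> \<le> 1 \<longrightarrow> x + \<tau> *\<^sub>R axis i 1 \<in> R (insert i J)"
        by (auto simp: R_def cube_def axis_def)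
      have "modular p (R (insert i J)) u \<le> D * (e + modular p (slab (R (insert i J)) i (c $ i) (c $ i + s)) u)"
        using c ax by (intro D(2)[OF u _ _ cyl]) (auto simp: R_def)
      also have "slab (R (insert i J)) i (c $ i) (c $ i + s) = R J"
        using insert.hyps by (auto simp: R_def slab_def)
      finally have "e + modular p (R (insert i J)) u \<le> 1 * (e + modular p (R J) u) + D * (e + modular p (R J) u)"
        by (simp add: add_mono)
      also have "\<dots> = (1 + D) * (e + modular p (R J) u)" by (simp only: distrib_right)
      also have "\<dots> \<le> (1 + D) * (C * (e + modular p (cube c s) u))"
        by (intro mult_left_mono C(2) u ax) auto
      finally show "e + modular p (R (insert i J)) u \<le> (1 + D) * C * (e + modular p (cube c s) u)"
        by (simp add: mult.assoc)
    qed
  qed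
  from this[of UNIV] obtain C where C: "C < top" "\<And>u e. u \<in> borel_measurable borel \<Longrightarrow> (\<forall>i. axis_diffs p (cube 0 1) (r $ i) i u e) \<Longrightarrow>
    e + modular p (R UNIV) u \<le> C * (e + modular p (cube c s) u)" by auto
  have "R UNIV = cube 0 1" by (auto simp: R_def)
  then have "modular p (cube 0 1) u \<le> C * (e + modular p (cube c s) u)"
    if "u \<in> borel_measurable borel" "\<forall>i. axis_diffs p (cube 0 1) (r $ i) i u e" for u e
    using order_trans[OF _ C(2)[OF that], of "modular p (cube 0 1) u"] by simp
  then show ?thesis using C(1) by blast
qed

text \<open>In Kemperman's identity the subset \<open>A\<close> contributes an \<open>m\<close>-th
  difference with equal steps \<open>\<alpha> A \<le> 0\<close>, based at a point shifted up by
  \<open>sum w A\<close>. The size of \<open>s\<close> makes both \<open>s + m s\<close> and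
  \<open>m * \<bar>\<alpha> A\<bar>\<close> at most 1/4, so starting from the corner 1/2 all points
  stay between 1/4 and 3/4. The exponent \<open>2 ^ M\<close> bounds the number of subsets.\<close>

lemma small_diffs_of_axis_diffs:
  fixes r :: "nat^'d"
  assumes p: "0 < p" and [measurable]: "f \<in> borel_measurable borel" and M: "\<And>i. r $ i \<le> M"
    and ax: "\<And>i. axis_diffs p (cube 0 1) (r $ i) i f e"
  shows "small_diffs p (\<chi> i. 1 / 2) r (1 / (4 * (real M + 1)\<^sup>2)) f (quasi p ^ (2 ^ M) * e)"
  unfolding small_diffs_def
proof (intro allI impI)
  fix i and hs :: "real list"
  define c :: "real^'d" where "c = (\<chi> i. 1 / 2)"
  define s where "s = 1 / (4 * (real M + 1)\<^sup>2)"
  define m where "m = r $ i"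
  \<comment> \<open>Reversed indexing turns \<open>hs\<close> into the list
    \<open>map w (rev [0..<m])\<close> of \<open>idiff_kemperman\<close>.\<close>
  define w where "w k = rev hs ! k" for k
  assume hs: "length hs = r $ i" "set hs \<subseteq> {0..1 / (4 * (real M + 1)\<^sup>2)}"
  have s: "0 < s" "4 * ((real M + 1)\<^sup>2 * s) = 1" by (auto simp: s_def)
  have mM: "real m \<le> real M" using M by (simp add: m_def)
  have w: "0 \<le> w k \<and> w k \<le> s" if "k < m" for k
  proof -
    have "rev hs ! k \<in> set (rev hs)" using that hs(1) by (intro nth_mem) (simp add: m_def)
    then show ?thesis using hs(2) by (auto simp: w_def s_def)
  qed
  have "map w [0..<m] = rev hs"
    using map_nth[of "rev hs"] hs(1) by (simp add: w_def[abs_def] m_def)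
  then have hs_w: "hs = map w (rev [0..<m])" by (metis rev_map rev_rev_ident)
  define \<alpha> where "\<alpha> A = - (\<Sum>k\<in>A. w k / real (Suc k))" for A
  let ?g = "\<lambda>A x. (-1) ^ card A * idiff i (replicate m (\<alpha> A)) f (x + sum w A *\<^sub>R axis i 1)"
  have "modular p (cube c s) (?g A) \<le> e" if A: "A \<in> Pow {..<m}" for A
  proof -
    have fin: "finite A" "card A \<le> m" using A by (auto intro: finite_subset dest: card_mono[rotated])
    have sum_w: "0 \<le> sum w A" "sum w A \<le> real m * s"
    proof -
      show "0 \<le> sum w A" using w A by (intro sum_nonneg) auto
      have "sum w A \<le> real (card A) * s" using w A by (intro sum_bounded_above) auto
      also have "\<dots> \<le> real m * s" using fin s by (intro mult_right_mono) auto
      finally show "sum w A \<le> real m * s" .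
    qed
    have al: "- sum w A \<le> \<alpha> A" "\<alpha> A \<le> 0"
    proof -
      have "(\<Sum>k\<in>A. w k / real (Suc k)) \<le> sum w A"
      proof (rule sum_mono)
        fix k assume "k \<in> A"
        then have "0 \<le> w k" using w A by auto
        then have "w k / real (Suc k) \<le> w k / 1" by (intro divide_left_mono) auto
        then show "w k / real (Suc k) \<le> w k" by simp
      qed
      then show "- sum w A \<le> \<alpha> A" by (simp add: \<alpha>_def)
      show "\<alpha> A \<le> 0" unfolding \<alpha>_def using w A by (auto intro!: sum_nonneg)
    qed
    have sq: "real m * (real m * s) \<le> 1/4" "s + real m * s \<le> 1/4"
    proof -
      have "1 + real m \<le> (real M + 1) * 1" using mM by simp
      also have "\<dots> \<le> (real M + 1) * (real M + 1)" by (intro mult_left_mono) auto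
      finally have "1 + real m \<le> (real M + 1)\<^sup>2" unfolding power2_eq_square .
      moreover have "real m * real m \<le> (real M + 1)\<^sup>2"
        unfolding power2_eq_square using mM by (intro mult_mono) auto
      ultimately have "real m * real m \<le> (real M + 1)\<^sup>2" "1 + real m \<le> (real M + 1)\<^sup>2" by auto
      then have "(real m * real m) * s \<le> (real M + 1)\<^sup>2 * s" "(1 + real m) * s \<le> (real M + 1)\<^sup>2 * s"
        using s(1) by (intro mult_right_mono; simp)+
      then have "real m * (real m * s) \<le> (real M + 1)\<^sup>2 * s" "s + real m * s \<le> (real M + 1)\<^sup>2 * s"
        by (simp_all only: distrib_right mult_1_left mult.assoc)
      then show "real m * (real m * s) \<le> 1/4" "s + real m * s \<le> 1/4"
        using s(2) by linarith+
    qed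
    have mal: "- (1/4) \<le> real m * \<alpha> A" "real m * \<alpha> A \<le> 0"
    proof -
      have "real m * (- \<alpha> A) \<le> real m * (real m * s)"
        using al sum_w by (intro mult_left_mono) auto
      then show "- (1/4) \<le> real m * \<alpha> A" using sq by simp
      show "real m * \<alpha> A \<le> 0" using al by (simp add: mult_nonneg_nonpos)
    qed
    have "modular p (cube c s) (?g A) \<le> ppow p (ennreal 1) * e"
    proof (rule modular_mult_sub_le[OF p])
      have "modular p (cube c s) (\<lambda>x. idiff i (replicate m (\<alpha> A)) f (x + sum w A *\<^sub>R axis i 1))
        \<le> modular p (shift_dom (cube 0 1) ((real m * \<alpha> A) *\<^sub>R axis i 1)) (idiff i (replicate m (\<alpha> A)) f)"
      proof (rule modular_translate)
        fix x assume x: "x \<in> cube c s"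
        have x': "1/2 \<le> x $ j" "x $ j \<le> 1/2 + s" for j using x by (auto simp: cube_def c_def)
        have "0 \<le> (x + sum w A *\<^sub>R axis i 1) $ j \<and> (x + sum w A *\<^sub>R axis i 1) $ j \<le> 1" for j
          using x'[of j] sum_w sq s by (cases "j = i") (auto simp: axis_def)
        moreover have "0 \<le> (x + sum w A *\<^sub>R axis i 1 + (real m * \<alpha> A) *\<^sub>R axis i 1) $ j \<and>
            (x + sum w A *\<^sub>R axis i 1 + (real m * \<alpha> A) *\<^sub>R axis i 1) $ j \<le> 1" for j
          using x'[of j] sum_w sq s mal by (cases "j = i") (auto simp: axis_def)
        ultimately show "x + sum w A *\<^sub>R axis i 1 \<in> shift_dom (cube 0 1) ((real m * \<alpha> A) *\<^sub>R axis i 1)"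
          unfolding shift_dom_def cube_def by simp
      qed auto
      also have "\<dots> \<le> e"
      proof -
        have "real m * s \<le> 1/4" using sq s by linarith
        then have "\<bar>\<alpha> A\<bar> \<le> 1" using al sum_w by linarith
        then show ?thesis using ax[of i] by (simp add: axis_diffs_def m_def)
      qed
      finally show "modular p (cube c s) (\<lambda>x. idiff i (replicate m (\<alpha> A)) f (x + sum w A *\<^sub>R axis i 1)) \<le> e" .
    qed (auto simp: power_abs)
    also have "ppow p (ennreal 1) = 1" by (simp add: ppow_def)
    finally show ?thesis by simp
  qed
  then have "modular p (cube c s) (\<lambda>x. \<Sum>A\<in>Pow {..<m}. ?g A x) \<le> quasi p ^ card (Pow {..<m}) * e"
    unfolding quasi_def by (intro modular_sum_le p) auto
  also have "(\<lambda>x. \<Sum>A\<in>Pow {..<m}. ?g A x) = idiff i hs f"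
    unfolding hs_w idiff_kemperman[abs_def] \<alpha>_def ..
  also have "quasi p ^ card (Pow {..<m}) * e \<le> quasi p ^ (2 ^ M) * e"
    using mM by (intro mult_right_mono power_increasing quasi_ge_1 p) (auto simp: card_Pow)
  finally show "modular p (cube (\<chi> i. 1 / 2) (1 / (4 * (real M + 1)\<^sup>2))) (idiff i hs f) \<le> quasi p ^ (2 ^ M) * e"
    by (simp add: c_def s_def)
qed

lemma unit_cube_whitney:
  fixes r :: "nat^'d"
  assumes p: "0 < p" and r: "\<And>i. 1 \<le> r $ i"
  shows "\<exists>C<top. \<forall>f e. locally_Lp p (\<chi> i. 1 / 2) f \<longrightarrow> (\<forall>i. axis_diffs p (cube 0 1) (r $ i) i f e) \<longrightarrow>
    (\<exists>\<phi>\<in>polys r. modular p (cube 0 1) (\<lambda>x. f x - \<phi> x) \<le> C * e)"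
proof -
  define c :: "real^'d" where "c = (\<chi> i. 1 / 2)"
  define M where "M = (\<Sum>i\<in>UNIV. r $ i)"
  have M: "r $ i \<le> M" for i unfolding M_def by (rule member_le_sum) auto
  define s where "s = 1 / (4 * (real M + 1)\<^sup>2)"
  have s: "0 < s" "s \<le> 1/2"
  proof -
    have "1 \<le> (real M + 1)\<^sup>2" by simp
    then have "1 \<le> 2 * (real M + 1)\<^sup>2" by linarith
    then show "0 < s" "s \<le> 1/2" unfolding s_def by (auto simp: divide_le_eq)
  qed
  obtain s' C1 where s': "0 < s'" "s' \<le> s" "C1 < \<infinity>"
    "\<And>f e. locally_Lp p c f \<Longrightarrow> small_diffs p c r s f e \<Longrightarrow>
     (\<exists>\<phi>\<in>polys r. modular p (cube c s') (\<lambda>x. f x - \<phi> x) \<le> C1 * e)"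
    using local_whitney[OF p r, of c] s(1) unfolding local_whitney_def by metis
  obtain C2 where C2: "C2 < top" "\<And>u e. u \<in> borel_measurable borel \<Longrightarrow> (\<forall>i. axis_diffs p (cube 0 1) (r $ i) i u e) \<Longrightarrow>
    modular p (cube 0 1) u \<le> C2 * (e + modular p (cube c s') u)"
    using extend_to_unit_cube[OF p r s'(1), where c=c] s' s by (auto simp: c_def)
  define Q where "Q = quasi p ^ (2 ^ M)"
  have Q: "Q < top" using quasi_finite[of p] by (simp add: Q_def power_less_top_ennreal)
  have "\<exists>\<phi>\<in>polys r. modular p (cube 0 1) (\<lambda>x. f x - \<phi> x) \<le> C2 * (1 + C1 * Q) * e"
    if f: "locally_Lp p c f" and ax: "\<forall>i. axis_diffs p (cube 0 1) (r $ i) i f e" for f e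
  proof -
    note [measurable] = locally_LpD(1)[OF f]
    have "small_diffs p c r s f (Q * e)"
      unfolding c_def s_def Q_def using ax M by (intro small_diffs_of_axis_diffs p) auto
    then obtain \<phi> where \<phi>: "\<phi> \<in> polys r" "modular p (cube c s') (\<lambda>x. f x - \<phi> x) \<le> C1 * (Q * e)"
      using s'(4)[OF f] by blast
    note [measurable] = polys_measurable[OF \<phi>(1)]
    \<comment> \<open>The error inherits the axis differences of \<open>f\<close>, so the extension
      applies to the error itself, starting from its size on the small cube.\<close>
    have "idiff i (replicate (r $ i) h) (\<lambda>x. f x - \<phi> x) = idiff i (replicate (r $ i) h) f" for i h
      using polys_idiff_eq_0[OF \<phi>(1), of "replicate (r $ i) h" i] by (auto simp: fun_eq_iff idiff_diff)
    then have "\<forall>i. axis_diffs p (cube 0 1) (r $ i) i (\<lambda>x. f x - \<phi> x) e"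
      using ax unfolding axis_diffs_def by simp
    then have "modular p (cube 0 1) (\<lambda>x. f x - \<phi> x) \<le> C2 * (e + modular p (cube c s') (\<lambda>x. f x - \<phi> x))"
      by (intro C2(2)) auto
    also have "\<dots> \<le> C2 * (e + C1 * (Q * e))" by (intro mult_left_mono add_left_mono \<phi>) auto
    also have "\<dots> = C2 * (1 + C1 * Q) * e" by (simp add: algebra_simps)
    finally show ?thesis using \<phi>(1) by blast
  qed
  moreover have "C2 * (1 + C1 * Q) < top" using C2(1) s'(3) Q by (simp add: ennreal_mult_less_top)
  ultimately show ?thesis unfolding c_def by blast
qed

section \<open>Borel representatives\<close>

lemma AE_lborel_translate:
  fixes P :: "'a::euclidean_space \<Rightarrow> bool"
  assumes "AE x in lborel. P x" shows "AE x in lborel. P (x + v)"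
proof -
  have "AE x in distr lborel borel ((+) v). P x" unfolding lborel_distr_plus by (rule assms)
  then have "AE x in lborel. P (v + x)" by (rule AE_distrD[rotated]) simp
  then show ?thesis by (simp add: add.commute)
qed

text \<open>That \<open>g\<close> vanishes outside \<open>Q\<close> later makes the rescaled
  function finite on every cube, not only on the unit cube.\<close>

lemma Lp_space_borel_version:
  assumes f: "f \<in> Lp_space p Q" and [measurable]: "Q \<in> sets borel"
  obtains g where "g \<in> borel_measurable borel" "AE x in lborel. x \<in> Q \<longrightarrow> f x = g x" "\<And>x. x \<notin> Q \<Longrightarrow> g x = 0"
proof -
  have "f \<in> borel_measurable (lebesgue_on Q)" using f by (simp add: Lp_space_def)
  then have "(\<lambda>x. if x \<in> Q then f x else 0) \<in> borel_measurable lebesgue"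
    by (rule borel_measurable_if_I) simp
  then obtain g where [measurable]: "g \<in> borel_measurable lborel" and g: "AE x in lborel. (if x \<in> Q then f x else 0) = g x"
    by (blast dest: completion_ex_borel_measurable_real)
  show thesis
  proof (rule that)
    show "(\<lambda>x. if x \<in> Q then g x else 0) \<in> borel_measurable borel" by measurable
    show "AE x in lborel. x \<in> Q \<longrightarrow> f x = (if x \<in> Q then g x else 0)"
      using g by (rule eventually_mono) auto
  qed simp
qed

section \<open>Mixed differences as combinations of shifts\<close>

lemma pdiff_0 [simp]: "pdiff i 0 h f = f"
  by (simp add: pdiff_eq_idiff)

lemma pdiff_sum:
  "pdiff i m h f x = (\<Sum>j=0..m. (-1) ^ (m - j) * real (m choose j) * f (x + (real j * h) *\<^sub>R axis i 1))"
  by (simp add: pdiff_eq_idiff idiff_replicate)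

lemma mixed_diff_single: "mixed_diff (restrict_idx r {i}) h f = pdiff i (r $ i) (h $ i) f"
proof -
  let ?F = "\<lambda>j. pdiff j (restrict_idx r {i} $ j) (h $ j)"
  interpret comp_fun_commute ?F by (rule comp_fun_commute_pdiff)
  have id: "Finite_Set.fold ?F f A = f" if "finite A" "i \<notin> A" for A
    using that
  proof (induction A)
    case (insert j A)
    have "Finite_Set.fold ?F f (insert j A) = ?F j (Finite_Set.fold ?F f A)"
      by (rule fold_insert) (use insert.hyps in auto)
    also have "Finite_Set.fold ?F f A = f" using insert by blast
    also have "?F j f = f" using insert.prems by (auto simp: restrict_idx_def)
    finally show ?case .
  qed simp
  have "mixed_diff (restrict_idx r {i}) h f = ?F i (Finite_Set.fold ?F f (UNIV - {i}))"
    unfolding mixed_diff_def by (rule fold_rec) auto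
  also have "Finite_Set.fold ?F f (UNIV - {i}) = f" by (rule id) auto
  finally show ?thesis by (simp add: restrict_idx_def)
qed

text \<open>The list \<open>ks\<close> precedes \<open>h\<close>, \<open>f\<close> and
  \<open>x\<close>, which makes the constants derived from it uniform. A list may repeat
  multi-indices, so like terms need not be collected. That \<open>k\<close> vanishes off
  \<open>A\<close> allows \<open>upd\<close> to insert the shift in a new direction.\<close>

lemma fold_pdiff_shifts:
  fixes s :: "nat^'d"
  assumes "finite A"
  shows "\<exists>ks :: (real \<times> (nat^'d)) list. (\<forall>(c, k) \<in> set ks. \<forall>i. k $ i \<le> s $ i \<and> (i \<notin> A \<longrightarrow> k $ i = 0)) \<and>
    (\<forall>h f x. Finite_Set.fold (\<lambda>i. pdiff i (s $ i) (h $ i)) f A x =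
      (\<Sum>(c, k)\<leftarrow>ks. c * f (x + (\<chi> i. real (k $ i) * h $ i))))"
  using assms
proof (induction A)
  case empty
  have "(\<chi> i. real ((0 :: nat^'d) $ i) * h $ i) = (0 :: real^'d)" for h by (simp add: vec_eq_iff)
  then show ?case by (intro exI[of _ "[(1, 0)]"]) simp
next
  case (insert i A)
  then obtain ks :: "(real \<times> (nat^'d)) list" where ks: "\<forall>(c, k) \<in> set ks. \<forall>i. k $ i \<le> s $ i \<and> (i \<notin> A \<longrightarrow> k $ i = 0)"
    "\<And>h f x. Finite_Set.fold (\<lambda>i. pdiff i (s $ i) (h $ i)) f A x =
      (\<Sum>(c, k)\<leftarrow>ks. c * f (x + (\<chi> i. real (k $ i) * h $ i)))" by blast
  define g where "g j = (-1) ^ (s $ i - j) * real (s $ i choose j)" for j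
  define ks' where "ks' = concat (map (\<lambda>j. map (\<lambda>(c, k). (g j * c, upd k i j)) ks) [0..<Suc (s $ i)])"
  have "Finite_Set.fold (\<lambda>i. pdiff i (s $ i) (h $ i)) f (insert i A) x =
      (\<Sum>(c, k)\<leftarrow>ks'. c * f (x + (\<chi> i. real (k $ i) * h $ i)))" for h f x
  proof -
    interpret comp_fun_commute "\<lambda>i. pdiff i (s $ i) (h $ i)" by (rule comp_fun_commute_pdiff)
    have "Finite_Set.fold (\<lambda>i. pdiff i (s $ i) (h $ i)) f (insert i A) x =
       (\<Sum>j=0..s $ i. g j * (\<Sum>(c, k)\<leftarrow>ks. c * f (x + (real j * h $ i) *\<^sub>R axis i 1 + (\<chi> i. real (k $ i) * h $ i))))"
      by (simp only: fold_insert[OF insert.hyps] pdiff_sum ks(2) g_def)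
    also have "\<dots> = (\<Sum>j=0..s $ i. \<Sum>(c, k)\<leftarrow>ks. g j * c * f (x + (\<chi> l. real (upd k i j $ l) * h $ l)))"
    proof (intro sum.cong refl)
      fix j
      have eq: "x + (real j * h $ i) *\<^sub>R axis i 1 + (\<chi> i. real (k $ i) * h $ i) = x + (\<chi> l. real (upd k i j $ l) * h $ l)"
        if "(c, k) \<in> set ks" for c k
        using ks(1) that insert.hyps by (auto simp: vec_eq_iff axis_def)
      show "g j * (\<Sum>(c, k)\<leftarrow>ks. c * f (x + (real j * h $ i) *\<^sub>R axis i 1 + (\<chi> i. real (k $ i) * h $ i))) =
        (\<Sum>(c, k)\<leftarrow>ks. g j * c * f (x + (\<chi> l. real (upd k i j $ l) * h $ l)))"
        unfolding sum_list_const_mult[symmetric]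
      proof (intro arg_cong[where f=sum_list] map_cong refl)
        fix z assume z: "z \<in> set ks"
        obtain c k where ck: "z = (c, k)" by force
        show "g j * (case z of (c, k) \<Rightarrow> c * f (x + (real j * h $ i) *\<^sub>R axis i 1 + (\<chi> i. real (k $ i) * h $ i))) =
            (case z of (c, k) \<Rightarrow> g j * c * f (x + (\<chi> l. real (upd k i j $ l) * h $ l)))"
          unfolding ck prod.case eq[OF z[unfolded ck]] by (rule mult.assoc[symmetric])
      qed
    qed
    also have "\<dots> = (\<Sum>j\<leftarrow>[0..<Suc (s $ i)]. \<Sum>(c, k)\<leftarrow>ks. g j * c * f (x + (\<chi> l. real (upd k i j $ l) * h $ l)))"
      unfolding interv_sum_list_conv_sum_set_nat set_upt by (simp add: atLeastLessThanSuc_atLeastAtMost del: upd_nth)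
    also have "\<dots> = (\<Sum>(c, k)\<leftarrow>ks'. c * f (x + (\<chi> i. real (k $ i) * h $ i)))"
    proof -
      have "sum_list (map F (concat (map G js))) = (\<Sum>j\<leftarrow>js. sum_list (map F (G j)))"
        for F :: "real \<times> (nat^'d) \<Rightarrow> real" and G :: "nat \<Rightarrow> (real \<times> (nat^'d)) list" and js
        by (induction js) auto
      then show ?thesis
        unfolding ks'_def map_map o_def by (simp add: case_prod_unfold o_def del: upd_nth upt_Suc)
    qed
    finally show ?thesis .
  qed
  moreover have "\<forall>(c, k) \<in> set ks'. \<forall>l. k $ l \<le> s $ l \<and> (l \<notin> insert i A \<longrightarrow> k $ l = 0)"
    using ks(1) unfolding ks'_def by (auto simp del: upt_Suc)
  ultimately show ?case by blast
qed

lemma mixed_diff_shifts: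
  fixes s :: "nat^'d"
  shows "\<exists>ks :: (real \<times> (nat^'d)) list. (\<forall>c k i. (c, k) \<in> set ks \<longrightarrow> k $ i \<le> s $ i) \<and>
    (\<forall>h f x. mixed_diff s h f x = (\<Sum>(c, k)\<leftarrow>ks. c * f (x + (\<chi> i. real (k $ i) * h $ i))))"
proof -
  obtain ks :: "(real \<times> (nat^'d)) list" where ks: "\<forall>(c, k) \<in> set ks. \<forall>i. k $ i \<le> s $ i \<and> (i \<notin> UNIV \<longrightarrow> k $ i = 0)"
    "\<forall>h f x. mixed_diff s h f x = (\<Sum>(c, k)\<leftarrow>ks. c * f (x + (\<chi> i. real (k $ i) * h $ i)))"
    using fold_pdiff_shifts[OF finite[of UNIV], of s] unfolding mixed_diff_def by blast
  show ?thesis by (rule exI[of _ ks]) (use ks in auto)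
qed

text \<open>The factors commute, so the one in direction \<open>i\<close> may act first. It
  annihilates \<open>\<phi>\<close>, and the other factors, being combinations of shifts, map 0 to
  0.\<close>

lemma mixed_diff_polys:
  assumes \<phi>: "\<phi> \<in> polys r" and i: "s $ i = r $ i"
  shows "mixed_diff s h \<phi> = (\<lambda>x. 0)"
proof -
  let ?F = "\<lambda>i. pdiff i (s $ i) (h $ i)"
  interpret comp_fun_commute ?F by (rule comp_fun_commute_pdiff)
  have "Finite_Set.fold ?F (?F i \<phi>) (UNIV - {i}) = mixed_diff s h \<phi>"
    unfolding mixed_diff_def using fold_fun_left_comm[of "UNIV - {i}" i \<phi>] fold_rec[of UNIV i \<phi>] by simp
  moreover have "?F i \<phi> = (\<lambda>x. 0)"
    unfolding pdiff_eq_idiff using polys_idiff_eq_0[OF \<phi>, of "replicate (s $ i) (h $ i)" i] i by simp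
  moreover obtain ks :: "(real \<times> (nat^'a)) list" where
    "\<And>f x. Finite_Set.fold ?F f (UNIV - {i}) x = (\<Sum>(c, k)\<leftarrow>ks. c * f (x + (\<chi> i. real (k $ i) * h $ i)))"
    using fold_pdiff_shifts[of "UNIV - {i}" s] by auto
  ultimately show ?thesis by (auto simp: fun_eq_iff case_prod_unfold)
qed

text \<open>In each coordinate the new point lies between \<open>x\<close> and
  \<open>x + s h\<close>, whatever the sign of \<open>h $ i\<close>.\<close>

lemma mem_cbox_shift:
  fixes a :: "real^'d"
  assumes x: "x \<in> shift_dom (cbox a b) (\<chi> i. real (s $ i) * h $ i)" and k: "\<And>i. k $ i \<le> s $ i"
  shows "x + (\<chi> i. real (k $ i) * h $ i) \<in> cbox a b"
  unfolding mem_box_cart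
proof
  fix i
  have x: "a $ i \<le> x $ i" "x $ i \<le> b $ i" "a $ i \<le> x $ i + real (s $ i) * h $ i" "x $ i + real (s $ i) * h $ i \<le> b $ i"
    using x by (auto simp: shift_dom_def mem_box_cart)
  have "0 \<le> real (k $ i) * h $ i \<and> real (k $ i) * h $ i \<le> real (s $ i) * h $ i \<or>
      real (s $ i) * h $ i \<le> real (k $ i) * h $ i \<and> real (k $ i) * h $ i \<le> 0"
    using k[of i] by (cases "0 \<le> h $ i") (auto intro: mult_right_mono mult_right_mono_neg mult_nonneg_nonpos)
  then show "a $ i \<le> (x + (\<chi> i. real (k $ i) * h $ i)) $ i \<and> (x + (\<chi> i. real (k $ i) * h $ i)) $ i \<le> b $ i"
    using x by auto
qed

section \<open>The moduli are bounded by the error\<close>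

definition shifts_const :: "ennreal \<Rightarrow> (real \<times> 'b) list \<Rightarrow> ennreal" where
  "shifts_const p ks = foldr (\<lambda>(c, k) B. ppow p 2 * (ppow p (ennreal \<bar>c\<bar>) + B)) ks 0"

lemma shifts_const_finite: "shifts_const p ks < top"
proof (induction ks)
  case (Cons ck ks)
  then show ?case
    using ppow_finite[of 2 p] ppow_finite[of "ennreal \<bar>fst ck\<bar>" p]
    by (simp add: shifts_const_def case_prod_beta ennreal_mult_less_top)
qed (simp add: shifts_const_def)

lemma modular_shifts_le:
  assumes p: "0 < p" and [measurable]: "u \<in> borel_measurable borel" "T \<in> sets borel" "Q \<in> sets borel"
    and T: "\<And>x c k. x \<in> T \<Longrightarrow> (c, k) \<in> set ks \<Longrightarrow> x + v k \<in> Q"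
  shows "(\<lambda>x. \<Sum>(c, k)\<leftarrow>ks. c * u (x + v k)) \<in> borel_measurable borel \<and>
    modular p T (\<lambda>x. \<Sum>(c, k)\<leftarrow>ks. c * u (x + v k)) \<le> shifts_const p ks * modular p Q u"
  using T
proof (induction ks)
  case Nil
  then show ?case using p by (simp add: modular_0)
next
  case (Cons ck ks)
  obtain c k where ck: "ck = (c, k)" by force
  let ?R = "\<lambda>x. \<Sum>(c, k)\<leftarrow>ks. c * u (x + v k)"
  have IH: "?R \<in> borel_measurable borel" "modular p T ?R \<le> shifts_const p ks * modular p Q u"
    using Cons by auto
  have "modular p T (\<lambda>x. u (x + v k)) \<le> modular p Q u"
    using Cons.prems ck by (intro modular_translate) auto
  then have "modular p T (\<lambda>x. c * u (x + v k)) \<le> ppow p (ennreal \<bar>c\<bar>) * modular p Q u"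
    by (intro modular_mult_left_le p) auto
  then have "modular p T (\<lambda>x. c * u (x + v k) + ?R x) \<le>
      ppow p 2 * (ppow p (ennreal \<bar>c\<bar>) * modular p Q u + shifts_const p ks * modular p Q u)"
    using IH by (intro modular_add_le p) auto
  also have "\<dots> = shifts_const p (ck # ks) * modular p Q u"
    by (simp add: shifts_const_def ck distrib_right mult.assoc)
  finally show ?case using IH(1) by (simp add: ck)
qed

text \<open>Finitely many translates of the exceptional null set form a null set.\<close>

lemma shifts_AE_eq:
  fixes f g :: "'a::euclidean_space \<Rightarrow> real"
  assumes "AE x in lborel. x \<in> Q \<longrightarrow> f x = g x"
    and T: "\<And>x c k. x \<in> T \<Longrightarrow> (c, k) \<in> set ks \<Longrightarrow> x + v k \<in> Q"
  shows "AE x in lborel. x \<in> T \<longrightarrow> (\<Sum>(c, k)\<leftarrow>ks. c * f (x + v k)) = (\<Sum>(c, k)\<leftarrow>ks. c * g (x + v k))"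
  using T
proof (induction ks)
  case (Cons ck ks)
  have "AE x in lborel. x + v (snd ck) \<in> Q \<longrightarrow> f (x + v (snd ck)) = g (x + v (snd ck))"
    by (rule AE_lborel_translate[OF assms(1)])
  moreover have "AE x in lborel. x \<in> T \<longrightarrow> (\<Sum>(c, k)\<leftarrow>ks. c * f (x + v k)) = (\<Sum>(c, k)\<leftarrow>ks. c * g (x + v k))"
    using Cons by auto
  ultimately show ?case
  proof eventually_elim
    case (elim x)
    then show ?case using Cons.prems[of x "fst ck" "snd ck"] by (auto simp: case_prod_unfold)
  qed
qed simp

text \<open>Turns a finite factor between modulars into a positive real factor between quasi-norms;
  the summand 1 in the proof secures positivity.\<close>

lemma ppow_bound:
  assumes "0 < p" "C < top"
  obtains C' where "0 < C'" "C \<le> ppow p (ennreal C')"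
proof -
  obtain C' where C': "0 < C'" "ppow p (ennreal C') = ennreal (enn2real C + 1)"
    using ppow_surj[OF assms(1), of "enn2real C + 1"] by (auto simp: add_nonneg_pos)
  have "C = ennreal (enn2real C)" using assms(2) by simp
  also have "\<dots> \<le> ennreal (enn2real C + 1)" by (rule ennreal_leI) simp
  finally show ?thesis using that C' by simp
qed

lemma mixed_modulus_le_error:
  fixes r s :: "nat^'d"
  assumes p: "0 < p" and i: "s $ i = r $ i"
  obtains C where "0 < C"
    "\<And>a b f \<phi> t. f \<in> Lp_space p (cbox a b) \<Longrightarrow> \<phi> \<in> polys r \<Longrightarrow>
      mixed_modulus s f t p (cbox a b) \<le> ennreal C * Lp_norm p (cbox a b) (\<lambda>x. f x - \<phi> x)"
proof -
  obtain ks :: "(real \<times> (nat^'d)) list" where ks: "\<And>c k i. (c, k) \<in> set ks \<Longrightarrow> k $ i \<le> s $ i"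
    "\<And>h f x. mixed_diff s h f x = (\<Sum>(c, k)\<leftarrow>ks. c * f (x + (\<chi> i. real (k $ i) * h $ i)))"
    using mixed_diff_shifts[of s] by blast
  obtain C where C: "0 < C" "shifts_const p ks \<le> ppow p (ennreal C)"
    using ppow_bound[OF p shifts_const_finite] .
  show thesis
  proof (rule that[OF C(1)])
    fix a b :: "real^'d" and f \<phi> t assume f: "f \<in> Lp_space p (cbox a b)" and \<phi>: "\<phi> \<in> polys r"
    let ?Q = "cbox a b"
    let ?L = "Lp_norm p ?Q (\<lambda>x. f x - \<phi> x)"
    obtain g where [measurable]: "g \<in> borel_measurable borel" and g: "AE x in lborel. x \<in> ?Q \<longrightarrow> f x = g x"
      using Lp_space_borel_version[OF f] by auto
    define u where "u = (\<lambda>x. g x - \<phi> x)"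
    have [measurable]: "u \<in> borel_measurable borel"
      unfolding u_def using polys_measurable[OF \<phi>] by measurable
    have fu: "AE x in lborel. x \<in> ?Q \<longrightarrow> f x - \<phi> x = u x"
      using g by (rule eventually_mono) (auto simp: u_def)
    have u: "modular p ?Q u \<le> ppow p ?L"
      using Lp_norm_le_iff[OF p _ _ fu, of ?L] by simp
    have "Lp_norm p (shift_dom ?Q (\<chi> i. real (s $ i) * h $ i)) (mixed_diff s h f) \<le> ennreal C * ?L" for h
    proof -
      let ?T = "shift_dom ?Q (\<chi> i. real (s $ i) * h $ i)"
      let ?v = "\<lambda>k :: nat^'d. \<chi> i. real (k $ i) * h $ i"
      let ?U = "\<lambda>x. \<Sum>(c, k)\<leftarrow>ks. c * u (x + ?v k)"
      have T: "x + ?v k \<in> ?Q" if "x \<in> ?T" "(c, k) \<in> set ks" for x c k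
        using that ks(1) by (intro mem_cbox_shift) auto
      \<comment> \<open>Subtracting the vanishing difference of \<open>\<phi>\<close> turns the
        expansion for \<open>f\<close> into one for the error.\<close>
      have md: "mixed_diff s h f x = (\<Sum>(c, k)\<leftarrow>ks. c * (f (x + ?v k) - \<phi> (x + ?v k)))" for x
      proof -
        have "mixed_diff s h f x = mixed_diff s h f x - mixed_diff s h \<phi> x"
          using mixed_diff_polys[where s=s and r=r, OF \<phi> i] by simp
        also have "\<dots> = (\<Sum>(c, k)\<leftarrow>ks. c * (f (x + ?v k) - \<phi> (x + ?v k)))"
          unfolding ks(2) sum_list_subtractf[symmetric] by (simp add: case_prod_unfold right_diff_distrib)
        finally show ?thesis .
      qed
      have ae: "AE x in lborel. x \<in> ?T \<longrightarrow> mixed_diff s h f x = ?U x"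
        unfolding md by (rule shifts_AE_eq[OF fu T])
      have U: "?U \<in> borel_measurable borel" "modular p ?T ?U \<le> shifts_const p ks * modular p ?Q u"
        using modular_shifts_le[OF p, of u ?T ?Q ks ?v] T by auto
      note U(2)
      also have "shifts_const p ks * modular p ?Q u \<le> ppow p (ennreal C) * ppow p ?L"
        by (intro mult_mono C u) auto
      also have "\<dots> = ppow p (ennreal C * ?L)" by (simp add: ppow_mult p)
      finally show ?thesis using Lp_norm_le_iff[OF p U(1) _ ae] by simp
    qed
    then show "mixed_modulus s f t p ?Q \<le> ennreal C * ?L"
      unfolding mixed_modulus_def by (intro SUP_least) auto
  qed
qed

text \<open>Every nonempty \<open>e\<close> contains a direction in which
  \<open>restrict_idx r e\<close> has the full order, so no summand of the total modulus sees
  polynomials. \<open>D\<close> adds up the constants of the finitely many summands.\<close>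

lemma total_modulus_le_best_approx:
  fixes r :: "nat^'d"
  assumes p: "0 < p"
  obtains C where "0 < C"
    "\<And>a b f t. f \<in> Lp_space p (cbox a b) \<Longrightarrow>
      ennreal C * total_modulus r f t p (cbox a b) \<le> best_approx r f p (cbox a b)"
proof -
  have "\<exists>C>0. \<forall>a b f \<phi> t. f \<in> Lp_space p (cbox a b) \<longrightarrow> \<phi> \<in> polys r \<longrightarrow>
      mixed_modulus (restrict_idx r e) f t p (cbox a b) \<le> ennreal C * Lp_norm p (cbox a b) (\<lambda>x. f x - \<phi> x)"
    if e: "e \<noteq> {}" for e
  proof -
    obtain i where "i \<in> e" using e by blast
    then have "restrict_idx r e $ i = r $ i" by (simp add: restrict_idx_def)
    then show ?thesis using mixed_modulus_le_error[OF p, of "restrict_idx r e" i r] by metis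
  qed
  then obtain C where C: "\<And>e. e \<noteq> {} \<Longrightarrow> 0 < C e" "\<And>e a b f \<phi> t. e \<noteq> {} \<Longrightarrow> f \<in> Lp_space p (cbox a b) \<Longrightarrow> \<phi> \<in> polys r \<Longrightarrow>
      mixed_modulus (restrict_idx r e) f t p (cbox a b) \<le> ennreal (C e) * Lp_norm p (cbox a b) (\<lambda>x. f x - \<phi> x)"
    by metis
  define D where "D = (\<Sum>e | e \<noteq> {}. C e)"
  have D: "0 < D" unfolding D_def using C(1) by (intro sum_pos) auto
  show thesis
  proof (rule that[of "1 / D"])
    show "0 < 1 / D" using D by simp
    fix a b :: "real^'d" and f t assume f: "f \<in> Lp_space p (cbox a b)"
    have "total_modulus r f t p (cbox a b) \<le> ennreal D * Lp_norm p (cbox a b) (\<lambda>x. f x - \<phi> x)" if "\<phi> \<in> polys r" for \<phi>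
    proof -
      have "total_modulus r f t p (cbox a b) \<le> (\<Sum>e | e \<noteq> {}. ennreal (C e) * Lp_norm p (cbox a b) (\<lambda>x. f x - \<phi> x))"
        unfolding total_modulus_def by (intro sum_mono C(2) f that) auto
      also have "\<dots> = (\<Sum>e | e \<noteq> {}. ennreal (C e)) * Lp_norm p (cbox a b) (\<lambda>x. f x - \<phi> x)"
        by (simp add: sum_distrib_right)
      also have "(\<Sum>e | e \<noteq> {}. ennreal (C e)) = ennreal D"
        unfolding D_def using C(1) by (intro sum_ennreal) (auto intro: less_imp_le)
      finally show ?thesis .
    qed
    then have "ennreal (1 / D) * total_modulus r f t p (cbox a b)
        \<le> ennreal (1 / D) * (ennreal D * Lp_norm p (cbox a b) (\<lambda>x. f x - \<phi> x))" if "\<phi> \<in> polys r" for \<phi>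
      using that by (intro mult_left_mono) auto
    moreover have "ennreal (1 / D) * (ennreal D * L) = L" for L
    proof -
      have "ennreal (1 / D) * ennreal D = 1" using D by (subst ennreal_mult[symmetric]) auto
      then show ?thesis by (simp add: mult.assoc[symmetric])
    qed
    ultimately show "ennreal (1 / D) * total_modulus r f t p (cbox a b) \<le> best_approx r f p (cbox a b)"
      unfolding best_approx_def by (intro INF_greatest) simp
  qed
qed

section \<open>Change of variables\<close>

lemma mem_cbox_stretch:
  assumes "\<And>i. a $ i < b $ i"
  shows "stretch a (b - a) x \<in> cbox a b \<longleftrightarrow> x \<in> cube 0 1"
proof -
  have "a $ i \<le> a $ i + (b $ i - a $ i) * x $ i \<and> a $ i + (b $ i - a $ i) * x $ i \<le> b $ i \<longleftrightarrow> 0 \<le> x $ i \<and> x $ i \<le> 1" for i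
  proof -
    have d: "0 < b $ i - a $ i" using assms by simp
    have "a $ i + (b $ i - a $ i) * x $ i \<le> b $ i \<longleftrightarrow> (b $ i - a $ i) * x $ i \<le> (b $ i - a $ i) * 1" by (simp add: algebra_simps)
    then show ?thesis using d by (simp add: zero_le_mult_iff mult_le_cancel_left_pos)
  qed
  then show ?thesis by (simp add: mem_box_cart cube_def stretch_def)
qed

lemma stretch_axis: "stretch a c (x + t *\<^sub>R axis i 1) = stretch a c x + (c $ i * t) *\<^sub>R axis i 1"
  by (auto simp: stretch_def vec_eq_iff axis_def algebra_simps)

lemma idiff_stretch:
  "idiff i hs (\<lambda>x. f (stretch a c x)) x = idiff i (map (\<lambda>h. c $ i * h) hs) f (stretch a c x)"
  by (induction hs arbitrary: x) (auto simp: stretch_axis)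

text \<open>A step vector along the axis \<open>i\<close> is admissible in the summand
  \<open>e = {i}\<close> of the total modulus, where the mixed difference is the univariate
  one.\<close>

lemma modular_axis_diff_le:
  fixes r :: "nat^'d"
  assumes p: "0 < p" and [measurable]: "g \<in> borel_measurable borel"
    and g: "AE x in lborel. x \<in> cbox a b \<longrightarrow> f x = g x"
    and ab: "\<And>i. a $ i < b $ i" and h: "\<bar>h\<bar> \<le> b $ i - a $ i"
  shows "modular p (shift_dom (cbox a b) ((real (r $ i) * h) *\<^sub>R axis i 1)) (idiff i (replicate (r $ i) h) g)
    \<le> ppow p (total_modulus r f (b - a) p (cbox a b))"
proof -
  let ?s = "restrict_idx r {i}"
  let ?h = "h *\<^sub>R axis i 1 :: real^'d"
  let ?T = "shift_dom (cbox a b) (\<chi> j. real (?s $ j) * ?h $ j)"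
  have T: "?T = shift_dom (cbox a b) ((real (r $ i) * h) *\<^sub>R axis i 1)"
    by (rule arg_cong[where f="shift_dom _"]) (auto simp: vec_eq_iff restrict_idx_def axis_def)
  have md: "mixed_diff ?s ?h u = idiff i (replicate (r $ i) h) u" for u
    by (simp add: mixed_diff_single pdiff_eq_idiff)
  obtain ks :: "(real \<times> (nat^'d)) list" where ks: "\<And>c k i. (c, k) \<in> set ks \<Longrightarrow> k $ i \<le> ?s $ i"
    "\<And>h f x. mixed_diff ?s h f x = (\<Sum>(c, k)\<leftarrow>ks. c * f (x + (\<chi> i. real (k $ i) * h $ i)))"
    using mixed_diff_shifts[of ?s] by blast
  have ae: "AE x in lborel. x \<in> ?T \<longrightarrow> mixed_diff ?s ?h f x = mixed_diff ?s ?h g x"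
    unfolding ks(2) by (rule shifts_AE_eq[OF g]) (rule mem_cbox_shift[OF _ ks(1)])
  have "Lp_norm p ?T (mixed_diff ?s ?h f) \<le> mixed_modulus ?s f (b - a) p (cbox a b)"
    unfolding mixed_modulus_def using h ab
    by (intro SUP_upper) (auto simp: axis_def less_imp_le)
  also have "\<dots> \<le> total_modulus r f (b - a) p (cbox a b)"
    unfolding total_modulus_def by (rule member_le_sum) auto
  finally have "modular p ?T (mixed_diff ?s ?h g) \<le> ppow p (total_modulus r f (b - a) p (cbox a b))"
    by (subst (asm) Lp_norm_le_iff[OF p _ _ ae]) (auto simp: md)
  then show ?thesis unfolding T md .
qed

text \<open>The factor \<open>J\<close> between modulars on the box and on the unit cube depends on
  the box. It enters the bound for the differences as \<open>I = 1 / J\<close> and the error as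
  \<open>J\<close>, so it cancels from the constant.\<close>

lemma best_approx_le_total_modulus:
  fixes r :: "nat^'d"
  assumes p: "0 < p" and r: "\<And>i. 1 \<le> r $ i"
  obtains C where "0 < C"
    "\<And>a b f. (\<And>i. a $ i < b $ i) \<Longrightarrow> f \<in> Lp_space p (cbox a b) \<Longrightarrow>
      best_approx r f p (cbox a b) \<le> ennreal C * total_modulus r f (b - a) p (cbox a b)"
proof -
  obtain C1 where C1: "C1 < top"
    "\<And>f e. locally_Lp p (\<chi> i. 1 / 2) f \<Longrightarrow> (\<forall>i. axis_diffs p (cube 0 1) (r $ i) i f e) \<Longrightarrow>
      (\<exists>\<phi>\<in>polys r. modular p (cube 0 1) (\<lambda>x. f x - \<phi> x) \<le> C1 * e)"
    using unit_cube_whitney[OF p r] by blast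
  obtain C where C: "0 < C" "C1 \<le> ppow p (ennreal C)" using ppow_bound[OF p C1(1)] .
  show thesis
  proof (rule that[OF C(1)])
    fix a b :: "real^'d" and f assume ab: "\<And>i. a $ i < b $ i" and f: "f \<in> Lp_space p (cbox a b)"
    let ?Q = "cbox a b"
    let ?\<Omega> = "total_modulus r f (b - a) p ?Q"
    define c where "c = b - a"
    have c: "0 < c $ i" for i using ab by (simp add: c_def)
    obtain g where [measurable]: "g \<in> borel_measurable borel" and g: "AE x in lborel. x \<in> ?Q \<longrightarrow> f x = g x"
      and g0: "\<And>x. x \<notin> ?Q \<Longrightarrow> g x = 0"
      using Lp_space_borel_version[OF f] by auto
    define F where "F = (\<lambda>x. g (stretch a c x))"
    have [measurable]: "F \<in> borel_measurable borel" unfolding F_def by measurable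
    have vQ: "stretch a c -` ?Q = cube 0 1"
      using mem_cbox_stretch[OF ab] by (auto simp: c_def)
    define J where "J = stretch_factor p c"
    have "\<exists>j>0. J = ennreal j"
      unfolding J_def stretch_factor_def using c by (auto intro!: exI[of _ "1::real"] exI[of _ "prod (($) c) UNIV"] prod_pos)
    then obtain j where j: "0 < j" "J = ennreal j" by blast
    define I where "I = ennreal (1 / j)"
    have one: "I * J = 1" unfolding I_def j(2) using j(1) by (subst ennreal_mult[symmetric]) auto
    have "I * (J * t) = (I * J) * t" "J * (I * t) = (I * J) * t" for t
      by (simp_all only: mult_ac)
    then have IJ: "I * (J * t) = t" "J * (I * t) = t" for t
      unfolding one by simp_all
    have fin: "modular p ?Q g < \<infinity>"
    proof -
      have "Lp_norm p ?Q f < \<infinity>" using f by (simp add: Lp_space_def)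
      moreover have "modular p ?Q g \<le> ppow p (Lp_norm p ?Q f)"
        using Lp_norm_le_iff[OF p _ _ g, of "Lp_norm p ?Q f"] by simp
      ultimately show ?thesis using ppow_finite[of "Lp_norm p ?Q f" p] by (simp add: le_less_trans)
    qed
    \<comment> \<open>\<open>F\<close> vanishes outside the unit cube, so its size on any cube is at
      most that on the unit cube.\<close>
    have "locally_Lp p (\<chi> i. 1 / 2) F"
      unfolding locally_Lp_def
    proof (intro conjI allI)
      fix s
      let ?S = "cube (\<chi> i. 1 / 2 :: real^'d) s"
      have "modular p (?S - cube 0 1) F \<le> modular p UNIV (\<lambda>x :: real^'d. 0)"
        using vQ g0 by (intro modular_mono) (auto simp: F_def)
      then have 0: "modular p (?S - cube 0 1) F = 0" by (simp add: modular_0 p)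
      have "modular p ?S F \<le> modular p ((?S - cube 0 1) \<union> cube 0 1) F"
        by (intro modular_subset) auto
      also have "\<dots> \<le> modular p (?S - cube 0 1) F + modular p (cube 0 1) F"
        by (intro modular_Un p) auto
      also have "\<dots> = modular p (cube 0 1) F" unfolding 0 by simp
      also have "\<dots> = I * modular p ?Q g"
      proof -
        have "modular p ?Q g = J * modular p (stretch a c -` ?Q) (\<lambda>x. g (stretch a c x))"
          unfolding J_def by (rule modular_stretch[OF c]) auto
        then show ?thesis unfolding vQ F_def by (simp only: IJ(1))
      qed
      also have "\<dots> < \<infinity>" using fin by (simp add: I_def ennreal_mult_less_top)
      finally show "modular p ?S F < \<infinity>" .
    qed simp
    moreover have "axis_diffs p (cube 0 1) (r $ i) i F (I * ppow p ?\<Omega>)" for i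
      unfolding axis_diffs_def
    proof (intro allI impI)
      fix h :: real assume h: "\<bar>h\<bar> \<le> 1"
      let ?m = "r $ i"
      let ?T = "shift_dom ?Q ((real ?m * (c $ i * h)) *\<^sub>R axis i 1)"
      let ?G = "idiff i (replicate ?m (c $ i * h)) g"
      have "\<bar>c $ i * h\<bar> \<le> b $ i - a $ i"
        using h c[of i] mult_left_mono[OF h, of "c $ i"] by (simp add: abs_mult c_def)
      then have "modular p ?T ?G \<le> ppow p ?\<Omega>"
        by (intro modular_axis_diff_le p g ab) auto
      moreover have "modular p ?T ?G = J * modular p (stretch a c -` ?T) (\<lambda>x. ?G (stretch a c x))"
        unfolding J_def by (rule modular_stretch[OF c]) auto
      moreover have "stretch a c -` ?T = shift_dom (cube 0 1) ((real ?m * h) *\<^sub>R axis i 1)"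
        unfolding shift_dom_def vQ[symmetric] by (auto simp: stretch_axis mult_ac)
      moreover have "(\<lambda>x. ?G (stretch a c x)) = idiff i (replicate ?m h) F"
        unfolding F_def by (rule ext) (simp add: idiff_stretch)
      ultimately have "J * modular p (shift_dom (cube 0 1) ((real ?m * h) *\<^sub>R axis i 1)) (idiff i (replicate ?m h) F) \<le> ppow p ?\<Omega>"
        by simp
      then have "I * (J * modular p (shift_dom (cube 0 1) ((real ?m * h) *\<^sub>R axis i 1)) (idiff i (replicate ?m h) F)) \<le> I * ppow p ?\<Omega>"
        by (intro mult_left_mono) auto
      then show "modular p (shift_dom (cube 0 1) ((real ?m * h) *\<^sub>R axis i 1)) (idiff i (replicate ?m h) F) \<le> I * ppow p ?\<Omega>"
        unfolding IJ .
    qed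
    ultimately obtain \<phi> where \<phi>: "\<phi> \<in> polys r" "modular p (cube 0 1) (\<lambda>x. F x - \<phi> x) \<le> C1 * (I * ppow p ?\<Omega>)"
      using C1(2) by blast
    \<comment> \<open>The inverse of \<open>stretch a c\<close> is again a \<open>stretch\<close>,
      so \<open>polys_stretch\<close> applies.\<close>
    define \<psi> where "\<psi> = (\<lambda>x. \<phi> (stretch (\<chi> i. - a $ i / c $ i) (\<chi> i. 1 / c $ i) x))"
    have \<psi>: "\<psi> \<in> polys r" unfolding \<psi>_def by (rule polys_stretch[OF \<phi>(1)])
    note [measurable] = polys_measurable[OF \<psi>]
    have inv: "stretch (\<chi> i. - a $ i / c $ i) (\<chi> i. 1 / c $ i) (stretch a c x) = x" for x
      using c by (auto simp: stretch_def vec_eq_iff field_simps less_imp_neq[THEN not_sym])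
    have "modular p ?Q (\<lambda>x. g x - \<psi> x) = J * modular p (stretch a c -` ?Q) (\<lambda>x. g (stretch a c x) - \<psi> (stretch a c x))"
      unfolding J_def by (rule modular_stretch[OF c]) auto
    also have "\<dots> = J * modular p (cube 0 1) (\<lambda>x. F x - \<phi> x)"
      unfolding vQ F_def \<psi>_def inv ..
    also have "\<dots> \<le> J * (C1 * (I * ppow p ?\<Omega>))" by (intro mult_left_mono \<phi>) auto
    also have "\<dots> = C1 * ppow p ?\<Omega>" using IJ(2)[of "C1 * ppow p ?\<Omega>"] by (simp add: mult_ac)
    also have "\<dots> \<le> ppow p (ennreal C) * ppow p ?\<Omega>" by (intro mult_right_mono C) auto
    also have "\<dots> = ppow p (ennreal C * ?\<Omega>)" by (simp add: ppow_mult p)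
    finally have "Lp_norm p ?Q (\<lambda>x. f x - \<psi> x) \<le> ennreal C * ?\<Omega>"
      using g by (subst Lp_norm_le_iff[OF p]) (auto elim!: eventually_mono)
    then show "best_approx r f p ?Q \<le> ennreal C * ?\<Omega>"
      unfolding best_approx_def using \<psi> by (rule INF_lower2[rotated])
  qed
qed

theorem theorem1p1:
  fixes p :: ennreal and r :: "nat^'d"
  assumes "0 < p" and "\<And>i. 1 \<le> r $ i"
  shows "\<exists>C C' :: real. 0 < C \<and> 0 < C' \<and>
    (\<forall>a b :: real^'d. (\<forall>i. a $ i < b $ i) \<longrightarrow>
      (\<forall>f \<in> Lp_space p (cbox a b).
        ennreal C' * total_modulus r f (b - a) p (cbox a b) \<le> best_approx r f p (cbox a b) \<and>
        best_approx r f p (cbox a b) \<le> ennreal C * total_modulus r f (b - a) p (cbox a b)))"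
proof -
  obtain C where "0 < C" "\<And>(a :: real^'d) b f. (\<And>i. a $ i < b $ i) \<Longrightarrow> f \<in> Lp_space p (cbox a b) \<Longrightarrow>
      best_approx r f p (cbox a b) \<le> ennreal C * total_modulus r f (b - a) p (cbox a b)"
    using best_approx_le_total_modulus[OF assms] by blast
  moreover obtain C' where "0 < C'" "\<And>(a :: real^'d) b f t. f \<in> Lp_space p (cbox a b) \<Longrightarrow>
      ennreal C' * total_modulus r f t p (cbox a b) \<le> best_approx r f p (cbox a b)"
    using total_modulus_le_best_approx[OF assms(1)] by blast
  ultimately show ?thesis by blast
qed

end
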